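(* Let $(K,v)$ be a valued field, let $\overline{K}$ be an algebraic closure of $K$, let $\bar v$ be an extension of $v$ to $\overline{K}$, and let $(K^h,v^h)$ be the henselization of $(K,v)$ determined by $\bar v$. Let $\Lambda$ be a divisible ordered abelian group extending $v(K^* )$. Let $\mathcal{T}(K,\Lambda)$ be the poset of all $\Lambda$-valued valuations on $K[x]$ extending $v$, and let $\mathcal{T}(K^h,\Lambda)$ be the poset of all $\Lambda$-valued valuations on $K^h[x]$ extending $v^h$. Then the natural restriction mapping $\mathcal{T}(K^h,\Lambda)\to\mathcal{T}(K,\Lambda)$, $\eta\mapsto \eta_{|K[x]}$, is an isomorphism of posets.
   Context: All ordered abelian groups are totally ordered; $\Lambda\infty$ denotes $\Lambda\cup\{\infty\}$. A $\Lambda$-valued valuation on a commutative ring $R$ is a map $\mu\colon R\to\Lambda\infty$ with $\mu(0)=\infty$, $\mu(1)=0$, $\mu(fg)=\mu(f)+\mu(g)$, $\mu(f+g)\ge\min\{\mu(f),\mu(g)\}$; its support $\mu^{-1}(\infty)$ is a prime ideal which may be nonzero. Henselization: let $K^{\mathrm{sep}}$ be the separable closure of $K$ in $\overline K$. Then $K^h$ is the fixed field in $K^{\mathrm{sep}}$ of $\{\sigma\in\mathrm{Gal}(K^{\mathrm{sep}}/K)\mid \bar v\circ\sigma=\bar v\}$, and $v^h$ is the restriction of $\bar v$ to $K^h$. Write $\Gamma=v(K^* )$. An embedding $\Gamma\hookrightarrow\Lambda$ of ordered groups is fixed. As $\Lambda$ is divisible, it extends uniquely to the value group of $\bar v$ (which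 is identified with the divisible hull $\Gamma_{\mathbb Q}=\Gamma\otimes\mathbb Q$), so $\bar v$ and $v^h$ are regarded as taking values in $\Lambda\infty$. A valuation on $K[x]$ (resp. $K^h[x]$) extends $v$ (resp. $v^h$) if its restriction to $K$ (resp. $K^h$) is equal to $v$ (resp. $v^h$). The partial ordering on each of the two sets is: $\mu\le\nu$ if and only if $\mu(f)\le\nu(f)$ for all polynomials $f$ in the corresponding polynomial ring. *)

theory Defs
  imports "HOL-Computational_Algebra.Computational_Algebra" "HOL-Library.FuncSet"
begin

datatype 'l with_infinity = Fin 'l | Infty

instantiation with_infinity :: (linorder) linorder
begin

definition less_eq_with_infinity :: "'a with_infinity \<Rightarrow> 'a with_infinity \<Rightarrow> bool" where
  "x \<le> y \<longleftrightarrow> (case y of Infty \<Rightarrow> True | Fin b \<Rightarrow> (case x of Infty \<Rightarrow> False | Fin a \<Rightarrow> a \<le> b))"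

definition less_with_infinity :: "'a with_infinity \<Rightarrow> 'a with_infinity \<Rightarrow> bool" where
  "x < y \<longleftrightarrow> (case x of Infty \<Rightarrow> False | Fin a \<Rightarrow> (case y of Infty \<Rightarrow> True | Fin b \<Rightarrow> a < b))"

instance
  by standard
    (auto simp: less_eq_with_infinity_def less_with_infinity_def split: with_infinity.splits)

end

instantiation with_infinity :: (comm_monoid_add) comm_monoid_add
begin

definition zero_with_infinity :: "'a with_infinity" where
  "0 = Fin 0"

definition plus_with_infinity :: "'a with_infinity \<Rightarrow> 'a with_infinity \<Rightarrow> 'a with_infinity" where
  "x + y = (case x of Infty \<Rightarrow> Infty | Fin a \<Rightarrow> (case y of Infty \<Rightarrow> Infty | Fin b \<Rightarrow> Fin (a + b)))"

instance
  by standard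
    (auto simp: zero_with_infinity_def plus_with_infinity_def algebra_simps
      split: with_infinity.splits)

end

definition divisible_group :: "'l::ab_group_add itself \<Rightarrow> bool" where
  "divisible_group _ \<longleftrightarrow> (\<forall>n>0. \<forall>a::'l. \<exists>b. (\<Sum>i<(n::nat). b) = a)"

text \<open>
  All fields are subfields of one ambient algebraically closed field, given by a type.
  A function on a subring is a function on the whole type whose values outside the subring
  are irrelevant, or are normalised to \<open>undefined\<close> where equality of such functions matters.
\<close>

definition is_subfield :: "'a::field set \<Rightarrow> bool" where
  "is_subfield K \<longleftrightarrow> 0 \<in> K \<and> 1 \<in> K \<and>
     (\<forall>a\<in>K. \<forall>b\<in>K. a + b \<in> K \<and> a * b \<in> K) \<and>
     (\<forall>a\<in>K. - a \<in> K \<and> inverse a \<in> K)"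

definition polys_over :: "'a::zero set \<Rightarrow> 'a poly set" where
  "polys_over R = {p. \<forall>i. coeff p i \<in> R}"

definition algebraic_over :: "'a::field set \<Rightarrow> 'a \<Rightarrow> bool" where
  "algebraic_over K a \<longleftrightarrow> (\<exists>p\<in>polys_over K. p \<noteq> 0 \<and> poly p a = 0)"

definition is_algebraic_closure_of :: "'a::field set \<Rightarrow> bool" where
  "is_algebraic_closure_of K \<longleftrightarrow> is_subfield K \<and> (\<forall>a. algebraic_over K a)"

definition is_min_poly :: "'a::field set \<Rightarrow> 'a \<Rightarrow> 'a poly \<Rightarrow> bool" where
  "is_min_poly K a p \<longleftrightarrow> p \<in> polys_over K \<and> lead_coeff p = 1 \<and> poly p a = 0 \<and>
     (\<forall>q\<in>polys_over K. q \<noteq> 0 \<and> poly q a = 0 \<longrightarrow> degree p \<le> degree q)"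

text \<open>
  The ambient field is algebraically closed, so \<^const>\<open>rsquarefree\<close> says that the minimal
  polynomial has no multiple root in an algebraic closure.
\<close>

definition separable_over :: "'a::alg_closed_field set \<Rightarrow> 'a \<Rightarrow> bool" where
  "separable_over K a \<longleftrightarrow> (\<exists>p. is_min_poly K a p \<and> rsquarefree p)"

definition separable_closure :: "'a::alg_closed_field set \<Rightarrow> 'a set" where
  "separable_closure K = {a. separable_over K a}"

definition field_automorphisms_over :: "'a::field set \<Rightarrow> 'a set \<Rightarrow> ('a \<Rightarrow> 'a) set" where
  "field_automorphisms_over K E =
     {\<sigma> \<in> extensional E. bij_betw \<sigma> E E \<and>
        (\<forall>a\<in>E. \<forall>b\<in>E. \<sigma> (a + b) = \<sigma> a + \<sigma> b \<and> \<sigma> (a * b) = \<sigma> a * \<sigma> b) \<and>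
        (\<forall>a\<in>K. \<sigma> a = a)}"

definition valuation_on :: "'r::comm_ring_1 set \<Rightarrow> ('r \<Rightarrow> 'l::linordered_ab_group_add with_infinity) \<Rightarrow> bool" where
  "valuation_on R \<mu> \<longleftrightarrow> \<mu> 0 = Infty \<and> \<mu> 1 = 0 \<and>
     (\<forall>f\<in>R. \<forall>g\<in>R. \<mu> (f * g) = \<mu> f + \<mu> g \<and> min (\<mu> f) (\<mu> g) \<le> \<mu> (f + g))"

definition henselization ::
    "'a::alg_closed_field set \<Rightarrow> ('a \<Rightarrow> 'l::linordered_ab_group_add with_infinity) \<Rightarrow> 'a set" where
  "henselization K vbar =
     {a \<in> separable_closure K.
        \<forall>\<sigma>\<in>field_automorphisms_over K (separable_closure K).
          (\<forall>b\<in>separable_closure K. vbar (\<sigma> b) = vbar b) \<longrightarrow> \<sigma> a = a}"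

definition henselized_valuation ::
    "'a::alg_closed_field set \<Rightarrow> ('a \<Rightarrow> 'l::linordered_ab_group_add with_infinity) \<Rightarrow>
     'a \<Rightarrow> 'l with_infinity" where
  "henselized_valuation K vbar = restrict vbar (henselization K vbar)"

definition valuation_extensions ::
    "'a::field set \<Rightarrow> ('a \<Rightarrow> 'l::linordered_ab_group_add with_infinity) \<Rightarrow>
     ('a poly \<Rightarrow> 'l with_infinity) set" where
  "valuation_extensions K v =
     {\<mu> \<in> extensional (polys_over K). valuation_on (polys_over K) \<mu> \<and> (\<forall>a\<in>K. \<mu> [:a:] = v a)}"

definition pointwise_le_on :: "'r set \<Rightarrow> ('r \<Rightarrow> 'b::ord) \<Rightarrow> ('r \<Rightarrow> 'b) \<Rightarrow> bool" where
  "pointwise_le_on R \<mu> \<nu> \<longleftrightarrow> (\<forall>f\<in>R. \<mu> f \<le> \<nu> f)"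

definition poset_isomorphism ::
    "'x set \<Rightarrow> ('x \<Rightarrow> 'x \<Rightarrow> bool) \<Rightarrow> 'y set \<Rightarrow> ('y \<Rightarrow> 'y \<Rightarrow> bool) \<Rightarrow> ('x \<Rightarrow> 'y) \<Rightarrow> bool" where
  "poset_isomorphism A leA B leB \<phi> \<longleftrightarrow>
     bij_betw \<phi> A B \<and> (\<forall>x\<in>A. \<forall>y\<in>A. leA x y \<longleftrightarrow> leB (\<phi> x) (\<phi> y))"

end

(*
Idea. Valuations are studied on the polynomial ring over the algebraic closure. Given a valuation \<mu>
on K[x] extending v, Chevalley's theorem extends it to the algebraic closure, and since any two
extensions are conjugate over K, the extension can be chosen to restrict to vbar on constants; this
gives surjectivity. Two extensions of \<mu> that both restrict to vbar are conjugate by an automorphism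
that preserves vbar, hence fixes the henselization, so they agree over it; this gives injectivity.

Conjugacy is proved by Zorn's lemma for partial isomorphisms. When a is adjoined, a value on the
larger field is a slope of a Newton polygon, so it is attained by some conjugate; a product
A^t * B with suitable t shows that a single conjugate serves for all elements.

The inverse map is monotone: if \<mu> \<le> \<mu>' on K[x] are different and q in K[x] has least degree with
\<mu> q < \<mu>' q, then \<mu> is determined on q-adic expansions by its values in degree below deg q, where it
agrees with \<mu>', and by its value at q. The Gauss valuation centred at the root of q closest to \<mu>',
with radius chosen so as to reproduce \<mu> q, therefore restricts to \<mu>, and it lies below every
extension of \<mu>' for which that root is closest.
*)

theory Submission
  imports "HOL-Algebra.Algebraic_Closure_Type" Defs
begin

section \<open>Valuations\<close>

text \<open>Two obstacles shape the proof. First, a valuation on K[x] may have nonzero support and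
  then does not extend to rational functions. Zero support leads to the field K(X), nonzero support
  to evaluation at an algebraic element, and both extension and conjugacy are proved separately in
  the two cases. Secondly, injectivity of restriction does not by itself make the inverse monotone,
  since nothing relates the two preimages. The Gauss valuation is a competitor for the smaller
  preimage that visibly lies below the larger one, and uniqueness over the henselization identifies
  it with the smaller preimage. Field theory is done with graphs of partial homomorphisms:
  embeddings into an algebraically closed field take the place of splitting fields and Galois
  groups. With dual numbers as target the graphs are derivations, which show that the separable
  elements form a field, and hence that the henselization does. Divisibility of \<Lambda> enters
  where n * t = c has to be solved: for the radius of the Gauss valuation and for the values of
  algebraic elements.\<close>

lemma with_infinity_simps [simp]:
  fixes a b :: "'l::comm_monoid_add" and x :: "'l with_infinity"
  shows "Fin a + Fin b = Fin (a + b)" "Infty + x = Infty" "x + Infty = Infty"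
    "x + Fin 0 = x" "Fin 0 + x = x"
  by (auto simp: plus_with_infinity_def split: with_infinity.splits)

lemma with_infinity_le_simps [simp]:
  fixes a b :: "'l::linorder" and x :: "'l with_infinity"
  shows "Fin a \<le> Fin b \<longleftrightarrow> a \<le> b" "Fin a < Fin b \<longleftrightarrow> a < b" "x \<le> Infty"
    "Infty \<le> x \<longleftrightarrow> x = Infty" "\<not> Infty < x" "Fin a < Infty"
  by (auto simp: less_eq_with_infinity_def less_with_infinity_def split: with_infinity.splits)

lemma zero_with_infinity_Fin: "0 = Fin 0"
  by (simp add: zero_with_infinity_def)

lemma plus_eq_Infty_iff [simp]:
  fixes x y :: "'l::comm_monoid_add with_infinity"
  shows "x + y = Infty \<longleftrightarrow> x = Infty \<or> y = Infty"
  by (cases x; cases y) auto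

lemma less_InftyE:
  assumes "x < (y :: 'l::linorder with_infinity)"
  obtains a where "x = Fin a"
  using assms by (cases x) auto

lemma neq_InftyE:
  assumes "x \<noteq> Infty"
  obtains a where "x = Fin a"
  using assms by (cases x) auto

instance with_infinity :: (linordered_ab_group_add) ordered_comm_monoid_add
proof
  fix a b c :: "'a with_infinity"
  show "a \<le> b \<Longrightarrow> c + a \<le> c + b"
    by (cases a; cases b; cases c) auto
qed

lemma with_infinity_add_less_mono:
  fixes a b c d :: "'l::linordered_ab_group_add with_infinity"
  assumes "a < b" "c \<le> d" "c \<noteq> Infty"
  shows "a + c < b + d"
  using assms by (cases a; cases b; cases c; cases d) (auto intro: add_less_le_mono)

lemma with_infinity_add_Fin_iff [simp]:
  fixes x y :: "'l::linordered_ab_group_add with_infinity"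
  shows "x + Fin a < y + Fin a \<longleftrightarrow> x < y" "x + Fin a \<le> y + Fin a \<longleftrightarrow> x \<le> y"
  by (cases x; cases y; simp)+

text \<open>Formulated for commutative monoids, so that it applies to \<Lambda> with and without
  infinity; the sum is the one in \<open>divisible_group\<close>.\<close>

definition nsmul :: "nat \<Rightarrow> 'l \<Rightarrow> 'l::comm_monoid_add" where
  "nsmul n a = (\<Sum>i<n. a)"

lemma nsmul_simps [simp]: "nsmul 0 a = 0" "nsmul (Suc n) a = a + nsmul n a" "nsmul 1 a = a"
  by (simp_all add: nsmul_def add.commute)

lemma nsmul_zero [simp]: "nsmul n 0 = 0"
  by (simp add: nsmul_def)

lemma nsmul_add: "nsmul (m + n) a = nsmul m a + nsmul n a"
  by (induction m) (auto simp: add.assoc)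

lemma nsmul_distrib: "nsmul n (a + b) = nsmul n a + nsmul n b"
  by (induction n) (auto simp: algebra_simps)

lemma nsmul_nsmul: "nsmul m (nsmul n a) = nsmul (m * n) a"
  by (induction m) (auto simp: nsmul_add)

lemma nsmul_Fin [simp]: "nsmul n (Fin a) = Fin (nsmul n (a::'l::comm_monoid_add))"
  by (induction n) (auto simp: zero_with_infinity_Fin)

lemma nsmul_mono:
  fixes a b :: "'l::ordered_comm_monoid_add"
  assumes "a \<le> b" shows "nsmul n a \<le> nsmul n b"
  using assms by (induction n) (auto intro: add_mono)

lemma nsmul_strict_mono:
  fixes a b :: "'l::linordered_ab_group_add"
  assumes "a < b" "n > 0" shows "nsmul n a < nsmul n b"
  using assms(2,1)
proof (induction n)
  case (Suc n)
  then show ?case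
    using nsmul_mono[of a b n] by (auto intro: add_less_le_mono)
qed simp

lemma nsmul_cancel [simp]:
  fixes a b :: "'l::linordered_ab_group_add"
  assumes "n > 0" shows "nsmul n a = nsmul n b \<longleftrightarrow> a = b"
  using assms nsmul_strict_mono[of a b n] nsmul_strict_mono[of b a n]
  by (metis less_irrefl linorder_less_linear)

lemma nsmul_le_cancel [simp]:
  fixes a b :: "'l::linordered_ab_group_add"
  assumes "n > 0" shows "nsmul n a \<le> nsmul n b \<longleftrightarrow> a \<le> b"
  using assms nsmul_strict_mono[of b a n] nsmul_mono[of a b n]
  by (metis linorder_not_le)

lemma nsmul_uminus: "nsmul n (- a) = - nsmul n (a :: 'l::ab_group_add)"
  by (induction n) auto

lemma divisible_nsmul:
  assumes "divisible_group TYPE('l::ab_group_add)" "n > 0"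
  obtains b where "nsmul n b = (a::'l)"
  using assms unfolding divisible_group_def nsmul_def by blast

section \<open>Valuations of a whole ring and the ultrametric rules\<close>

locale valuation =
  fixes w :: "'r::comm_ring_1 \<Rightarrow> 'l::linordered_ab_group_add with_infinity"
  assumes valuation_UNIV: "valuation_on UNIV w"
begin

lemma val_0 [simp]: "w 0 = Infty" and val_1 [simp]: "w 1 = 0"
  and val_mult: "w (x * y) = w x + w y"
  and val_add: "min (w x) (w y) \<le> w (x + y)"
  using valuation_UNIV unfolding valuation_on_def by auto

lemma val_power: "w (x ^ n) = nsmul n (w x)"
  by (induction n) (auto simp: val_mult)

lemma val_minus_1 [simp]: "w (- 1) = 0"
proof -
  have eq: "w (- 1) + w (- 1) = Fin 0"
    using val_mult[of "-1" "-1"] by (simp add: zero_with_infinity_Fin)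
  then obtain a where a: "w (- 1) = Fin a"
    by (cases "w (- 1)") auto
  with eq have "a = 0"
    by simp
  with a show ?thesis
    by (simp add: zero_with_infinity_Fin)
qed

lemma val_minus [simp]: "w (- x) = w x"
  using val_mult[of "-1" x] by simp

lemma val_diff: "min (w x) (w y) \<le> w (x - y)"
  using val_add[of x "- y"] by simp

lemma val_add_ge: "c \<le> w x \<Longrightarrow> c \<le> w y \<Longrightarrow> c \<le> w (x + y)"
  using val_add[of x y] by (metis min.boundedI order_trans)

lemma val_add_gt: "c < w x \<Longrightarrow> c < w y \<Longrightarrow> c < w (x + y)"
  using val_add[of x y] by (metis min_less_iff_conj order_less_le_trans)

lemma val_add_eq:
  assumes "w x < w y"
  shows "w (x + y) = w x"
proof (rule antisym)
  show "w x \<le> w (x + y)"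
    using assms by (intro val_add_ge) auto
  show "w (x + y) \<le> w x"
  proof (rule ccontr)
    assume "\<not> w (x + y) \<le> w x"
    then have "w x < w ((x + y) + (- y))"
      using assms by (intro val_add_gt[of "w x" "x + y" "- y"]) (auto simp: not_le)
    then have "w x < w x"
      by simp
    then show False by simp
  qed
qed

lemma val_sum_ge:
  assumes "\<And>i. i \<in> A \<Longrightarrow> c \<le> w (f i)"
  shows "c \<le> w (sum f A)"
  using assms by (induction A rule: infinite_finite_induct) (auto intro: val_add_ge)

lemma val_sum_gt:
  assumes "\<And>i. i \<in> A \<Longrightarrow> c < w (f i)" "c < Infty"
  shows "c < w (sum f A)"
  using assms by (induction A rule: infinite_finite_induct) (auto intro: val_add_gt)

lemma val_sum_eq:
  assumes "finite A" "i \<in> A" "w (f i) < Infty" "\<And>j. j \<in> A - {i} \<Longrightarrow> w (f i) < w (f j)"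
  shows "w (sum f A) = w (f i)"
proof -
  have "w (f i) < w (sum f (A - {i}))"
    using assms by (intro val_sum_gt) auto
  then show ?thesis
    using assms by (simp add: sum.remove[of A i] val_add_eq)
qed

lemma val_prod_mset: "w (\<Prod>x\<in>#A. f x) = (\<Sum>x\<in>#A. w (f x))"
  by (induction A) (auto simp: val_mult)

lemma val_unit:
  assumes "x * y = 1"
  obtains a where "w x = Fin a"
  using val_mult[of x y] assms by (cases "w x") (auto simp: zero_with_infinity_Fin)

end

locale field_valuation = valuation w
  for w :: "'r::field \<Rightarrow> 'l::linordered_ab_group_add with_infinity"
begin

lemma val_eq_Infty_iff [simp]: "w x = Infty \<longleftrightarrow> x = 0"
proof
  assume inf: "w x = Infty"
  show "x = 0"
  proof (rule ccontr)
    assume "x \<noteq> 0"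
    then obtain a where "w x = Fin a"
      using val_unit[of x "inverse x"] by (metis right_inverse)
    with inf show False by simp
  qed
qed simp

lemma val_inverse:
  assumes "x \<noteq> 0" "w x = Fin a"
  shows "w (inverse x) = Fin (- a)"
proof -
  have "w x + w (inverse x) = Fin 0"
    unfolding val_mult[symmetric] using assms(1) by (simp add: zero_with_infinity_Fin)
  with assms(2) show ?thesis
    by (cases "w (inverse x)") (simp_all add: minus_unique)
qed

end

lemma degree_pos_of_root: "p \<noteq> 0 \<Longrightarrow> poly p a = 0 \<Longrightarrow> 0 < degree p"
  by (auto intro!: gr0I elim!: degree_eq_zeroE)

section \<open>Gauss valuations\<close>

abbreviation gauss_term ::
    "('a::field \<Rightarrow> 'l::linordered_ab_group_add with_infinity) \<Rightarrow> 'l \<Rightarrow> 'a poly \<Rightarrow> nat \<Rightarrow> 'l with_infinity" where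
  "gauss_term w t f i \<equiv> w (coeff f i) + Fin (nsmul i t)"

text \<open>The Gauss valuation that gives the variable the value \<open>t\<close>. The index set is
  nonempty also for \<open>f = 0\<close>, where the only term is \<open>Infty\<close>.\<close>

definition gauss ::
    "('a::field \<Rightarrow> 'l::linordered_ab_group_add with_infinity) \<Rightarrow> 'l \<Rightarrow> 'a poly \<Rightarrow> 'l with_infinity" where
  "gauss w t f = Min (gauss_term w t f ` {..degree f})"

context field_valuation
begin

lemma gauss_le: "gauss w t f \<le> gauss_term w t f i"
  unfolding gauss_def
  by (cases "i \<le> degree f") (auto simp: coeff_eq_0 intro!: Min_le)

text \<open>The first minimal index is recorded because multiplicativity pairs the first minimal
  terms of the two factors.\<close>

lemma gauss_attained:
  obtains i where "gauss w t f = gauss_term w t f i"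
    "\<And>j. j < i \<Longrightarrow> gauss w t f < gauss_term w t f j"
proof -
  let ?h = "gauss_term w t f"
  have "Min (?h ` {..degree f}) \<in> ?h ` {..degree f}"
    by (intro Min_in) auto
  then have ex: "\<exists>i. gauss w t f = ?h i"
    unfolding gauss_def by blast
  define i where "i = (LEAST i. gauss w t f = ?h i)"
  have "gauss w t f = ?h i"
    unfolding i_def using ex by (rule LeastI_ex)
  moreover have "gauss w t f < ?h j" if "j < i" for j
    using not_less_Least[OF that[unfolded i_def]] gauss_le[of t f j] by (simp add: order_le_less)
  ultimately show thesis
    using that by blast
qed

lemma gauss_ge:
  assumes "\<And>i. c \<le> gauss_term w t f i"
  shows "c \<le> gauss w t f"
  using gauss_attained[of t f] assms by metis

lemma gauss_eq_Infty_iff [simp]: "gauss w t f = Infty \<longleftrightarrow> f = 0"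
proof
  assume "gauss w t f = Infty"
  then have "coeff f i = 0" for i
    using gauss_le[of t f i] by auto
  then show "f = 0"
    by (simp add: poly_eq_iff)
next
  show "f = 0 \<Longrightarrow> gauss w t f = Infty"
    by (simp add: gauss_def)
qed

lemma gauss_const [simp]: "gauss w t [:a:] = w a"
  by (simp add: gauss_def zero_with_infinity_Fin)

lemma gauss_linear: "gauss w t [:a, 1:] = min (w a) (Fin t)"
proof -
  have "{..degree [:a, 1:]} = {0, 1}"
    by auto
  then show ?thesis
    unfolding gauss_def by (simp add: zero_with_infinity_Fin del: One_nat_def) simp
qed

lemma gauss_term_product:
  "i \<le> n \<Longrightarrow> w (coeff f i * coeff g (n - i)) + Fin (nsmul n t) = gauss_term w t f i + gauss_term w t g (n - i)"
  using nsmul_add[of i "n - i" t] by (simp add: val_mult ac_simps flip: with_infinity_simps(1))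

lemma gauss_term_mult_ge:
  assumes "\<And>i. i \<le> n \<Longrightarrow> c \<le> gauss_term w t f i + gauss_term w t g (n - i)"
  shows "c \<le> gauss_term w t (f * g) n"
proof -
  \<comment> \<open>Values may be infinite, so the common weight is removed by adding a finite
    negative instead of subtracting.\<close>
  have c: "c = (c + Fin (- nsmul n t)) + Fin (nsmul n t)"
    by (simp add: add.assoc)
  have "c + Fin (- nsmul n t) \<le> w (coeff (f * g) n)"
    unfolding coeff_mult
  proof (rule val_sum_ge)
    fix i assume "i \<in> {..n}"
    then have "(c + Fin (- nsmul n t)) + Fin (nsmul n t) \<le> w (coeff f i * coeff g (n - i)) + Fin (nsmul n t)"
      using assms gauss_term_product[of i n] unfolding c[symmetric] by simp
    then show "c + Fin (- nsmul n t) \<le> w (coeff f i * coeff g (n - i))"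
      by simp
  qed
  then show ?thesis
    by (subst c) simp
qed

lemma gauss_term_mult_gt:
  assumes "\<And>i. i \<le> n \<Longrightarrow> c < gauss_term w t f i + gauss_term w t g (n - i)"
  shows "c < gauss_term w t (f * g) n"
proof -
  have "c < Infty"
    using order_less_le_trans[OF assms[of 0], of Infty] by simp
  have c: "c = (c + Fin (- nsmul n t)) + Fin (nsmul n t)"
    by (simp add: add.assoc)
  have "c + Fin (- nsmul n t) < w (coeff (f * g) n)"
    unfolding coeff_mult
  proof (rule val_sum_gt)
    fix i assume "i \<in> {..n}"
    then have "(c + Fin (- nsmul n t)) + Fin (nsmul n t) < w (coeff f i * coeff g (n - i)) + Fin (nsmul n t)"
      using assms gauss_term_product[of i n] unfolding c[symmetric] by simp
    then show "c + Fin (- nsmul n t) < w (coeff f i * coeff g (n - i))"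
      by simp
  qed (use \<open>c < Infty\<close> in \<open>cases c; simp\<close>)
  then show ?thesis
    by (subst c) simp
qed

text \<open>One summand of the convolution is strictly smallest, so it cannot be cancelled. For the
  Gauss valuation it comes from the first minimal terms, for Newton polygons from the unique minimal
  terms.\<close>

lemma gauss_term_mult_eq:
  assumes "\<And>i j. i + j = k + l \<Longrightarrow> i \<noteq> k \<Longrightarrow>
      gauss_term w t f k + gauss_term w t g l < gauss_term w t f i + gauss_term w t g j"
    and fin: "gauss_term w t f k + gauss_term w t g l \<noteq> Infty"
  shows "gauss_term w t (f * g) (k + l) = gauss_term w t f k + gauss_term w t g l"
proof -
  have kl: "w (coeff f k * coeff g l) + Fin (nsmul (k + l) t) = gauss_term w t f k + gauss_term w t g l"
    using gauss_term_product[of k "k + l"] by simp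
  have "w (coeff (f * g) (k + l)) = w (coeff f k * coeff g (k + l - k))"
    unfolding coeff_mult
  proof (rule val_sum_eq)
    show "w (coeff f k * coeff g (k + l - k)) < Infty"
      using fin kl by (cases "w (coeff f k * coeff g l)") auto
    fix i assume i: "i \<in> {..k + l} - {k}"
    then have "w (coeff f k * coeff g l) + Fin (nsmul (k + l) t)
        < w (coeff f i * coeff g (k + l - i)) + Fin (nsmul (k + l) t)"
      using assms(1)[of i "k + l - i"] gauss_term_product[of i "k + l"] kl by simp
    then show "w (coeff f k * coeff g (k + l - k)) < w (coeff f i * coeff g (k + l - i))"
      by simp
  qed auto
  with kl show ?thesis by simp
qed

lemma gauss_mult: "gauss w t (f * g) = gauss w t f + gauss w t g"
proof (cases "f = 0 \<or> g = 0")
  case False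
  then have fin: "gauss w t f \<noteq> Infty" "gauss w t g \<noteq> Infty"
    by auto
  show ?thesis
  proof (rule antisym)
    show "gauss w t f + gauss w t g \<le> gauss w t (f * g)"
      by (intro gauss_ge gauss_term_mult_ge add_mono gauss_le)
  next
    obtain i where i: "gauss w t f = gauss_term w t f i" "\<And>j. j < i \<Longrightarrow> gauss w t f < gauss_term w t f j"
      using gauss_attained by blast
    obtain j where j: "gauss w t g = gauss_term w t g j" "\<And>i. i < j \<Longrightarrow> gauss w t g < gauss_term w t g i"
      using gauss_attained by blast
    \<comment> \<open>Off the pair \<open>(i, j)\<close>, either \<open>k < i\<close> or
      \<open>l < j\<close>, and a term before the first minimal one is strictly larger.\<close>
    have "gauss w t f + gauss w t g < gauss_term w t f k + gauss_term w t g l" if k: "k + l = i + j" "k \<noteq> i" for k l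
    proof (cases "k < i")
      case True
      then show ?thesis
        by (rule with_infinity_add_less_mono[OF i(2) gauss_le fin(2)])
    next
      case False
      then have "l < j" using k by auto
      from with_infinity_add_less_mono[OF j(2)[OF this] gauss_le[of t f k] fin(1)] show ?thesis
        by (simp only: add.commute)
    qed
    then have "gauss_term w t (f * g) (i + j) = gauss w t f + gauss w t g"
      using gauss_term_mult_eq[where k = i and l = j and f = f and g = g and t = t] fin unfolding i(1) j(1) by simp
    then show "gauss w t (f * g) \<le> gauss w t f + gauss w t g"
      using gauss_le[of t "f * g" "i + j"] by simp
  qed
next
  case True
  have "gauss w t 0 = Infty" by simp
  with True show ?thesis
    by (elim disjE) (simp_all only: mult_zero_left mult_zero_right with_infinity_simps)
qed

lemma valuation_gauss: "valuation (gauss w t)"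
proof
  have "min (gauss w t f) (gauss w t g) \<le> gauss w t (f + g)" for f g
  proof (rule gauss_ge)
    fix i
    have "min (gauss w t f) (gauss w t g)
        \<le> min (gauss_term w t f i) (gauss_term w t g i)"
      by (intro min.mono gauss_le)
    also have "\<dots> \<le> w (coeff (f + g) i) + Fin (nsmul i t)"
      using val_add[of "coeff f i" "coeff g i"]
      by (cases "w (coeff f i)"; cases "w (coeff g i)"; cases "w (coeff f i + coeff g i)")
        (auto simp: min_def split: if_splits)
    finally show "min (gauss w t f) (gauss w t g) \<le> w (coeff (f + g) i) + Fin (nsmul i t)" .
  qed
  then show "valuation_on UNIV (gauss w t)"
    unfolding valuation_on_def using gauss_const[of t 1] by (simp add: gauss_mult one_pCons)
qed

end

text \<open>The composed polynomial has the Taylor coefficients of \<open>f\<close> at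
  \<open>\<theta>\<close>. This is the valuation of the closed ball with centre
  \<open>\<theta>\<close> and radius \<open>t\<close>; it gives x - \<open>\<theta>\<close> the
  value \<open>t\<close>.\<close>

definition gauss_at :: "('a::field \<Rightarrow> 'l::linordered_ab_group_add with_infinity) \<Rightarrow> 'a \<Rightarrow> 'l
    \<Rightarrow> 'a poly \<Rightarrow> 'l with_infinity" where
  "gauss_at w \<theta> t f = gauss w t (pcompose f [:\<theta>, 1:])"

context field_valuation
begin

lemma valuation_gauss_at: "valuation (gauss_at w \<theta> t)"
proof -
  interpret g: valuation "gauss w t"
    by (rule valuation_gauss)
  show ?thesis
    by standard (simp add: valuation_on_def gauss_at_def pcompose_mult pcompose_add pcompose_1
        g.val_mult g.val_add)
qed

lemma gauss_at_eq_Infty_iff [simp]: "gauss_at w \<theta> t f = Infty \<longleftrightarrow> f = 0"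
  by (simp add: gauss_at_def pcompose_eq_0_iff)

lemma gauss_at_const [simp]: "gauss_at w \<theta> t [:a:] = w a"
  by (simp add: gauss_at_def)

lemma gauss_at_linear: "gauss_at w \<theta> t [:- a, 1:] = min (w (\<theta> - a)) (Fin t)"
  by (simp add: gauss_at_def pcompose_pCons gauss_linear)

lemma gauss_at_mono:
  assumes "s \<le> t"
  shows "gauss_at w \<theta> s f \<le> gauss_at w \<theta> t f"
  unfolding gauss_at_def
proof (rule gauss_ge)
  fix i
  show "gauss w s (pcompose f [:\<theta>, 1:]) \<le> w (coeff (pcompose f [:\<theta>, 1:]) i) + Fin (nsmul i t)"
    using gauss_le[of s "pcompose f [:\<theta>, 1:]" i] nsmul_mono[OF assms, of i]
    by (meson add_left_mono order_trans with_infinity_le_simps(1))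
qed

text \<open>The value \<open>t\<close> is read off the Newton polygon of \<open>q\<close> at \<open>\<theta>\<close>.\<close>

lemma gauss_at_solve:
  assumes div: "divisible_group TYPE('l)" and q: "poly q \<theta> = 0" "q \<noteq> 0"
  obtains t where "gauss_at w \<theta> t q = Fin c"
proof -
  define h where "h = pcompose q [:\<theta>, 1:]"
  have "h \<noteq> 0"
    using q by (simp add: h_def pcompose_eq_0_iff)
  have h0: "coeff h 0 = 0"
    using q by (simp add: h_def coeff_pcompose_0)
  define S where "S = {i. coeff h i \<noteq> 0}"
  have finS: "finite S"
    unfolding S_def by (rule finite_subset[of _ "{..degree h}"]) (auto intro: le_degree)
  have "S \<noteq> {}"
    using \<open>h \<noteq> 0\<close> by (auto simp: S_def poly_eq_iff)
  \<comment> \<open>The constant coefficient vanishes because \<open>\<theta>\<close> is a root of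
    \<open>q\<close>, so every index that occurs can be divided by.\<close>
  have pos: "i > 0" if "i \<in> S" for i
    using that h0 by (cases i) (auto simp: S_def)
  have "\<exists>t. gauss_term w t h i = Fin c" if "i \<in> S" for i
  proof -
    have "w (coeff h i) \<noteq> Infty"
      using that by (auto simp: S_def)
    then obtain a where a: "w (coeff h i) = Fin a"
      by (rule neq_InftyE)
    obtain t where "nsmul i t = c - a"
      using divisible_nsmul[OF div, of i "c - a"] pos[OF \<open>i \<in> S\<close>] by blast
    with a show ?thesis by (auto intro!: exI[of _ t])
  qed
  then obtain T where T: "w (coeff h i) + Fin (nsmul i (T i)) = Fin c" if "i \<in> S" for i
    by metis
  \<comment> \<open>The term with index \<open>i\<close> reaches \<open>c\<close> exactly at
    \<open>T i\<close> and grows with the radius. At the largest \<open>T i\<close> one term equals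
    \<open>c\<close> and all others are at least \<open>c\<close>.\<close>
  define t where "t = Max (T ` S)"
  obtain i where i: "i \<in> S" "t = T i"
    using Max_in[of "T ` S"] finS \<open>S \<noteq> {}\<close> unfolding t_def by (auto simp del: Max_in)
  have "gauss w t h = Fin c"
  proof (rule antisym)
    show "gauss w t h \<le> Fin c"
      using gauss_le[of t h i] T i by simp
    show "Fin c \<le> gauss w t h"
    proof (rule gauss_ge)
      fix j
      show "Fin c \<le> gauss_term w t h j"
      proof (cases "j \<in> S")
        case True
        then have "T j \<le> t"
          using finS by (simp add: t_def)
        then have "Fin (nsmul j (T j)) \<le> Fin (nsmul j t)"
          by (simp add: nsmul_mono)
        then show ?thesis
          using T[OF True] by (metis add_left_mono)
      qed (simp add: S_def)
    qed
  qed
  then show thesis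
    using that by (simp add: gauss_at_def h_def)
qed

end

section \<open>Comparison of arbitrary valuations with Gauss valuations\<close>

lemma pcompose_conv_sum: "pcompose p q = (\<Sum>i\<le>degree p. smult (coeff p i) (q ^ i))"
proof (induction p)
  case (pCons a p)
  show ?case
  proof (cases "p = 0")
    case False
    then show ?thesis
      using pCons(2)
      by (simp add: pcompose_pCons sum.atMost_Suc_shift sum_distrib_left del: sum.atMost_Suc)
  qed simp
qed simp

lemma pcompose_shift_back: "pcompose (pcompose f [:a, 1:]) [:- a, 1:] = (f :: 'a::comm_ring_1 poly)"
  by (simp add: pcompose_assoc[symmetric] pcompose_pCons)

text \<open>The Taylor expansion at \<open>\<theta>\<close> and the ultrametric inequality bound
  \<open>om f\<close> from below by the terms of the Gauss valuation, which is thus the least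
  valuation with these constants and value at least \<open>t\<close> at x -
  \<open>\<theta>\<close>.\<close>

lemma (in field_valuation) gauss_at_le_extension:
  assumes "valuation om" and const: "\<And>a. om [:a:] = w a" and t: "Fin t \<le> om [:- \<theta>, 1:]"
  shows "gauss_at w \<theta> t f \<le> om f"
proof -
  interpret om: valuation om by fact
  define h where "h = pcompose f [:\<theta>, 1:]"
  have f: "f = (\<Sum>i\<le>degree h. smult (coeff h i) ([:- \<theta>, 1:] ^ i))"
    unfolding pcompose_conv_sum[symmetric] h_def by (simp add: pcompose_shift_back)
  show ?thesis
    unfolding gauss_at_def h_def[symmetric]
  proof (subst f, rule om.val_sum_ge)
    fix i
    have "Fin (nsmul i t) \<le> om ([:- \<theta>, 1:] ^ i)"
      using nsmul_mono[OF t, of i] by (simp add: om.val_power)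
    moreover have "om (smult (coeff h i) ([:- \<theta>, 1:] ^ i)) = w (coeff h i) + om ([:- \<theta>, 1:] ^ i)"
      using om.val_mult[of "[:coeff h i:]" "[:- \<theta>, 1:] ^ i"] by (simp add: const)
    ultimately show "gauss w t h \<le> om (smult (coeff h i) ([:- \<theta>, 1:] ^ i))"
      using gauss_le[of t h i] by (metis add_left_mono order_trans)
  qed
qed

lemma val_poly_split:
  fixes f :: "'a::alg_closed_field poly"
  assumes "valuation om" "f \<noteq> 0"
  obtains A where "set_mset A = {a. poly f a = 0}"
    "f = smult (lead_coeff f) (\<Prod>a\<in>#A. [:- a, 1:])"
    "om f = om [:lead_coeff f:] + (\<Sum>a\<in>#A. om [:- a, 1:])"
proof -
  interpret valuation om by fact
  obtain A where A: "f = smult (lead_coeff f) (\<Prod>a\<in>#A. [:- a, 1:])"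
    using alg_closed_imp_factorization[OF assms(2)] by blast
  have "poly f a = lead_coeff f * (\<Prod>b\<in>#A. a - b)" for a
    using arg_cong[OF A, of "\<lambda>g. poly g a"] by (simp only: poly_smult poly_prod_mset) simp
  then have "set_mset A = {a. poly f a = 0}"
    using assms(2) by (auto simp: prod_mset_zero_iff)
  moreover have "om f = om [:lead_coeff f:] + (\<Sum>a\<in>#A. om [:- a, 1:])"
    using val_mult[of "[:lead_coeff f:]" "\<Prod>a\<in>#A. [:- a, 1:]"]
      arg_cong[OF A, of om] by (simp only: val_prod_mset mult_pCons_left) simp
  ultimately show thesis
    using that A by blast
qed

text \<open>Multiplicativity reduces the claim to linear factors. As x - \<open>\<theta>\<close> has
  the largest value among them, the ultrametric triangle formed by x - a, x -
  \<open>\<theta>\<close> and \<open>\<theta> - a\<close> forces the value of x - a to be the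
  minimum of the other two.\<close>

lemma gauss_at_maximal_root:
  fixes om :: "'a::alg_closed_field poly \<Rightarrow> 'l::linordered_ab_group_add with_infinity"
  assumes "valuation om" "valuation w" and const: "\<And>a. om [:a:] = w a" and "q \<noteq> 0"
    and max: "\<And>a. poly q a = 0 \<Longrightarrow> om [:- a, 1:] \<le> om [:- \<theta>, 1:]"
    and e: "om [:- \<theta>, 1:] = Fin e"
  shows "gauss_at w \<theta> e q = om q"
proof -
  interpret om: valuation om by fact
  interpret w: field_valuation w by (rule field_valuation.intro) fact
  interpret g: valuation "gauss_at w \<theta> e"
    by (rule w.valuation_gauss_at)
  obtain A where A: "set_mset A = {a. poly q a = 0}"
    "q = smult (lead_coeff q) (\<Prod>a\<in>#A. [:- a, 1:])"
    "om q = om [:lead_coeff q:] + (\<Sum>a\<in>#A. om [:- a, 1:])"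
    using val_poly_split[OF assms(1) \<open>q \<noteq> 0\<close>] .
  have "gauss_at w \<theta> e [:- a, 1:] = om [:- a, 1:]" if "a \<in># A" for a
  proof -
    have le: "om [:- a, 1:] \<le> Fin e"
      using that A(1) max e by auto
    have ge: "min (w (\<theta> - a)) (Fin e) \<le> om [:- a, 1:]"
      using om.val_add[of "[:\<theta> - a:]" "[:- \<theta>, 1:]"] by (simp add: e const)
    have ge': "min (om [:- a, 1:]) (Fin e) \<le> w (\<theta> - a)"
      using om.val_diff[of "[:- a, 1:]" "[:- \<theta>, 1:]"] by (simp add: e const)
    show ?thesis
      unfolding w.gauss_at_linear using le ge ge' by (auto simp: min_def split: if_splits)
  qed
  then have "(\<Sum>a\<in>#A. gauss_at w \<theta> e [:- a, 1:]) = (\<Sum>a\<in>#A. om [:- a, 1:])"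
    by (intro arg_cong[of _ _ sum_mset] image_mset_cong) auto
  moreover have "gauss_at w \<theta> e q = gauss_at w \<theta> e [:lead_coeff q:] + (\<Sum>a\<in>#A. gauss_at w \<theta> e [:- a, 1:])"
    using g.val_mult[of "[:lead_coeff q:]" "\<Prod>a\<in>#A. [:- a, 1:]"]
      arg_cong[OF A(2), of "gauss_at w \<theta> e"] by (simp only: g.val_prod_mset mult_pCons_left) simp
  ultimately show ?thesis
    using A(3) const by simp
qed

section \<open>Polynomials over a subfield\<close>

context
  fixes K :: "'a::field set"
  assumes K: "is_subfield K"
begin

lemma subfield_closed:
  shows "0 \<in> K" "1 \<in> K" "a \<in> K \<Longrightarrow> b \<in> K \<Longrightarrow> a + b \<in> K" "a \<in> K \<Longrightarrow> b \<in> K \<Longrightarrow> a * b \<in> K"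
    "a \<in> K \<Longrightarrow> - a \<in> K" "a \<in> K \<Longrightarrow> inverse a \<in> K" "a \<in> K \<Longrightarrow> b \<in> K \<Longrightarrow> a - b \<in> K"
    "a \<in> K \<Longrightarrow> b \<in> K \<Longrightarrow> a / b \<in> K"
  using K unfolding is_subfield_def diff_conv_add_uminus divide_inverse by blast+

lemma subfield_sum: "(\<And>i. i \<in> A \<Longrightarrow> f i \<in> K) \<Longrightarrow> sum f A \<in> K"
  by (induction A rule: infinite_finite_induct) (auto intro: subfield_closed)

lemma subfield_power: "a \<in> K \<Longrightarrow> a ^ n \<in> K"
  by (induction n) (auto intro: subfield_closed)

lemma polys_over_pCons_iff [simp]: "pCons a p \<in> polys_over K \<longleftrightarrow> a \<in> K \<and> p \<in> polys_over K"
  unfolding polys_over_def by (auto simp: coeff_pCons split: nat.splits)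

lemma polys_over_0 [simp]: "0 \<in> polys_over K"
  by (simp add: polys_over_def subfield_closed)

lemma polys_over_1 [simp]: "1 \<in> polys_over K"
  by (simp add: one_pCons subfield_closed)

lemma polys_over_closed:
  assumes "p \<in> polys_over K" "q \<in> polys_over K"
  shows "p + q \<in> polys_over K" "p - q \<in> polys_over K" "- p \<in> polys_over K" "p * q \<in> polys_over K"
  using assms by (auto simp: polys_over_def coeff_mult intro!: subfield_closed subfield_sum)

lemma polys_over_monom: "a \<in> K \<Longrightarrow> monom a n \<in> polys_over K"
  by (auto simp: polys_over_def subfield_closed)

text \<open>Quotient and remainder must stay over \<open>K\<close>. The last alternative gives the
  drop in degree needed for induction along expansions in powers of \<open>q\<close>.\<close>

lemma polys_over_division:
  assumes "f \<in> polys_over K" "q \<in> polys_over K" "0 < degree q"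
  obtains g r where "g \<in> polys_over K" "r \<in> polys_over K" "f = q * g + r" "degree r < degree q"
    "g = 0 \<or> degree f = degree q + degree g"
proof -
  have "\<exists>g r. g \<in> polys_over K \<and> r \<in> polys_over K \<and> f = q * g + r \<and> degree r < degree q"
    using assms(1)
  proof (induction "degree f" arbitrary: f rule: less_induct)
    case less
    show ?case
    proof (cases "degree f < degree q")
      case True
      then show ?thesis
        using less.prems by (intro exI[of _ 0] exI[of _ f]) auto
    next
      case False
      define h where "h = monom (lead_coeff f / lead_coeff q) (degree f - degree q)"
      have "h \<in> polys_over K"
        unfolding h_def using less.prems assms(2)
        by (intro polys_over_monom subfield_closed) (auto simp: polys_over_def)
      moreover have deg: "degree (f - q * h) < degree f"
      proof (rule degree_lessI)
        have "q \<noteq> 0" "f \<noteq> 0" "degree f > 0"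
          using assms(3) False by auto
        show "f - q * h \<noteq> 0 \<or> 0 < degree f"
          using \<open>degree f > 0\<close> by simp
        have dqh: "degree (q * h) = degree f"
          using \<open>q \<noteq> 0\<close> \<open>f \<noteq> 0\<close> False by (auto simp: h_def degree_mult_eq degree_monom_eq monom_eq_0_iff)
        have lead: "coeff (q * h) (degree f) = lead_coeff f"
          using \<open>q \<noteq> 0\<close> \<open>f \<noteq> 0\<close> False dqh lead_coeff_mult[of q h] by (simp add: h_def degree_monom_eq)
        show "\<forall>k\<ge>degree f. coeff (f - q * h) k = 0"
          using lead dqh by (auto simp: coeff_eq_0 le_less)
      qed
      ultimately obtain g r where "g \<in> polys_over K" "r \<in> polys_over K" "f - q * h = q * g + r" "degree r < degree q"
        using less.hyps[OF deg] less.prems assms(2) by (metis polys_over_closed(2,4))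
      then show ?thesis
        using \<open>h \<in> polys_over K\<close>
        by (intro exI[of _ "g + h"] exI[of _ r]) (auto intro!: polys_over_closed simp: algebra_simps)
    qed
  qed
  then obtain g r where gr: "g \<in> polys_over K" "r \<in> polys_over K" "f = q * g + r" "degree r < degree q"
    by blast
  moreover have "g = 0 \<or> degree f = degree q + degree g"
  proof (cases "g = 0")
    case False
    then have "degree (q * g) = degree q + degree g"
      using assms(3) by (intro degree_mult_eq) auto
    then show ?thesis
      using gr degree_add_eq_left[of r "q * g"] by simp
  qed simp
  ultimately show thesis
    using that by blast
qed

end

section \<open>Comparable valuations\<close>

text \<open>If the minimum were not attained, \<open>q * g\<close> and \<open>r\<close> would cancel for \<open>\<nu>\<close>, but not for \<open>\<nu>'\<close>,
  which is strictly larger on \<open>q * g\<close> and unchanged on \<open>r\<close>.\<close>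

lemma valuation_division_min:
  assumes K: "is_subfield K" and "valuation \<nu>" "valuation \<nu>'"
    and le: "\<And>f. f \<in> polys_over K \<Longrightarrow> \<nu> f \<le> \<nu>' f"
    and q: "q \<in> polys_over K" "\<nu> q < \<nu>' q" and g: "g \<in> polys_over K"
    and r: "r \<in> polys_over K" "\<nu> r = \<nu>' r"
  shows "\<nu> (q * g + r) = min (\<nu> q + \<nu> g) (\<nu> r)"
proof -
  interpret \<nu>: valuation \<nu> by fact
  interpret \<nu>': valuation \<nu>' by fact
  consider "\<nu> (q * g) < \<nu> r" | "\<nu> r < \<nu> (q * g)" | "\<nu> (q * g) = \<nu> r"
    by fastforce
  then show ?thesis
  proof cases
    case 1
    then show ?thesis
      using \<nu>.val_add_eq[OF 1] by (simp add: \<nu>.val_mult)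
  next
    case 2
    then show ?thesis
      using \<nu>.val_add_eq[OF 2] by (simp add: \<nu>.val_mult add.commute min.absorb2)
  next
    case 3
    have ge: "\<nu> r \<le> \<nu> (q * g + r)"
      using 3 by (intro \<nu>.val_add_ge) auto
    have "\<nu> (q * g + r) \<le> \<nu> r"
    proof (rule ccontr)
      assume gt: "\<not> \<nu> (q * g + r) \<le> \<nu> r"
      then have fin: "\<nu> r \<noteq> Infty"
        by auto
      have "\<nu> g \<noteq> Infty"
        using fin 3 by (auto simp: \<nu>.val_mult)
      then have "\<nu>' r < \<nu>' (q * g)"
        unfolding r(2)[symmetric] 3[symmetric] \<nu>.val_mult \<nu>'.val_mult
        by (rule with_infinity_add_less_mono[OF q(2) le[OF g]])
      then have "\<nu>' (r + q * g) = \<nu>' r"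
        by (rule \<nu>'.val_add_eq)
      moreover have "q * g + r \<in> polys_over K"
        using q g r by (intro polys_over_closed K)
      ultimately show False
        using gt le[of "q * g + r"] r(2) by (simp add: add.commute)
    qed
    with ge 3 show ?thesis
      by (simp add: \<nu>.val_mult)
  qed
qed

lemma gauss_at_interpolation:
  fixes K :: "'a::alg_closed_field set" and w :: "'a \<Rightarrow> 'l::linordered_ab_group_add with_infinity"
  assumes div: "divisible_group TYPE('l)" and K: "is_subfield K"
    and "valuation w" "valuation \<mu>" "valuation \<mu>'"
    and const: "\<And>a. \<mu> [:a:] = w a" "\<And>a. \<mu>' [:a:] = w a"
    and le: "\<And>f. f \<in> polys_over K \<Longrightarrow> \<mu> f \<le> \<mu>' f"
    and neq: "f\<^sub>0 \<in> polys_over K" "\<mu> f\<^sub>0 \<noteq> \<mu>' f\<^sub>0"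
  obtains \<theta> t where "\<And>f. gauss_at w \<theta> t f \<le> \<mu>' f"
    "\<And>f. f \<in> polys_over K \<Longrightarrow> gauss_at w \<theta> t f = \<mu> f"
proof -
  interpret w: field_valuation w by (rule field_valuation.intro) fact
  interpret \<mu>: valuation \<mu> by fact
  interpret \<mu>': valuation \<mu>' by fact
  obtain q where q: "q \<in> polys_over K" "\<mu> q \<noteq> \<mu>' q"
    and qmin: "\<And>u. u \<in> polys_over K \<Longrightarrow> \<mu> u \<noteq> \<mu>' u \<Longrightarrow> degree q \<le> degree u"
    using ex_has_least_nat[of "\<lambda>u. u \<in> polys_over K \<and> \<mu> u \<noteq> \<mu>' u" f\<^sub>0 degree] neq by blast
  have q_less: "\<mu> q < \<mu>' q"
    using le[OF q(1)] q(2) by simp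
  have small: "\<mu> u = \<mu>' u" if "u \<in> polys_over K" "degree u < degree q" for u
    using that qmin[of u] by fastforce
  have degq: "0 < degree q"
    using q const by (metis degree_eq_zeroE gr0I)
  then have "q \<noteq> 0" by auto
  obtain \<gamma> where \<gamma>: "\<mu> q = Fin \<gamma>"
    using q_less by (rule less_InftyE)
  let ?R = "{a. poly q a = 0}"
  have R: "finite ?R" "?R \<noteq> {}"
    using \<open>q \<noteq> 0\<close> poly_roots_finite alg_closed_imp_poly_has_root[OF degq] by auto
  obtain \<theta> where \<theta>: "poly q \<theta> = 0" "\<And>a. poly q a = 0 \<Longrightarrow> \<mu>' [:- a, 1:] \<le> \<mu>' [:- \<theta>, 1:]"
  proof -
    let ?h = "\<lambda>a. \<mu>' [:- a, 1:]"
    have "Max (?h ` ?R) \<in> ?h ` ?R"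
      using R by (intro Max_in) auto
    then obtain \<theta> where "\<theta> \<in> ?R" "Max (?h ` ?R) = ?h \<theta>"
      by blast
    moreover have "?h a \<le> Max (?h ` ?R)" if "a \<in> ?R" for a
      using R that by (intro Max_ge) auto
    ultimately show thesis
      using that by auto
  qed
  obtain t where t: "gauss_at w \<theta> t q = Fin \<gamma>"
    using w.gauss_at_solve[OF div \<theta>(1) \<open>q \<noteq> 0\<close>] .
  \<comment> \<open>With a smaller radius \<open>e\<close> the Gauss valuation already takes the
    value \<open>\<mu>' q\<close> at \<open>q\<close>, by the choice of \<open>\<theta>\<close>; if
    \<open>e < t\<close>, growth in the radius would give
    \<open>\<mu>' q \<le> \<mu> q\<close>.\<close>
  have "Fin t \<le> \<mu>' [:- \<theta>, 1:]"
  proof (rule ccontr)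
    assume "\<not> Fin t \<le> \<mu>' [:- \<theta>, 1:]"
    then obtain e where e: "\<mu>' [:- \<theta>, 1:] = Fin e" "e < t"
      by (cases "\<mu>' [:- \<theta>, 1:]") auto
    have "\<mu>' q = gauss_at w \<theta> e q"
      using gauss_at_maximal_root[OF \<open>valuation \<mu>'\<close> \<open>valuation w\<close> const(2) \<open>q \<noteq> 0\<close> \<theta>(2) e(1)] by simp
    also have "\<dots> \<le> \<mu> q"
      using w.gauss_at_mono[of e t \<theta> q] e(2) t \<gamma> by simp
    finally show False
      using q_less by simp
  qed
  let ?\<nu> = "gauss_at w \<theta> t"
  interpret \<nu>: valuation ?\<nu>
    by (rule w.valuation_gauss_at)
  have \<nu>_le: "?\<nu> f \<le> \<mu>' f" for f
    using w.gauss_at_le_extension[OF \<open>valuation \<mu>'\<close> const(2) \<open>Fin t \<le> _\<close>] .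
  \<comment> \<open>Otherwise \<open>q\<close> is divided by a polynomial \<open>p\<close> of least
    degree at which the two differ, \<open>q = p * g + r\<close>. The minimum formula bounds the
    Gauss value of \<open>p * g\<close> from below by \<open>\<gamma>\<close>, so
    \<open>\<mu>'\<close> exceeds \<open>\<gamma>\<close> on \<open>p * g\<close> and then on
    \<open>r\<close>. All three of \<open>p\<close>, \<open>g\<close>, \<open>r\<close> have degree
    below that of \<open>q\<close>, so \<open>\<mu>\<close> exceeds \<open>\<gamma>\<close> there
    too and hence at \<open>q\<close>, a contradiction.\<close>
  have \<nu>_small: "?\<nu> u = \<mu>' u" if u: "u \<in> polys_over K" "degree u < degree q" for u
  proof (rule ccontr)
    assume "?\<nu> u \<noteq> \<mu>' u"
    then obtain p where p: "p \<in> polys_over K" "?\<nu> p \<noteq> \<mu>' p"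
      and pmin: "\<And>u. u \<in> polys_over K \<Longrightarrow> ?\<nu> u \<noteq> \<mu>' u \<Longrightarrow> degree p \<le> degree u"
      using ex_has_least_nat[of "\<lambda>u. u \<in> polys_over K \<and> ?\<nu> u \<noteq> \<mu>' u" u degree] u by blast
    have p_less: "?\<nu> p < \<mu>' p"
      using \<nu>_le[of p] p(2) by simp
    have "0 < degree p"
      using p const by (metis degree_eq_zeroE gr0I w.gauss_at_const)
    obtain g r where gr: "g \<in> polys_over K" "r \<in> polys_over K" "q = p * g + r" "degree r < degree p"
      "g = 0 \<or> degree q = degree p + degree g"
      using polys_over_division[OF K q(1) p(1) \<open>0 < degree p\<close>] .
    have degp: "degree p < degree q"
      using pmin[OF u(1) \<open>?\<nu> u \<noteq> \<mu>' u\<close>] u(2) by simp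
    have degg: "degree g < degree q"
      using gr(5) \<open>0 < degree p\<close> degq by auto
    have "?\<nu> r = \<mu>' r"
      using pmin[OF gr(2)] gr(4) by fastforce
    then have "?\<nu> q = min (?\<nu> p + ?\<nu> g) (?\<nu> r)"
      unfolding gr(3) using \<nu>_le p_less p gr
      by (intro valuation_division_min[OF K w.valuation_gauss_at \<open>valuation \<mu>'\<close>]) auto
    then have "Fin \<gamma> \<le> ?\<nu> p + ?\<nu> g"
      using t by (metis min.cobounded1)
    moreover have "?\<nu> p + ?\<nu> g < \<mu>' p + \<mu>' g" if "g \<noteq> 0"
      using that by (intro with_infinity_add_less_mono p_less \<nu>_le) simp
    ultimately have pg: "Fin \<gamma> < \<mu>' (p * g)"
      by (cases "g = 0") (auto simp: \<mu>'.val_mult)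
    have "r = q + - (p * g)"
      using gr(3) by simp
    then have "Fin \<gamma> < \<mu>' r"
      using \<mu>'.val_add_gt[of "Fin \<gamma>" q "- (p * g)"] q_less \<gamma> pg by simp
    then have "Fin \<gamma> < \<mu> r"
      using small[of r] gr(2,4) degp by simp
    moreover have "Fin \<gamma> < \<mu> (p * g)"
      using pg small[OF p(1) degp] small[OF gr(1) degg] by (simp add: \<mu>.val_mult \<mu>'.val_mult)
    ultimately have "Fin \<gamma> < \<mu> q"
      unfolding gr(3) by (intro \<mu>.val_add_gt)
    then show False
      using \<gamma> by simp
  qed
  \<comment> \<open>Both valuations satisfy the same minimum formula for division by
    \<open>q\<close>, each time compared with the larger \<open>\<mu>'\<close>.\<close>
  have "?\<nu> f = \<mu> f" if "f \<in> polys_over K" for f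
    using that
  proof (induction "degree f" arbitrary: f rule: less_induct)
    case less
    obtain g r where gr: "g \<in> polys_over K" "r \<in> polys_over K" "f = q * g + r" "degree r < degree q"
      "g = 0 \<or> degree f = degree q + degree g"
      using polys_over_division[OF K less.prems q(1) degq] .
    have "?\<nu> g = \<mu> g"
      using less.hyps[of g] gr degq by (cases "g = 0") auto
    moreover have "?\<nu> r = \<mu>' r" "\<mu> r = \<mu>' r"
      using small \<nu>_small gr by auto
    moreover have "?\<nu> q = \<mu> q" "?\<nu> q < \<mu>' q"
      using t \<gamma> q_less by auto
    moreover have "?\<nu> (q * g + r) = min (?\<nu> q + ?\<nu> g) (?\<nu> r)"
      using calculation q gr \<nu>_le
      by (intro valuation_division_min[OF K w.valuation_gauss_at \<open>valuation \<mu>'\<close>]) auto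
    moreover have "\<mu> (q * g + r) = min (\<mu> q + \<mu> g) (\<mu> r)"
      using calculation q gr le q_less
      by (intro valuation_division_min[OF K \<open>valuation \<mu>\<close> \<open>valuation \<mu>'\<close>]) auto
    ultimately show ?case
      unfolding gr(3) by simp
  qed
  with \<nu>_le show thesis
    using that by blast
qed

section \<open>Graphs of partial homomorphisms\<close>

text \<open>Subrings of a product that are graphs of homomorphisms defined on a subfield of the first
  factor. The second factor is a field of embeddings or, for derivations, a ring of dual numbers.\<close>

locale hom_graph =
  fixes G :: "('b::field \<times> 'c::comm_ring_1) set"
  assumes graph_1: "(1, 1) \<in> G"
    and graph_add: "(x, y) \<in> G \<Longrightarrow> (x', y') \<in> G \<Longrightarrow> (x + x', y + y') \<in> G"
    and graph_mult: "(x, y) \<in> G \<Longrightarrow> (x', y') \<in> G \<Longrightarrow> (x * x', y * y') \<in> G"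
    and graph_minus: "(x, y) \<in> G \<Longrightarrow> (- x, - y) \<in> G"
    and graph_0_unique: "(0, y) \<in> G \<Longrightarrow> y = 0"
    and graph_inverse: "(x, y) \<in> G \<Longrightarrow> \<exists>y'. (inverse x, y') \<in> G"

definition poly_graph :: "('b::zero \<times> 'c::zero) set \<Rightarrow> ('b poly \<times> 'c poly) set" where
  "poly_graph G = {(f, f'). \<forall>i. (coeff f i, coeff f' i) \<in> G}"

text \<open>The first factor is algebraic over the domain of \<open>G\<close>. Pairs of polynomials
  are used so that an annihilating polynomial comes with its image.\<close>

definition algebraic_graph :: "('b::field \<times> 'c::comm_ring_1) set \<Rightarrow> bool" where
  "algebraic_graph G \<longleftrightarrow> (\<forall>z. \<exists>(P, P')\<in>poly_graph G. P \<noteq> 0 \<and> poly P z = 0)"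

text \<open>A relation for every \<open>r\<close>; it is single-valued when \<open>r\<close> is a
  root of the image of the minimal polynomial of \<open>a\<close> over the domain, as
  \<open>hom_graph_adjoin\<close> shows.\<close>

definition adjoin_graph ::
    "('b::field \<times> 'c::comm_ring_1) set \<Rightarrow> 'b \<Rightarrow> 'c \<Rightarrow> ('b \<times> 'c) set" where
  "adjoin_graph G a r = {(poly H a, poly H' r) |H H'. (H, H') \<in> poly_graph G}"

abbreviation adjoinable :: "('b::field \<times> 'c::comm_ring_1) set \<Rightarrow> 'b \<Rightarrow> 'c \<Rightarrow> bool" where
  "adjoinable G a r \<equiv> hom_graph (adjoin_graph G a r) \<and> G \<subseteq> adjoin_graph G a r \<and> (a, r) \<in> adjoin_graph G a r"

lemma poly_graph_mono: "G \<subseteq> G' \<Longrightarrow> poly_graph G \<subseteq> poly_graph G'"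
  unfolding poly_graph_def by blast

lemma algebraic_graph_mono: "G \<subseteq> G' \<Longrightarrow> algebraic_graph G \<Longrightarrow> algebraic_graph G'"
  unfolding algebraic_graph_def using poly_graph_mono by blast

lemma algebraic_graph_minimal:
  assumes "algebraic_graph G"
  obtains P P' where "(P, P') \<in> poly_graph G" "P \<noteq> 0" "poly P z = 0"
    "\<And>Q Q'. (Q, Q') \<in> poly_graph G \<Longrightarrow> Q \<noteq> 0 \<Longrightarrow> poly Q z = 0 \<Longrightarrow> degree P \<le> degree Q"
proof -
  let ?A = "\<lambda>(P, P'). (P, P') \<in> poly_graph G \<and> P \<noteq> 0 \<and> poly P z = 0"
  obtain P0 where "?A P0"
    using assms unfolding algebraic_graph_def by blast
  then obtain P where "?A P" "\<And>Q. ?A Q \<Longrightarrow> degree (fst P) \<le> degree (fst Q)"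
    using ex_has_least_nat[of ?A P0 "\<lambda>P. degree (fst P)"] by blast
  then show thesis
    using that[of "fst P" "snd P"] by (auto simp: case_prod_beta)
qed

context hom_graph
begin

lemma graph_0: "(0, 0) \<in> G"
  using graph_add[OF graph_1 graph_minus[OF graph_1]] by simp

lemma subfield_Domain: "is_subfield (Domain G)"
  unfolding is_subfield_def Ball_def Domain_iff
  using graph_0 graph_1 graph_add graph_mult graph_minus graph_inverse by meson

lemma graph_diff: "(x, y) \<in> G \<Longrightarrow> (x', y') \<in> G \<Longrightarrow> (x - x', y - y') \<in> G"
  using graph_add[of x y "- x'" "- y'"] graph_minus[of x' y'] by simp

lemma graph_unique: "(x, y) \<in> G \<Longrightarrow> (x, y') \<in> G \<Longrightarrow> y = y'"
  using graph_diff[of x y x y'] graph_0_unique[of "y - y'"] by simp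

lemma graph_sum: "(\<And>i. i \<in> A \<Longrightarrow> (f i, f' i) \<in> G) \<Longrightarrow> (sum f A, sum f' A) \<in> G"
  by (induction A rule: infinite_finite_induct) (auto intro: graph_0 graph_add)

text \<open>A nonzero element with image 0 would, multiplied by its inverse, give 1 the image 0 in a
  nontrivial ring. Injectivity keeps degrees of polynomials unchanged, also when the target is a
  ring of dual numbers.\<close>

lemma graph_zero_iff:
  fixes x :: 'b and y :: 'c
  assumes "(x, y) \<in> G"
  shows "y = 0 \<longleftrightarrow> x = 0"
proof
  assume "y = 0"
  show "x = 0"
  proof (rule ccontr)
    assume "x \<noteq> 0"
    obtain y' where "(inverse x, y') \<in> G"
      using graph_inverse[OF assms] by blast
    then have "(x * inverse x, y * y') \<in> G"
      using assms by (rule graph_mult[rotated])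
    then have "(1, 0) \<in> G"
      using \<open>x \<noteq> 0\<close> \<open>y = 0\<close> by simp
    then have "(1 :: 'c) = 0"
      using graph_unique[OF graph_1 \<open>(1, 0) \<in> G\<close>] by simp
    then show False by simp
  qed
qed (use assms graph_0_unique in auto)

lemma poly_graph_coeff: "(f, f') \<in> poly_graph G \<Longrightarrow> (coeff f i, coeff f' i) \<in> G"
  by (simp add: poly_graph_def)

lemma poly_graph_add: "(f, f') \<in> poly_graph G \<Longrightarrow> (g, g') \<in> poly_graph G \<Longrightarrow> (f + g, f' + g') \<in> poly_graph G"
  by (simp add: poly_graph_def graph_add)

lemma poly_graph_diff: "(f, f') \<in> poly_graph G \<Longrightarrow> (g, g') \<in> poly_graph G \<Longrightarrow> (f - g, f' - g') \<in> poly_graph G"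
  by (simp add: poly_graph_def graph_diff)

lemma poly_graph_mult: "(f, f') \<in> poly_graph G \<Longrightarrow> (g, g') \<in> poly_graph G \<Longrightarrow> (f * g, f' * g') \<in> poly_graph G"
  by (auto simp: poly_graph_def coeff_mult intro!: graph_sum graph_mult)

lemma poly_graph_0: "(0, 0) \<in> poly_graph G"
  by (simp add: poly_graph_def graph_0)

lemma poly_graph_pCons_iff [simp]:
  "(pCons a p, pCons a' p') \<in> poly_graph G \<longleftrightarrow> (a, a') \<in> G \<and> (p, p') \<in> poly_graph G"
  by (auto simp: poly_graph_def coeff_pCons split: nat.splits)

lemma poly_graph_monom: "(a, a') \<in> G \<Longrightarrow> (monom a n, monom a' n) \<in> poly_graph G"
  by (auto simp: poly_graph_def graph_0)

lemma poly_graph_const: "(a, a') \<in> G \<Longrightarrow> ([:a:], [:a':]) \<in> poly_graph G"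
  by (simp add: poly_graph_0)

lemma poly_graph_X: "([:0, 1:], [:0, 1:]) \<in> poly_graph G"
  by (simp add: poly_graph_0 graph_0 graph_1)

lemma poly_graph_power: "(f, f') \<in> poly_graph G \<Longrightarrow> (f ^ n, f' ^ n) \<in> poly_graph G"
  by (induction n) (auto intro: poly_graph_mult simp: one_pCons poly_graph_0 graph_1)

lemma poly_graph_zero_left: "(0, f') \<in> poly_graph G \<Longrightarrow> f' = 0"
  using graph_0_unique by (auto simp: poly_graph_def poly_eq_iff)

lemma poly_graph_degree:
  assumes "(f, f') \<in> poly_graph G"
  shows "degree f' = degree f"
proof -
  have "coeff f' i = 0 \<longleftrightarrow> coeff f i = 0" for i
    using graph_zero_iff[OF poly_graph_coeff[OF assms]] .
  then show ?thesis
    by (simp add: degree_def)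
qed

lemma graph_poly:
  assumes "(f, f') \<in> poly_graph G" "(a, r) \<in> G"
  shows "(poly f a, poly f' r) \<in> G"
proof -
  have "poly f' r = (\<Sum>i\<le>degree f. coeff f' i * r ^ i)"
    using poly_graph_degree[OF assms(1)] by (simp add: poly_altdef)
  moreover have "(a ^ i, r ^ i) \<in> G" for i
    by (induction i) (auto intro: graph_1 graph_mult assms)
  ultimately show ?thesis
    by (auto simp: poly_altdef[of f] intro!: graph_sum graph_mult poly_graph_coeff assms)
qed

end

text \<open>The inverse of an algebraic element is a polynomial in it.\<close>

lemma hom_graphI_algebraic:
  fixes G G' :: "('b::field \<times> 'c::comm_ring_1) set"
  assumes "hom_graph G" "algebraic_graph G" "G \<subseteq> G'"
    and add: "\<And>x y x' y'. (x, y) \<in> G' \<Longrightarrow> (x', y') \<in> G' \<Longrightarrow> (x + x', y + y') \<in> G'"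
    and mult: "\<And>x y x' y'. (x, y) \<in> G' \<Longrightarrow> (x', y') \<in> G' \<Longrightarrow> (x * x', y * y') \<in> G'"
    and zero: "\<And>y. (0, y) \<in> G' \<Longrightarrow> y = 0"
  shows "hom_graph G'"
proof -
  interpret hom_graph G by fact
  have minus: "(- x, - y) \<in> G'" if "(x, y) \<in> G'" for x y
  proof -
    have "(- 1, - 1) \<in> G'"
      using graph_minus[OF graph_1] \<open>G \<subseteq> G'\<close> by auto
    from mult[OF this that] show ?thesis by simp
  qed
  have eval: "(poly P z, poly P' y) \<in> G'" if "(P, P') \<in> poly_graph G" "(z, y) \<in> G'" for P P' z y
  proof -
    have "(\<Sum>i\<le>n. coeff P i * z ^ i, \<Sum>i\<le>n. coeff P' i * y ^ i) \<in> G'" for n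
    proof -
      have "(z ^ i, y ^ i) \<in> G'" for i
        by (induction i) (use that graph_1 mult \<open>G \<subseteq> G'\<close> in auto)
      then have summand: "(coeff P i * z ^ i, coeff P' i * y ^ i) \<in> G'" for i
        using that poly_graph_coeff \<open>G \<subseteq> G'\<close> by (intro mult) auto
      show ?thesis
      proof (induction n)
        case 0
        from summand[of 0] show ?case by simp
      next
        case (Suc n)
        from add[OF Suc.IH summand[of "Suc n"]] show ?case
          by (simp del: power_Suc)
      qed
    qed
    from this[of "degree P"] poly_graph_degree[OF that(1)] show ?thesis
      by (simp add: poly_altdef)
  qed
  have one: "(1, 1) \<in> G'"
    using graph_1 \<open>G \<subseteq> G'\<close> by blast
  have inv: "\<exists>y'. (inverse z, y') \<in> G'" if z: "(z, y) \<in> G'" for z y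
  proof (cases "z = 0")
    case False
    obtain P P' where P: "(P, P') \<in> poly_graph G" "P \<noteq> 0" "poly P z = 0"
      and Pmin: "\<And>Q Q'. (Q, Q') \<in> poly_graph G \<Longrightarrow> Q \<noteq> 0 \<Longrightarrow> poly Q z = 0 \<Longrightarrow> degree P \<le> degree Q"
      using algebraic_graph_minimal[OF assms(2)] by blast
    \<comment> \<open>By minimality the constant coefficient \<open>p0\<close> is nonzero, so the
      relation \<open>p0 + z * poly P1 z = 0\<close> can be solved for the inverse of
      \<open>z\<close>.\<close>
    obtain p0 P1 p0' P1' where PC: "P = pCons p0 P1" "P' = pCons p0' P1'"
      by (metis pCons_cases)
    have P1: "(p0, p0') \<in> G" "(P1, P1') \<in> poly_graph G"
      using P(1) unfolding PC by simp_all
    have "p0 \<noteq> 0"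
    proof
      assume "p0 = 0"
      then have "P1 \<noteq> 0" "poly P1 z = 0"
        using P PC False by auto
      then have "degree P \<le> degree P1"
        using Pmin P1 by blast
      then show False
        using PC \<open>P1 \<noteq> 0\<close> by simp
    qed
    have "p0 + z * poly P1 z = 0"
      using P(3) PC by simp
    then have "z * poly P1 z = - p0"
      by (simp add: eq_neg_iff_add_eq_0 add.commute)
    moreover have "z * - (inverse p0 * poly P1 z) = - (inverse p0 * (z * poly P1 z))"
      by (simp add: ac_simps)
    ultimately have "z * - (inverse p0 * poly P1 z) = 1"
      using \<open>p0 \<noteq> 0\<close> by simp
    then have inv: "inverse z = - (inverse p0 * poly P1 z)"
      by (rule inverse_unique)
    obtain y' where "(inverse p0, y') \<in> G'"
      using graph_inverse[OF P1(1)] \<open>G \<subseteq> G'\<close> by blast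
    then show ?thesis
      unfolding inv using minus[OF mult[OF _ eval[OF P1(2) z]]] by blast
  qed (use graph_0 \<open>G \<subseteq> G'\<close> in auto)
  show ?thesis
  proof
    fix x y x' y' assume "(x, y) \<in> G'" "(x', y') \<in> G'"
    then show "(x + x', y + y') \<in> G'" "(x * x', y * y') \<in> G'"
      by (fact add, fact mult)
  next
    fix x y assume "(x, y) \<in> G'"
    then show "(- x, - y) \<in> G'" "\<exists>y'. (inverse x, y') \<in> G'"
      by (fact minus, fact inv)
  next
    fix y assume "(0, y) \<in> G'"
    then show "y = 0"
      by (fact zero)
  qed (fact one)
qed

text \<open>The point is well-definedness: whenever \<open>H\<close> vanishes at \<open>a\<close>,
  its image must vanish at every root \<open>r\<close> of \<open>F'\<close>. This is division by the
  minimal polynomial \<open>F\<close>, carried out on pairs of polynomials by cancelling one leading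
  term at a time.\<close>

lemma hom_graph_adjoin:
  fixes G :: "('b::field \<times> 'c::comm_ring_1) set"
  assumes "hom_graph G" "algebraic_graph G"
  obtains F F' where "(F, F') \<in> poly_graph G" "poly F a = 0" "0 < degree F"
    "\<And>Q Q'. (Q, Q') \<in> poly_graph G \<Longrightarrow> Q \<noteq> 0 \<Longrightarrow> poly Q a = 0 \<Longrightarrow> degree F \<le> degree Q"
    "\<And>r. poly F' r = 0 \<Longrightarrow> adjoinable G a r"
proof -
  interpret hom_graph G by fact
  obtain F F' where F: "(F, F') \<in> poly_graph G" "F \<noteq> 0" "poly F a = 0"
    and Fmin: "\<And>Q Q'. (Q, Q') \<in> poly_graph G \<Longrightarrow> Q \<noteq> 0 \<Longrightarrow> poly Q a = 0 \<Longrightarrow> degree F \<le> degree Q"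
    using algebraic_graph_minimal[OF assms(2)] by blast
  note degF = degree_pos_of_root[OF F(2,3)]
  have root: "poly H' r = 0" if r: "poly F' r = 0" and H: "(H, H') \<in> poly_graph G" "poly H a = 0" for r H H'
    using H
  proof (induction "degree H" arbitrary: H H' rule: less_induct)
    case less
    show ?case
    proof (cases "H = 0")
      case True
      then show ?thesis
        using less.prems poly_graph_zero_left[of H'] by simp
    next
      case False
      then have le: "degree F \<le> degree H"
        using Fmin less.prems by blast
      have lead: "(lead_coeff F, coeff F' (degree F)) \<in> G" "(lead_coeff H, coeff H' (degree H)) \<in> G"
        using F(1) less.prems poly_graph_coeff by auto
      obtain y where y: "(inverse (lead_coeff F), y) \<in> G"
        using graph_inverse[OF lead(1)] by blast
      \<comment> \<open>\<open>m'\<close> is the image of \<open>m\<close>, with \<open>y\<close>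
        the image of the inverse leading coefficient, so the difference below stays in
        \<open>poly_graph G\<close>.\<close>
      define m where "m = monom (lead_coeff H * inverse (lead_coeff F)) (degree H - degree F)"
      define m' where "m' = monom (coeff H' (degree H) * y) (degree H - degree F)"
      have J: "(H - m * F, H' - m' * F') \<in> poly_graph G"
        unfolding m_def m'_def
        by (intro poly_graph_diff poly_graph_mult poly_graph_monom graph_mult less.prems F lead y)
      have dm: "degree (m * F) = degree H"
        using \<open>F \<noteq> 0\<close> False le by (auto simp: m_def degree_mult_eq degree_monom_eq monom_eq_0_iff)
      have "lead_coeff m = lead_coeff H * inverse (lead_coeff F)"
        unfolding m_def by (rule lead_coeff_monom)
      moreover have "inverse (lead_coeff F) * lead_coeff F = 1"
        using \<open>F \<noteq> 0\<close> by (intro left_inverse) simp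
      ultimately have "lead_coeff (m * F) = lead_coeff H"
        by (metis lead_coeff_mult mult.assoc mult.right_neutral)
      then have lead_eq: "coeff (m * F) (degree H) = coeff H (degree H)"
        unfolding dm .
      have "degree (H - m * F) < degree H"
      proof (rule degree_lessI)
        show "H - m * F \<noteq> 0 \<or> 0 < degree H"
          using degF le by simp
        show "\<forall>k\<ge>degree H. coeff (H - m * F) k = 0"
        proof (intro allI impI)
          fix k assume "degree H \<le> k"
          then show "coeff (H - m * F) k = 0"
            using lead_eq dm by (cases "k = degree H") (simp_all add: coeff_eq_0)
        qed
      qed
      moreover have "poly (H - m * F) a = 0"
        using less.prems F by simp
      ultimately have "poly (H' - m' * F') r = 0"
        using less.hyps J by blast
      then show ?thesis
        using r by simp
    qed
  qed
  have "adjoinable G a r"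
    if r: "poly F' r = 0" for r
  proof (intro conjI)
    show sub: "G \<subseteq> adjoin_graph G a r"
    proof (rule subrelI)
      fix x y assume "(x, y) \<in> G"
      then have "([:x:], [:y:]) \<in> poly_graph G"
        by (rule poly_graph_const)
      then have "(poly [:x:] a, poly [:y:] r) \<in> adjoin_graph G a r"
        unfolding adjoin_graph_def by blast
      then show "(x, y) \<in> adjoin_graph G a r"
        by simp
    qed
    have "(poly [:0, 1:] a, poly [:0, 1:] r) \<in> adjoin_graph G a r"
      unfolding adjoin_graph_def using poly_graph_X by blast
    then show "(a, r) \<in> adjoin_graph G a r"
      by simp
    show "hom_graph (adjoin_graph G a r)"
    proof (rule hom_graphI_algebraic[OF assms sub])
      fix x y x' y'
      assume "(x, y) \<in> adjoin_graph G a r" "(x', y') \<in> adjoin_graph G a r"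
      then obtain H H' J J' where *: "(H, H') \<in> poly_graph G" "(J, J') \<in> poly_graph G"
        "x = poly H a" "y = poly H' r" "x' = poly J a" "y' = poly J' r"
        unfolding adjoin_graph_def by blast
      show "(x + x', y + y') \<in> adjoin_graph G a r"
        unfolding adjoin_graph_def *(3-) poly_add[symmetric] using poly_graph_add[OF *(1,2)] by blast
      show "(x * x', y * y') \<in> adjoin_graph G a r"
        unfolding adjoin_graph_def *(3-) poly_mult[symmetric] using poly_graph_mult[OF *(1,2)] by blast
    next
      fix y assume "(0, y) \<in> adjoin_graph G a r"
      then obtain H H' where "(H, H') \<in> poly_graph G" "poly H a = 0" "y = poly H' r"
        unfolding adjoin_graph_def by (smt (verit) mem_Collect_eq prod.inject)
      then show "y = 0"
        using root[OF r] by blast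
    qed
  qed
  then show thesis
    using that F(1,3) degF Fmin by blast
qed

section \<open>Conjugacy of valuations\<close>

text \<open>The Newton polygon of \<open>f\<close> has a vertex, rather than an edge, of slope \<open>- \<beta>\<close>.\<close>

definition newton_vertex ::
    "('a::field \<Rightarrow> 'l::linordered_ab_group_add with_infinity) \<Rightarrow> 'l \<Rightarrow> 'a poly \<Rightarrow> bool" where
  "newton_vertex w \<beta> f \<longleftrightarrow> (\<exists>k. \<forall>i. i \<noteq> k \<longrightarrow>
     gauss_term w \<beta> f k < gauss_term w \<beta> f i)"

context field_valuation
begin

text \<open>Newton polygons of a product are Minkowski sums: the unique minimal terms of the factors
  multiply to the unique minimal term of the product.\<close>

lemma newton_vertex_mult:
  assumes "newton_vertex w \<beta> f" "newton_vertex w \<beta> g"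
  shows "newton_vertex w \<beta> (f * g)"
proof -
  let ?a = "gauss_term w \<beta> f" and ?b = "gauss_term w \<beta> g"
  obtain k where k: "\<And>i. i \<noteq> k \<Longrightarrow> ?a k < ?a i"
    using assms(1) unfolding newton_vertex_def by blast
  obtain l where l: "\<And>i. i \<noteq> l \<Longrightarrow> ?b l < ?b i"
    using assms(2) unfolding newton_vertex_def by blast
  have fin: "?a k \<noteq> Infty" "?b l \<noteq> Infty"
    using k[of "Suc k"] l[of "Suc l"] by force+
  have le: "?a k \<le> ?a i" "?b l \<le> ?b i" for i
    using k[of i] l[of i] by (metis order.refl less_imp_le)+
  have less: "?a k + ?b l < ?a i + ?b j" if "i \<noteq> k \<or> j \<noteq> l" for i j
  proof (cases "i = k")
    case True
    then have "?b l < ?b j"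
      using that l by blast
    from with_infinity_add_less_mono[OF this le(1)[of i] fin(1)] show ?thesis
      by (simp only: add.commute)
  next
    case False
    from with_infinity_add_less_mono[OF k[OF False] le(2)[of j] fin(2)] show ?thesis .
  qed
  have "gauss_term w \<beta> (f * g) (k + l) = ?a k + ?b l"
    using less fin by (intro gauss_term_mult_eq) simp_all
  moreover have "?a k + ?b l < gauss_term w \<beta> (f * g) n" if "n \<noteq> k + l" for n
    using that by (intro gauss_term_mult_gt less) auto
  ultimately show ?thesis
    unfolding newton_vertex_def by metis
qed

lemma newton_vertex_linear:
  assumes "w a \<noteq> Fin \<beta>"
  shows "newton_vertex w \<beta> [:- a, 1:]"
proof -
  have 0: "w (coeff [:- a, 1:] 0) + Fin (nsmul 0 \<beta>) = w a"
    by simp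
  have 1: "w (coeff [:- a, 1:] 1) + Fin (nsmul 1 \<beta>) = Fin \<beta>"
    by (simp add: zero_with_infinity_Fin)
  have 2: "w (coeff [:- a, 1:] i) + Fin (nsmul i \<beta>) = Infty" if "i \<noteq> 0" "i \<noteq> 1" for i
  proof -
    have "coeff [:- a, 1:] i = 0"
      using that by (intro coeff_eq_0) simp
    then show ?thesis by simp
  qed
  consider "w a < Fin \<beta>" | "Fin \<beta> < w a"
    using assms by fastforce
  then show ?thesis
  proof cases
    case lt: 1
    have "w a < w (coeff [:- a, 1:] i) + Fin (nsmul i \<beta>)" if "i \<noteq> 0" for i
      using lt less_trans[OF lt, of Infty] 1 2[OF that] by (cases "i = 1") simp_all
    then show ?thesis
      unfolding newton_vertex_def using 0 by metis
  next
    case gt: 2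
    have "Fin \<beta> < w (coeff [:- a, 1:] i) + Fin (nsmul i \<beta>)" if "i \<noteq> 1" for i
      using gt 0 2[OF _ that] by (cases "i = 0") simp_all
    then show ?thesis
      unfolding newton_vertex_def using 1 by metis
  qed
qed

lemma newton_vertex_const:
  assumes "a \<noteq> 0"
  shows "newton_vertex w \<beta> [:a:]"
proof -
  have "w a \<noteq> Infty" using assms by simp
  then obtain c where "w a = Fin c" by (rule neq_InftyE)
  then show ?thesis
    unfolding newton_vertex_def by (intro exI[of _ 0]) (auto simp: coeff_pCons split: nat.splits)
qed

text \<open>At an element of value \<open>\<beta>\<close> the summands of \<open>poly f z\<close>
  have the values of the Gauss terms. A strictly smallest one gives the sum a finite value.\<close>

lemma newton_vertex_no_root:
  assumes "newton_vertex w \<beta> f" "w z = Fin \<beta>"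
  shows "poly f z \<noteq> 0"
proof -
  obtain k where k: "\<And>i. i \<noteq> k \<Longrightarrow>
     gauss_term w \<beta> f k < gauss_term w \<beta> f i"
    using assms(1) unfolding newton_vertex_def by blast
  have val: "w (coeff f i * z ^ i) = gauss_term w \<beta> f i" for i
    using assms(2) by (simp add: val_mult val_power)
  have fin: "gauss_term w \<beta> f k < Infty"
    using k[of "Suc k"] by (rule order_less_le_trans) simp_all
  have "coeff f k \<noteq> 0"
    using fin by auto
  then have "k \<le> degree f"
    by (rule le_degree)
  then have "w (poly f z) = w (coeff f k * z ^ k)"
    unfolding poly_altdef using k fin by (intro val_sum_eq) (auto simp: val)
  then show ?thesis
    using fin by (auto simp: val)
qed

end

text \<open>Converse to \<open>newton_vertex_no_root\<close> when the polynomial splits: each linear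
  factor has a vertex, and vertices multiply.\<close>

lemma newton_vertex_split:
  fixes f :: "'a::alg_closed_field poly"
  assumes "valuation w" "f \<noteq> 0" "\<And>a. poly f a = 0 \<Longrightarrow> w a \<noteq> Fin \<beta>"
  shows "newton_vertex w \<beta> f"
proof -
  interpret valuation w by fact
  interpret field_valuation w ..
  obtain A where A: "f = smult (lead_coeff f) (\<Prod>a\<in>#A. [:- a, 1:])"
    using alg_closed_imp_factorization[OF assms(2)] by blast
  have "poly f a = 0" if "a \<in># A" for a
    using that arg_cong[OF A, of "\<lambda>g. poly g a"]
    by (simp only: poly_smult poly_prod_mset) (auto simp: prod_mset_zero_iff)
  then have "newton_vertex w \<beta> (\<Prod>a\<in>#A. [:- a, 1:])"
  proof (induction A)
    case (add a A)
    then show ?case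
      using assms(3) by (auto intro!: newton_vertex_mult newton_vertex_linear simp del: mult_pCons_left)
  qed (simp add: newton_vertex_const one_pCons)
  then have "newton_vertex w \<beta> ([:lead_coeff f:] * (\<Prod>a\<in>#A. [:- a, 1:]))"
    using assms(2) by (intro newton_vertex_mult newton_vertex_const) auto
  moreover have "[:lead_coeff f:] * (\<Prod>a\<in>#A. [:- a, 1:]) = f"
    using A by simp
  ultimately show ?thesis
    by (simp only:)
qed

definition compatible_graph ::
    "('b \<Rightarrow> 'l with_infinity) \<Rightarrow> ('c \<Rightarrow> 'l with_infinity) \<Rightarrow> ('b \<times> 'c) set \<Rightarrow> bool" where
  "compatible_graph w1 w2 G \<longleftrightarrow> (\<forall>(x, y)\<in>G. w1 x = w2 y)"

text \<open>The value of \<open>z = H(a)\<close> is a slope of its minimal polynomial, so some conjugate \<open>\<zeta>\<close> of \<open>z\<close> has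
  the same value. Extending \<open>z \<mapsto> \<zeta>\<close> to \<open>a\<close> yields the root \<open>r\<close>.\<close>

lemma conjugate_same_value:
  fixes w1 :: "'b::field \<Rightarrow> 'l::linordered_ab_group_add with_infinity"
    and w2 :: "'c::alg_closed_field \<Rightarrow> 'l with_infinity"
  assumes "valuation w1" "valuation w2" "hom_graph G" "algebraic_graph G" "compatible_graph w1 w2 G"
    and F: "(F, F') \<in> poly_graph G" "poly F a = 0"
    and H: "(H, H') \<in> poly_graph G" "poly H a \<noteq> 0"
  obtains r where "poly F' r = 0" "w2 (poly H' r) = w1 (poly H a)"
proof -
  interpret w1: field_valuation w1 by (rule field_valuation.intro) fact
  interpret w2: field_valuation w2 by (rule field_valuation.intro) fact
  interpret hom_graph G by fact
  define z where "z = poly H a"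
  have "w1 z \<noteq> Infty"
    using H(2) by (simp add: z_def)
  then obtain \<beta> where \<beta>: "w1 z = Fin \<beta>"
    by (rule neq_InftyE)
  obtain P P' where P: "(P, P') \<in> poly_graph G" "poly P z = 0" "0 < degree P"
    and P_adjoin: "\<And>r. poly P' r = 0 \<Longrightarrow> adjoinable G z r"
    using hom_graph_adjoin[OF assms(3,4), of z] by metis
  \<comment> \<open>Without such a root \<open>P'\<close> would have a vertex at
    \<open>\<beta>\<close>. Having a vertex depends only on the values of coefficients, which
    \<open>P\<close> shares, yet \<open>P\<close> has the root \<open>z\<close> of value
    \<open>\<beta>\<close>.\<close>
  have "\<exists>\<zeta>. poly P' \<zeta> = 0 \<and> w2 \<zeta> = Fin \<beta>"
  proof (rule ccontr)
    assume none: "\<nexists>\<zeta>. poly P' \<zeta> = 0 \<and> w2 \<zeta> = Fin \<beta>"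
    have "P' \<noteq> 0"
      using poly_graph_degree[OF P(1)] P(3) by auto
    then have "newton_vertex w2 \<beta> P'"
      using none by (intro newton_vertex_split \<open>valuation w2\<close>) auto
    moreover have "w1 (coeff P i) = w2 (coeff P' i)" for i
      using poly_graph_coeff[OF P(1)] assms(5) by (auto simp: compatible_graph_def)
    ultimately have "newton_vertex w1 \<beta> P"
      by (simp add: newton_vertex_def)
    then show False
      using w1.newton_vertex_no_root[OF _ \<beta>] P(2) by blast
  qed
  then obtain \<zeta> where \<zeta>: "poly P' \<zeta> = 0" "w2 \<zeta> = Fin \<beta>"
    by blast
  define G1 where "G1 = adjoin_graph G z \<zeta>"
  have G1: "hom_graph G1" "G \<subseteq> G1" "(z, \<zeta>) \<in> G1"
    using P_adjoin[OF \<zeta>(1)] by (simp_all add: G1_def)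
  obtain F1 F1' where F1: "(F1, F1') \<in> poly_graph G1" "0 < degree F1"
    and F1_adjoin: "\<And>r. poly F1' r = 0 \<Longrightarrow> adjoinable G1 a r"
    using hom_graph_adjoin[OF G1(1) algebraic_graph_mono[OF G1(2) assms(4)], of a] by metis
  have "0 < degree F1'"
    using F1 hom_graph.poly_graph_degree[OF G1(1)] by metis
  then obtain r where r: "poly F1' r = 0"
    using alg_closed_imp_poly_has_root by blast
  define G2 where "G2 = adjoin_graph G1 a r"
  have G2: "hom_graph G2" "G1 \<subseteq> G2" "(a, r) \<in> G2"
    using F1_adjoin[OF r] by (simp_all add: G2_def)
  interpret G2: hom_graph G2 by fact
  have sub: "poly_graph G \<subseteq> poly_graph G2"
    using G1(2) G2(2) by (intro poly_graph_mono) auto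
  have "(poly F a, poly F' r) \<in> G2"
    using F(1) sub G2(3) by (intro G2.graph_poly) auto
  then have "poly F' r = 0"
    using F(2) G2.graph_0_unique by simp
  moreover have "(z, poly H' r) \<in> G2"
    unfolding z_def using H(1) sub G2(3) by (intro G2.graph_poly) auto
  then have "poly H' r = \<zeta>"
    using G1(3) G2(2) G2.graph_unique by blast
  ultimately show thesis
    using that \<zeta>(2) \<beta> by (simp add: z_def)
qed

lemma nsmul_affine_eq:
  fixes a a' b b' :: "'l::linordered_ab_group_add"
  assumes "nsmul t a + b = nsmul t a' + b'" "nsmul s a + b = nsmul s a' + b'" "t \<noteq> s"
  shows "a = a' \<and> b = b'"
  using assms
proof (induction t s rule: linorder_wlog)
  case (le t s)
  then obtain d where d: "s = d + t" "d > 0"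
    by (metis le_imp_less_or_eq less_imp_add_positive add.commute)
  have "nsmul d a + (nsmul t a + b) = nsmul d a' + (nsmul t a' + b')"
    using le.prems(2) by (simp add: d nsmul_add add.assoc)
  then have "nsmul d a = nsmul d a'"
    using le.prems(1) by simp
  then have "a = a'"
    using d(2) by simp
  with le.prems show ?case by simp
next
  case (sym t s)
  then show ?case by metis
qed

text \<open>Values of products \<open>A ^ t * B\<close> depend affinely on \<open>t\<close>: a polynomial witnessing that several
  conjugates of a valuation differ from a given one is found by avoiding finitely many \<open>t\<close>.\<close>

lemma simultaneous_separation:
  fixes w1 :: "'b::field \<Rightarrow> 'l::linordered_ab_group_add with_infinity"
    and w2 :: "'c::field \<Rightarrow> 'l with_infinity"
  assumes "valuation w1" "valuation w2" "hom_graph G" "finite S"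
    and adj: "\<And>r. r \<in> S \<Longrightarrow> hom_graph (adjoin_graph G a r)"
    and incompat: "\<And>r. r \<in> S \<Longrightarrow> \<not> compatible_graph w1 w2 (adjoin_graph G a r)"
  shows "\<exists>(H, H')\<in>poly_graph G. poly H a \<noteq> 0 \<and> (\<forall>r\<in>S. w1 (poly H a) \<noteq> w2 (poly H' r))"
  using \<open>finite S\<close> adj incompat
proof (induction S)
  case empty
  interpret hom_graph G by fact
  have "([:1:], [:1:]) \<in> poly_graph G"
    by (intro poly_graph_const graph_1)
  then show ?case
    by (intro bexI[of _ "([:1:], [:1:])"]) auto
next
  case (insert s S)
  interpret w1: field_valuation w1 by (rule field_valuation.intro) fact
  interpret w2: field_valuation w2 by (rule field_valuation.intro) fact
  interpret hom_graph G by fact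
  have nz: "poly H' r \<noteq> 0" if "r \<in> insert s S" "(H, H') \<in> poly_graph G" "poly H a \<noteq> 0" for r H H'
  proof -
    interpret r: hom_graph "adjoin_graph G a r"
      using insert.prems(1) that(1) .
    have "(poly H a, poly H' r) \<in> adjoin_graph G a r"
      using that(2) unfolding adjoin_graph_def by blast
    from r.graph_zero_iff[OF this] that(3) show ?thesis by simp
  qed
  obtain A A' where A: "(A, A') \<in> poly_graph G" "poly A a \<noteq> 0"
    "\<And>r. r \<in> S \<Longrightarrow> w1 (poly A a) \<noteq> w2 (poly A' r)"
    using insert.IH insert.prems by fastforce
  obtain B B' where B: "(B, B') \<in> poly_graph G" "w1 (poly B a) \<noteq> w2 (poly B' s)"
    using insert.prems(2)[of s] unfolding compatible_graph_def adjoin_graph_def by blast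
  have "poly B a \<noteq> 0"
  proof
    interpret s: hom_graph "adjoin_graph G a s"
      using insert.prems(1)[of s] by simp
    assume "poly B a = 0"
    then have "(0, poly B' s) \<in> adjoin_graph G a s"
      using B(1) unfolding adjoin_graph_def by force
    then have "poly B' s = 0"
      by (rule s.graph_0_unique)
    with B(2) \<open>poly B a = 0\<close> show False by simp
  qed
  \<comment> \<open>The exponents that fail for \<open>r\<close>. Two of them would force equal
    values for both \<open>A\<close> and \<open>B\<close> at \<open>r\<close>, but \<open>A\<close>
    separates the roots in \<open>S\<close> and \<open>B\<close> separates \<open>s\<close>; so each
    set has at most one element.\<close>
  let ?E = "\<lambda>r. {t. w1 (poly (A ^ t * B) a) = w2 (poly (A' ^ t * B') r)}"
  have fin: "finite (?E r)" if r: "r \<in> insert s S" for r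
  proof -
    have "w1 (poly A a) \<noteq> Infty" "w1 (poly B a) \<noteq> Infty" "w2 (poly A' r) \<noteq> Infty" "w2 (poly B' r) \<noteq> Infty"
      using A B \<open>poly B a \<noteq> 0\<close> nz[OF r] by simp_all
    then obtain \<alpha> \<beta> \<alpha>' \<beta>' where vals: "w1 (poly A a) = Fin \<alpha>" "w1 (poly B a) = Fin \<beta>"
      "w2 (poly A' r) = Fin \<alpha>'" "w2 (poly B' r) = Fin \<beta>'"
      by (meson neq_InftyE)
    have E: "?E r = {t. nsmul t \<alpha> + \<beta> = nsmul t \<alpha>' + \<beta>'}"
      by (simp add: w1.val_mult w2.val_mult w1.val_power w2.val_power vals)
    have "\<not> (\<alpha> = \<alpha>' \<and> \<beta> = \<beta>')"
      using r A(3)[of r] B(2) vals by auto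
    then have "t = t'" if "t \<in> ?E r" "t' \<in> ?E r" for t t'
      using that nsmul_affine_eq[of t \<alpha> \<beta> \<alpha>' \<beta>' t'] unfolding E by blast
    then have "?E r \<subseteq> {t}" if "t \<in> ?E r" for t
      using that by blast
    then show ?thesis
      by (cases "?E r = {}") (auto dest: finite_subset)
  qed
  have "finite (\<Union>r\<in>insert s S. ?E r)"
    using fin \<open>finite S\<close> by (intro finite_UN_I) auto
  then obtain t where t: "t \<notin> (\<Union>r\<in>insert s S. ?E r)"
    using ex_new_if_finite[OF infinite_UNIV_nat] by blast
  show ?case
  proof (intro bexI[of _ "(A ^ t * B, A' ^ t * B')"])
    show "(A ^ t * B, A' ^ t * B') \<in> poly_graph G"
      by (intro poly_graph_mult poly_graph_power A B)
    show "case (A ^ t * B, A' ^ t * B') of (H, H') \<Rightarrow> poly H a \<noteq> 0 \<and> (\<forall>r\<in>insert s S. w1 (poly H a) \<noteq> w2 (poly H' r))"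
      using t A(2) \<open>poly B a \<noteq> 0\<close> by auto
  qed
qed

lemma chain_Union_pair:
  assumes "subset.chain \<A> \<C>" "p \<in> \<Union>\<C>" "q \<in> \<Union>\<C>"
  shows "\<exists>G\<in>\<C>. p \<in> G \<and> q \<in> G"
proof -
  from assms(2,3) obtain G G' where "G \<in> \<C>" "p \<in> G" "G' \<in> \<C>" "q \<in> G'"
    by blast
  moreover have "G \<subseteq> G' \<or> G' \<subseteq> G"
    using assms(1) \<open>G \<in> \<C>\<close> \<open>G' \<in> \<C>\<close> by (auto simp: subset.chain_def)
  ultimately show ?thesis by blast
qed

text \<open>Only a value-preserving embedding is claimed, not a bijection. In this form the theorem
  also covers embeddings of a rational function field into its algebraic closure.\<close>

theorem conjugate_valuations:
  fixes w1 :: "'b::field \<Rightarrow> 'l::linordered_ab_group_add with_infinity"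
    and w2 :: "'c::alg_closed_field \<Rightarrow> 'l with_infinity"
  assumes "valuation w1" "valuation w2" "hom_graph G\<^sub>0" "algebraic_graph G\<^sub>0"
    "compatible_graph w1 w2 G\<^sub>0"
  obtains s where "\<And>x y. s (x + y) = s x + s y" "\<And>x y. s (x * y) = s x * s y"
    "\<And>x y. (x, y) \<in> G\<^sub>0 \<Longrightarrow> s x = y" "\<And>x. w1 x = w2 (s x)"
proof -
  define \<E> where "\<E> = {G. hom_graph G \<and> G\<^sub>0 \<subseteq> G \<and> compatible_graph w1 w2 G}"
  have "\<exists>G\<in>\<E>. \<forall>G'\<in>\<E>. G \<subseteq> G' \<longrightarrow> G' = G"
  proof (rule subset_Zorn_nonempty)
    show "\<E> \<noteq> {}"
      using assms by (auto simp: \<E>_def)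
    fix \<C> assume \<C>: "\<C> \<noteq> {}" "subset.chain \<E> \<C>"
    have mem: "hom_graph G" "G\<^sub>0 \<subseteq> G" "compatible_graph w1 w2 G" if "G \<in> \<C>" for G
      using \<C>(2) that by (auto simp: subset.chain_def \<E>_def)
    note two = chain_Union_pair[OF \<C>(2)]
    have "hom_graph (\<Union>\<C>)"
    proof
      show "(1, 1) \<in> \<Union>\<C>"
        using \<C>(1) mem(1) hom_graph.graph_1 by blast
    next
      fix x y x' y' assume "(x, y) \<in> \<Union>\<C>" "(x', y') \<in> \<Union>\<C>"
      then obtain G where G: "G \<in> \<C>" "(x, y) \<in> G" "(x', y') \<in> G"
        using two by blast
      then show "(x + x', y + y') \<in> \<Union>\<C>" "(x * x', y * y') \<in> \<Union>\<C>"
        using mem(1) hom_graph.graph_add hom_graph.graph_mult by blast+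
    next
      fix x y assume "(x, y) \<in> \<Union>\<C>"
      then obtain G where G: "G \<in> \<C>" "(x, y) \<in> G"
        by blast
      then show "(- x, - y) \<in> \<Union>\<C>" "\<exists>y'. (inverse x, y') \<in> \<Union>\<C>"
        using mem(1) hom_graph.graph_minus hom_graph.graph_inverse by blast+
    next
      fix y assume "(0, y) \<in> \<Union>\<C>"
      then show "y = 0"
        using mem(1) hom_graph.graph_0_unique by blast
    qed
    moreover have "G\<^sub>0 \<subseteq> \<Union>\<C>"
      using \<C>(1) mem(2) by blast
    moreover have "compatible_graph w1 w2 (\<Union>\<C>)"
      using mem(3) unfolding compatible_graph_def by blast
    ultimately show "\<Union>\<C> \<in> \<E>"
      by (simp add: \<E>_def)
  qed
  then obtain G where "G \<in> \<E>" and max: "\<And>G'. G' \<in> \<E> \<Longrightarrow> G \<subseteq> G' \<Longrightarrow> G' = G"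
    by blast
  then have G: "hom_graph G" "G\<^sub>0 \<subseteq> G" "compatible_graph w1 w2 G"
    by (auto simp: \<E>_def)
  interpret hom_graph G by fact
  have alg: "algebraic_graph G"
    using algebraic_graph_mono[OF G(2) assms(4)] .
  \<comment> \<open>Maximality makes the extension to a new \<open>a\<close> incompatible for every
    root of \<open>F'\<close>. A single \<open>H\<close> then detects all these failures, whereas
    \<open>conjugate_same_value\<close> supplies a root that is right for this
    \<open>H\<close>.\<close>
  have total: "\<exists>r. (a, r) \<in> G" for a
  proof (rule ccontr)
    assume none: "\<nexists>r. (a, r) \<in> G"
    obtain F F' where F: "(F, F') \<in> poly_graph G" "poly F a = 0" "0 < degree F"
      and F_adjoin: "\<And>r. poly F' r = 0 \<Longrightarrow> adjoinable G a r"
      using hom_graph_adjoin[OF G(1) alg, of a] by metis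
    define S where "S = {r. poly F' r = 0}"
    have "F' \<noteq> 0"
      using poly_graph_degree[OF F(1)] F(3) by auto
    then have "finite S"
      unfolding S_def by (rule poly_roots_finite)
    have "hom_graph (adjoin_graph G a r)" if "r \<in> S" for r
      using F_adjoin that by (simp add: S_def)
    moreover have "\<not> compatible_graph w1 w2 (adjoin_graph G a r)" if "r \<in> S" for r
      using F_adjoin[of r] that max[of "adjoin_graph G a r"] none G(2) by (auto simp: S_def \<E>_def)
    ultimately obtain H H' where H: "(H, H') \<in> poly_graph G" "poly H a \<noteq> 0"
      "\<And>r. r \<in> S \<Longrightarrow> w1 (poly H a) \<noteq> w2 (poly H' r)"
      using simultaneous_separation[OF assms(1,2) G(1) \<open>finite S\<close>, of a] by fast
    obtain r where "poly F' r = 0" "w2 (poly H' r) = w1 (poly H a)"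
      using conjugate_same_value[OF assms(1,2) G(1) alg G(3) F(1,2) H(1,2)] .
    with H(3)[of r] show False
      by (simp add: S_def)
  qed
  define s where "s x = (SOME y. (x, y) \<in> G)" for x
  have s: "(x, s x) \<in> G" for x
    unfolding s_def using total by (rule someI_ex)
  have s_eq: "s x = y" if "(x, y) \<in> G" for x y
    using graph_unique[OF s that] .
  show thesis
  proof
    show "s (x + y) = s x + s y" "s (x * y) = s x * s y" for x y
      by (intro s_eq graph_add graph_mult s)+
    show "s x = y" if "(x, y) \<in> G\<^sub>0" for x y
      using s_eq G(2) that by blast
    show "w1 x = w2 (s x)" for x
      using G(3) s[of x] by (auto simp: compatible_graph_def)
  qed
qed

section \<open>Chevalley's theorem by maximal subrings\<close>

section \<open>Extension of valuations\<close>

locale unital_subring =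
  fixes A :: "'b::field set"
  assumes ring_1: "1 \<in> A"
    and ring_add: "x \<in> A \<Longrightarrow> y \<in> A \<Longrightarrow> x + y \<in> A"
    and ring_mult: "x \<in> A \<Longrightarrow> y \<in> A \<Longrightarrow> x * y \<in> A"
    and ring_minus: "x \<in> A \<Longrightarrow> - x \<in> A"
begin

lemma ring_0: "0 \<in> A"
  using ring_add[OF ring_1 ring_minus[OF ring_1]] by simp

lemma ring_diff: "x \<in> A \<Longrightarrow> y \<in> A \<Longrightarrow> x - y \<in> A"
  using ring_add[of x "- y"] ring_minus[of y] by simp

lemma ring_power: "x \<in> A \<Longrightarrow> x ^ n \<in> A"
  by (induction n) (auto intro: ring_1 ring_mult)

lemma ring_sum: "(\<And>i. i \<in> I \<Longrightarrow> f i \<in> A) \<Longrightarrow> sum f I \<in> A"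
  by (induction I rule: infinite_finite_induct) (auto intro: ring_0 ring_add)

lemma subring_adjoin: "unital_subring {poly p u |p. p \<in> polys_over A}"
proof
  show "1 \<in> {poly p u |p. p \<in> polys_over A}"
    by (rule CollectI, rule exI[of _ "[:1:]"])
      (auto simp: polys_over_def coeff_pCons ring_1 ring_0 split: nat.splits)
  fix x y assume "x \<in> {poly p u |p. p \<in> polys_over A}" "y \<in> {poly p u |p. p \<in> polys_over A}"
  then obtain p q where pq: "p \<in> polys_over A" "q \<in> polys_over A" "x = poly p u" "y = poly q u"
    by blast
  have "p + q \<in> polys_over A" "p * q \<in> polys_over A"
    using pq by (auto simp: polys_over_def coeff_mult intro!: ring_add ring_sum ring_mult)
  then show "x + y \<in> {poly p u |p. p \<in> polys_over A}" "x * y \<in> {poly p u |p. p \<in> polys_over A}"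
    unfolding pq(3,4) by (metis (mono_tags, lifting) mem_Collect_eq poly_add)
      (metis (mono_tags, lifting) \<open>p * q \<in> polys_over A\<close> mem_Collect_eq poly_mult)
next
  fix x assume "x \<in> {poly p u |p. p \<in> polys_over A}"
  then obtain p where p: "p \<in> polys_over A" "x = poly p u"
    by blast
  then have "- p \<in> polys_over A" "- x = poly (- p) u"
    by (auto simp: polys_over_def intro: ring_minus)
  then show "- x \<in> {poly p u |p. p \<in> polys_over A}"
    by blast
qed

end

locale subfield_valuation =
  fixes F :: "'b::field set" and w :: "'b \<Rightarrow> 'l::linordered_ab_group_add with_infinity"
  assumes F: "is_subfield F" and w: "valuation_on F w"
begin

lemma F_mult: "x \<in> F \<Longrightarrow> y \<in> F \<Longrightarrow> w (x * y) = w x + w y"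
  and F_add: "x \<in> F \<Longrightarrow> y \<in> F \<Longrightarrow> min (w x) (w y) \<le> w (x + y)"
  and F_0 [simp]: "w 0 = Infty" and F_1 [simp]: "w 1 = 0"
  using w unfolding valuation_on_def by auto

lemma F_inverse:
  assumes "x \<in> F" "x \<noteq> 0"
  obtains a where "w x = Fin a" "w (inverse x) = Fin (- a)"
proof -
  have "w x + w (inverse x) = Fin 0"
    using F_mult[OF assms(1), of "inverse x"] assms subfield_closed(6)[OF F]
    by (simp add: zero_with_infinity_Fin)
  then show thesis
    using that by (cases "w x"; cases "w (inverse x)") (auto simp: minus_unique)
qed

lemma F_power: "x \<in> F \<Longrightarrow> w (x ^ n) = nsmul n (w x)"
  by (induction n) (auto simp: F_mult subfield_power[OF F])

lemma F_minus:
  assumes "x \<in> F" shows "w (- x) = w x"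
proof -
  have m: "- 1 \<in> F"
    using subfield_closed[OF F] by blast
  have "w (- 1) + w (- 1) = Fin 0"
    using F_mult[OF m m] by (simp add: zero_with_infinity_Fin)
  then have "w (- 1) = 0"
    by (cases "w (- 1)") (auto simp: zero_with_infinity_Fin)
  then show ?thesis
    using F_mult[OF m assms] by simp
qed

lemma F_divide:
  assumes "x \<in> F" "y \<in> F" "w x \<le> w y" "x \<noteq> 0"
  shows "0 \<le> w (y / x)"
proof -
  obtain a where a: "w x = Fin a" "w (inverse x) = Fin (- a)"
    using F_inverse[OF assms(1,4)] .
  have "w (y / x) = w y + Fin (- a)"
    unfolding divide_inverse using a assms subfield_closed(6)[OF F] by (simp add: F_mult)
  with assms(3) a show ?thesis
    by (cases "w y") (auto simp: zero_with_infinity_Fin)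
qed

text \<open>The rings that meet \<open>F\<close> exactly in the valuation ring of \<open>w\<close>.
  This amounts to the maximal ideal of \<open>w\<close> generating a proper ideal, so Zorn's lemma
  can run over rings alone instead of pairs of a ring and an ideal.\<close>

definition extension_rings :: "'b set set" where
  "extension_rings = {A. unital_subring A \<and> {x \<in> F. 0 \<le> w x} \<subseteq> A \<and> (\<forall>x\<in>A \<inter> F. 0 \<le> w x)}"

lemma subring_valuation_ring: "unital_subring {x \<in> F. 0 \<le> w x}"
proof
  show "1 \<in> {x \<in> F. 0 \<le> w x}"
    using subfield_closed[OF F] by simp
next
  fix x y assume xy: "x \<in> {x \<in> F. 0 \<le> w x}" "y \<in> {x \<in> F. 0 \<le> w x}"
  then have F: "x \<in> F" "y \<in> F" and nonneg: "0 \<le> w x" "0 \<le> w y"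
    by blast+
  have "0 \<le> min (w x) (w y)"
    using nonneg by (rule min.boundedI)
  then have "0 \<le> w (x + y)"
    using F_add[OF F] by (rule order_trans)
  then show "x + y \<in> {x \<in> F. 0 \<le> w x}"
    using subfield_closed(3)[OF subfield_valuation.F F] subfield_valuation_axioms by blast
  have "0 \<le> w (x * y)"
    unfolding F_mult[OF F] using nonneg by (rule add_nonneg_nonneg)
  then show "x * y \<in> {x \<in> F. 0 \<le> w x}"
    using subfield_closed(4)[OF subfield_valuation.F F] subfield_valuation_axioms by blast
next
  fix x assume "x \<in> {x \<in> F. 0 \<le> w x}"
  then show "- x \<in> {x \<in> F. 0 \<le> w x}"
    using subfield_closed(5)[OF F] by (simp add: F_minus)
qed

lemma maximal_extension_ring:
  obtains A where "A \<in> extension_rings" "\<And>B. B \<in> extension_rings \<Longrightarrow> A \<subseteq> B \<Longrightarrow> B = A"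
proof -
  have "\<exists>A\<in>extension_rings. \<forall>B\<in>extension_rings. A \<subseteq> B \<longrightarrow> B = A"
  proof (rule subset_Zorn_nonempty)
    show "extension_rings \<noteq> {}"
      unfolding extension_rings_def using subring_valuation_ring by blast
    fix \<C> assume \<C>: "\<C> \<noteq> {}" "subset.chain extension_rings \<C>"
    have mem: "unital_subring A" "{x \<in> F. 0 \<le> w x} \<subseteq> A" "\<forall>x\<in>A \<inter> F. 0 \<le> w x" if "A \<in> \<C>" for A
      using \<C>(2) that by (auto simp: subset.chain_def extension_rings_def)
    note two = chain_Union_pair[OF \<C>(2)]
    have "unital_subring (\<Union>\<C>)"
    proof
      show "1 \<in> \<Union>\<C>"
        using \<C>(1) mem(1) unital_subring.ring_1 by blast
    next
      fix x y assume "x \<in> \<Union>\<C>" "y \<in> \<Union>\<C>"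
      then obtain A where A: "A \<in> \<C>" "x \<in> A" "y \<in> A"
        using two by blast
      then show "x + y \<in> \<Union>\<C>" "x * y \<in> \<Union>\<C>"
        using mem(1) unital_subring.ring_add unital_subring.ring_mult by blast+
    next
      fix x assume "x \<in> \<Union>\<C>"
      then show "- x \<in> \<Union>\<C>"
        using mem(1) unital_subring.ring_minus by blast
    qed
    moreover have "{x \<in> F. 0 \<le> w x} \<subseteq> \<Union>\<C>"
      using \<C>(1) mem(2) by blast
    moreover have "\<forall>x\<in>\<Union>\<C> \<inter> F. 0 \<le> w x"
      using mem(3) by blast
    ultimately show "\<Union>\<C> \<in> extension_rings"
      by (simp add: extension_rings_def)
  qed
  then show thesis
    using that by blast
qed

end

section \<open>A maximal ring is a valuation ring\<close>

locale maximal_ring = subfield_valuation F w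
  for F :: "'b::field set" and w :: "'b \<Rightarrow> 'l::linordered_ab_group_add with_infinity" +
  fixes A :: "'b set"
  assumes ext: "A \<in> extension_rings"
    and max: "\<And>B. B \<in> extension_rings \<Longrightarrow> A \<subseteq> B \<Longrightarrow> B = A"
begin

sublocale unital_subring A
  using ext by (simp add: extension_rings_def)

lemma A_F_iff: "x \<in> F \<Longrightarrow> x \<in> A \<longleftrightarrow> 0 \<le> w x"
  using ext by (auto simp: extension_rings_def)

text \<open>No sums are needed to obtain an ideal: of two elements of the maximal ideal of \<open>w\<close>, one divides the other.\<close>

definition I :: "'b set" where
  "I = {m * a |m a. m \<in> F \<and> 0 < w m \<and> a \<in> A}"

lemma I_mult: "x \<in> I \<Longrightarrow> y \<in> A \<Longrightarrow> x * y \<in> I"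
  unfolding I_def by (force intro: ring_mult simp: mult.assoc)

lemma I_subset: "x \<in> I \<Longrightarrow> x \<in> A"
  unfolding I_def using A_F_iff by (auto intro!: ring_mult simp: less_imp_le)

lemma I_0: "0 \<in> I"
proof -
  have "(0 :: 'b) \<in> F" "(0 :: 'l with_infinity) < w 0"
    using subfield_closed[OF F] by (auto simp: zero_with_infinity_Fin)
  then show ?thesis
    unfolding I_def using ring_0 by force
qed

lemma I_add_aux:
  assumes "m \<in> F" "0 < w m" "a \<in> A" "m' \<in> F" "0 < w m'" "a' \<in> A" "w m \<le> w m'"
  shows "m * a + m' * a' \<in> I"
proof (cases "m = 0")
  case True
  then have "m * a + m' * a' = m' * a'"
    by simp
  then show ?thesis
    using assms unfolding I_def by blast
next
  case False
  have "m' / m \<in> A"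
    using F_divide[of m m'] False assms subfield_closed(8)[OF F] by (simp add: A_F_iff)
  then have "a + m' / m * a' \<in> A"
    using assms by (intro ring_add ring_mult)
  moreover have "m * a + m' * a' = m * (a + m' / m * a')"
    using False by (simp add: field_simps)
  ultimately show ?thesis
    using assms unfolding I_def by blast
qed

lemma I_add: "x \<in> I \<Longrightarrow> y \<in> I \<Longrightarrow> x + y \<in> I"
proof -
  assume "x \<in> I" "y \<in> I"
  then obtain m a m' a' where *: "m \<in> F" "0 < w m" "a \<in> A" "x = m * a"
    "m' \<in> F" "0 < w m'" "a' \<in> A" "y = m' * a'"
    unfolding I_def by blast
  show ?thesis
  proof (cases "w m \<le> w m'")
    case True
    then show ?thesis
      using I_add_aux * by simp
  next
    case False
    then show ?thesis
      using I_add_aux[of m' a' m a] * by (simp add: add.commute)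
  qed
qed

lemma I_sum: "(\<And>i. i \<in> J \<Longrightarrow> f i \<in> I) \<Longrightarrow> sum f J \<in> I"
  by (induction J rule: infinite_finite_induct) (auto intro: I_0 I_add)

text \<open>If \<open>m * a = 1\<close>, then \<open>a\<close> is the inverse of \<open>m\<close>,
  an element of \<open>A\<close> and of \<open>F\<close> with negative value.\<close>

lemma one_notin_I: "1 \<notin> I"
proof
  assume "1 \<in> I"
  then obtain m a where *: "m \<in> F" "0 < w m" "a \<in> A" "1 = m * a"
    unfolding I_def by blast
  have "m \<noteq> 0" using * by auto
  then have "a = inverse m"
    using inverse_unique[of m a] * by simp
  then have "0 \<le> w (inverse m)"
    using * A_F_iff subfield_closed(6)[OF F] by blast
  with F_inverse[OF \<open>m \<in> F\<close> \<open>m \<noteq> 0\<close>] \<open>0 < w m\<close> show False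
    by (metis neg_0_le_iff_le linorder_not_le with_infinity_le_simps(1,2) zero_with_infinity_Fin)
qed

lemma poly_in_I:
  assumes "p \<in> polys_over I" "u \<in> A"
  shows "poly p u \<in> I"
  using assms unfolding poly_altdef polys_over_def by (auto intro!: I_sum I_mult ring_power)

text \<open>By maximality the larger ring generated by \<open>A\<close> and \<open>u\<close>
  contains an \<open>x\<close> in \<open>F\<close> of negative value. Writing \<open>x\<close> as a
  polynomial in \<open>u\<close> and multiplying by its inverse, which has positive value, gives the
  relation.\<close>

lemma notin_A_relation:
  assumes "u \<notin> A"
  obtains p where "p \<in> polys_over I" "poly p u = 1"
proof -
  let ?B = "{poly p u |p. p \<in> polys_over A}"
  have "unital_subring ?B"
    by (rule subring_adjoin)
  have "A \<subseteq> ?B"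
  proof
    fix a assume "a \<in> A"
    then have "[:a:] \<in> polys_over A"
      by (auto simp: polys_over_def coeff_pCons ring_0 split: nat.splits)
    moreover have "a = poly [:a:] u" by simp
    ultimately show "a \<in> ?B" by blast
  qed
  moreover have "u \<in> ?B"
  proof -
    have "[:0, 1:] \<in> polys_over A"
      by (auto simp: polys_over_def coeff_pCons ring_0 ring_1 split: nat.splits)
    moreover have "u = poly [:0, 1:] u" by simp
    ultimately show ?thesis by blast
  qed
  ultimately have "?B \<notin> extension_rings"
    using max assms by blast
  moreover have "{x \<in> F. 0 \<le> w x} \<subseteq> ?B"
    using A_F_iff \<open>A \<subseteq> ?B\<close> by blast
  ultimately obtain x where x: "x \<in> ?B" "x \<in> F" "\<not> 0 \<le> w x"
    unfolding extension_rings_def using \<open>unital_subring ?B\<close> by blast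
  from x(1) obtain p where p: "p \<in> polys_over A" "x = poly p u"
    by blast
  have "x \<noteq> 0"
    using x(3) by auto
  define m where "m = inverse x"
  have "m \<in> F"
    using x subfield_closed[OF F] by (simp add: m_def)
  have "0 < w m"
    using F_inverse[OF x(2) \<open>x \<noteq> 0\<close>] x(3) unfolding m_def
    by (metis neg_0_less_iff_less linorder_not_le with_infinity_le_simps(1,2) zero_with_infinity_Fin)
  show thesis
  proof
    show "smult m p \<in> polys_over I"
      using p(1) \<open>m \<in> F\<close> \<open>0 < w m\<close> by (auto simp: polys_over_def I_def)
    show "poly (smult m p) u = 1"
      using \<open>x \<noteq> 0\<close> p(2) by (simp add: m_def)
  qed
qed

lemma reflect_polys_over_I: "p \<in> polys_over I \<Longrightarrow> reflect_poly p \<in> polys_over I"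
  by (auto simp: polys_over_def coeff_reflect_poly I_0)

text \<open>\<open>I\<close> lies in the Jacobson radical. Otherwise the relation for the inverse of
  \<open>y = 1 - c\<close>, multiplied by a power of \<open>y\<close>, puts that power in
  \<open>I\<close>; but powers of \<open>y\<close> are congruent to 1 modulo
  \<open>I\<close>.\<close>

lemma unit_1_minus:
  assumes "c \<in> I"
  shows "inverse (1 - c) \<in> A"
proof (rule ccontr)
  define y where "y = 1 - c"
  have "y \<noteq> 0"
    using assms one_notin_I by (auto simp: y_def)
  have "y \<in> A"
    unfolding y_def using assms by (intro ring_diff ring_1 I_subset)
  assume "inverse (1 - c) \<notin> A"
  then obtain p where p: "p \<in> polys_over I" "poly p (inverse y) = 1"
    using notin_A_relation unfolding y_def by blast
  have "y ^ degree p = poly (reflect_poly p) y"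
    using poly_reflect_poly_nz[OF \<open>y \<noteq> 0\<close>, of p] p(2) by simp
  then have yn: "y ^ degree p \<in> I"
    using poly_in_I[OF reflect_polys_over_I[OF p(1)] \<open>y \<in> A\<close>] by simp
  have "1 - y ^ n \<in> I" for n
  proof (induction n)
    case (Suc n)
    have "1 - y ^ Suc n = (1 - y ^ n) * y + c"
      by (simp add: y_def algebra_simps)
    with Suc assms \<open>y \<in> A\<close> show ?case
      by (simp only:) (intro I_add I_mult)
  qed (simp add: I_0)
  from I_add[OF this[of "degree p"] yn] one_notin_I show False
    by simp
qed

text \<open>As \<open>1 - q0\<close> is invertible in \<open>A\<close>, multiplying the relation for
  \<open>inverse u\<close> by \<open>u ^ k\<close> expresses \<open>u ^ k\<close> as a polynomial
  \<open>s\<close> in \<open>u\<close> over \<open>I\<close> of degree below \<open>k\<close>.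
  Substituting this into the leading term of \<open>p\<close> lowers the degree.\<close>

lemma relation_decrease:
  assumes "u \<noteq> 0" and p: "p \<in> polys_over I" "poly p u = 1"
    and q: "q \<in> polys_over I" "poly q (inverse u) = 1" and le: "degree q \<le> degree p"
  obtains p' where "p' \<in> polys_over I" "poly p' u = 1" "degree p' < degree p"
proof -
  obtain q0 q1 where Q: "q = pCons q0 q1"
    by (rule pCons_cases)
  have q0: "q0 \<in> I" and q1: "q1 \<in> polys_over I"
    using q(1) unfolding Q polys_over_def by (force simp: coeff_pCons split: nat.splits)+
  have "q1 \<noteq> 0"
    using q(2) q0 one_notin_I unfolding Q by auto
  define k where "k = degree q"
  have k: "k = Suc (degree q1)"
    using \<open>q1 \<noteq> 0\<close> by (simp add: k_def Q)
  define e where "e = inverse (1 - q0)"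
  have "e \<in> A"
    using unit_1_minus[OF q0] by (simp add: e_def)
  have "1 - q0 \<noteq> 0"
    using q0 one_notin_I by auto
  define s where "s = smult e (reflect_poly q1)"
  have s: "s \<in> polys_over I"
    using reflect_polys_over_I[OF q1] I_mult[OF _ \<open>e \<in> A\<close>]
    by (auto simp: s_def polys_over_def mult.commute[of e])
  have degs: "degree s < k"
    using degree_reflect_poly_le[of q1] degree_smult_le[of e "reflect_poly q1"]
    by (simp add: s_def k)
  have eq: "1 - q0 = inverse u * poly q1 (inverse u)"
    using q(2) unfolding Q by (simp add: algebra_simps)
  have su: "poly s u = u ^ k"
  proof -
    have "poly (reflect_poly q1) u = u ^ degree q1 * poly q1 (inverse u)"
      by (rule poly_reflect_poly_nz[OF \<open>u \<noteq> 0\<close>])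
    also have "poly q1 (inverse u) = u * (1 - q0)"
      unfolding eq using \<open>u \<noteq> 0\<close> by simp
    finally show ?thesis
      unfolding s_def e_def k using \<open>1 - q0 \<noteq> 0\<close> by simp
  qed
  define n where "n = degree p"
  have "k \<le> n" "0 < n"
    using le k by (auto simp: n_def k_def)
  define p' where "p' = p - monom (coeff p n) n + smult (coeff p n) (monom 1 (n - k) * s)"
  have cI: "coeff p i \<in> I" for i
    using p(1) by (simp add: polys_over_def)
  have "p' \<in> polys_over I"
  proof -
    have "coeff s i \<in> A" for i
      using s I_subset by (auto simp: polys_over_def)
    then have "coeff (smult (coeff p n) (monom 1 (n - k) * s)) i \<in> I" for i
      using cI[of n] by (auto simp: coeff_monom_mult intro!: I_mult simp: I_0)
    moreover have "coeff (p - monom (coeff p n) n) i \<in> I" for i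
      using cI by (auto simp: I_0)
    ultimately show ?thesis
      unfolding p'_def polys_over_def by (simp only: coeff_add mem_Collect_eq) (blast intro: I_add)
  qed
  moreover have "poly p' u = 1"
  proof -
    have "u ^ (n - k) * u ^ k = u ^ n"
      using \<open>k \<le> n\<close> by (simp flip: power_add)
    then show ?thesis
      using p(2) su by (simp add: p'_def poly_monom)
  qed
  moreover have "degree p' < degree p"
    unfolding n_def[symmetric]
  proof (rule degree_lessI)
    show "p' \<noteq> 0 \<or> 0 < n"
      using \<open>0 < n\<close> by simp
    show "\<forall>j\<ge>n. coeff p' j = 0"
    proof (intro allI impI)
      fix j assume j: "n \<le> j"
      have "coeff (monom 1 (n - k) * s) j = 0"
        using j degs \<open>k \<le> n\<close> by (auto simp: coeff_monom_mult intro!: coeff_eq_0)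
      moreover have "coeff (p - monom (coeff p n) n) j = 0"
        using j by (cases "j = n") (auto simp: n_def intro!: coeff_eq_0)
      ultimately show "coeff p' j = 0"
        by (simp add: p'_def)
    qed
  qed
  ultimately show thesis
    using that by blast
qed

text \<open>Relations for \<open>u\<close> and for its inverse are taken with least total degree.
  Whichever has the larger degree is shortened by the other.\<close>

lemma valuation_ring: "u \<in> A \<or> inverse u \<in> A"
proof (rule ccontr)
  assume "\<not> (u \<in> A \<or> inverse u \<in> A)"
  then have u: "u \<notin> A" "inverse u \<notin> A" "u \<noteq> 0" "inverse u \<noteq> 0"
    using ring_0 by auto
  define rel where "rel x \<longleftrightarrow> (fst x \<in> polys_over I \<and> poly (fst x) u = 1) \<and>
    snd x \<in> polys_over I \<and> poly (snd x) (inverse u) = 1" for x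
  obtain p0 where p0: "p0 \<in> polys_over I" "poly p0 u = 1"
    using notin_A_relation[OF u(1)] .
  obtain q0 where q0: "q0 \<in> polys_over I" "poly q0 (inverse u) = 1"
    using notin_A_relation[OF u(2)] .
  have "rel (p0, q0)"
    using p0 q0 by (simp add: rel_def)
  then obtain x where "rel x" and min: "\<And>y. rel y \<Longrightarrow> degree (fst x) + degree (snd x) \<le> degree (fst y) + degree (snd y)"
    using ex_has_least_nat[of rel "(p0, q0)" "\<lambda>x. degree (fst x) + degree (snd x)"] by blast
  define p q where "p = fst x" and "q = snd x"
  have x: "x = (p, q)"
    by (simp add: p_def q_def)
  have pq: "p \<in> polys_over I" "poly p u = 1" "q \<in> polys_over I" "poly q (inverse u) = 1"
    using \<open>rel x\<close> by (simp_all add: rel_def p_def q_def)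
  show False
  proof (cases "degree q \<le> degree p")
    case True
    obtain p' where "p' \<in> polys_over I" "poly p' u = 1" "degree p' < degree p"
      using relation_decrease[OF u(3) pq True] .
    then show False
      using min[of "(p', q)"] pq by (simp add: x rel_def)
  next
    case False
    have pq': "poly p (inverse (inverse u)) = 1"
      using pq(2) u(3) by simp
    obtain q' where "q' \<in> polys_over I" "poly q' (inverse u) = 1" "degree q' < degree q"
      using relation_decrease[OF u(4) pq(3,4,1) pq'] False by force
    then show False
      using min[of "(p, q')"] pq by (simp add: x rel_def)
  qed
qed

section \<open>From the valuation ring to values in the divisible group\<close>

definition units :: "'b set" where
  "units = {z \<in> A. z \<noteq> 0 \<and> inverse z \<in> A}"

lemma units_mult: "x \<in> units \<Longrightarrow> y \<in> units \<Longrightarrow> x * y \<in> units"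
  by (auto simp: units_def intro!: ring_mult)

lemma units_inverse: "x \<in> units \<Longrightarrow> inverse x \<in> units"
  by (auto simp: units_def)

lemma units_1: "1 \<in> units"
  by (simp add: units_def ring_1)

lemma units_power: "x \<in> units \<Longrightarrow> x ^ n \<in> units"
  by (induction n) (auto intro: units_1 units_mult)

text \<open>One of \<open>x / y\<close> and \<open>y / x\<close> lies in \<open>A\<close>, say the
  first; then \<open>y\<close> divides \<open>x + y\<close>, and would be a unit together with
  it.\<close>

lemma nonunits_add:
  assumes "x \<in> A - units" "y \<in> A - units"
  shows "x + y \<in> A - units"
proof -
  have aux: "x + y \<notin> units" if "x \<in> A" "y \<in> A" "y \<notin> units" "y \<noteq> 0" "x / y \<in> A" for x y
  proof
    assume "x + y \<in> units"
    then have "inverse (x + y) \<in> A" "x + y \<noteq> 0"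
      by (auto simp: units_def)
    then have "(1 + x / y) * inverse (x + y) \<in> A"
      using that by (intro ring_mult ring_add ring_1)
    moreover have "(1 + x / y) * inverse (x + y) = inverse y"
      using \<open>y \<noteq> 0\<close> \<open>x + y \<noteq> 0\<close> by (simp add: divide_simps)
    ultimately show False
      using that by (auto simp: units_def)
  qed
  have "x + y \<notin> units"
  proof (cases "x = 0 \<or> y = 0")
    case False
    have "x / y \<in> A \<or> y / x \<in> A"
      using valuation_ring[of "x / y"] by simp
    then show ?thesis
      using aux[of x y] aux[of y x] False assms by (auto simp: add.commute)
  qed (use assms in auto)
  then show ?thesis
    using assms by (auto intro: ring_add)
qed

lemma nonunits_sum:
  "(\<And>i. i \<in> J \<Longrightarrow> f i \<in> A - units) \<Longrightarrow> sum f J \<in> A - units"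
proof (induction J rule: infinite_finite_induct)
  case (insert x J)
  then show ?case
    using nonunits_add[of "f x" "sum f J"] by simp
qed (simp_all add: ring_0 units_def)

lemma exists_minimal_term:
  assumes "finite S" "S \<noteq> {}" "\<And>i. i \<in> S \<Longrightarrow> T i \<noteq> 0"
  shows "\<exists>i\<in>S. \<forall>j\<in>S. T j / T i \<in> A"
  using assms
proof (induction S rule: finite_ne_induct)
  case (singleton i)
  then show ?case by (simp add: ring_1)
next
  case (insert k S)
  then obtain i where i: "i \<in> S" "\<forall>j\<in>S. T j / T i \<in> A"
    by auto
  have nz: "T i \<noteq> 0" "T k \<noteq> 0"
    using insert i by auto
  consider "T k / T i \<in> A" | "T i / T k \<in> A"
    using valuation_ring[of "T k / T i"] by auto
  then show ?case
  proof cases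
    case 1
    with i show ?thesis by auto
  next
    case 2
    have "T j / T k \<in> A" if "j \<in> S" for j
    proof -
      have "T j / T k = (T j / T i) * (T i / T k)"
        using nz by simp
      with 2 i that show ?thesis
        by (simp only: ring_mult)
    qed
    with nz show ?thesis
      by (auto intro!: bexI[of _ k] simp: ring_1)
  qed
qed

text \<open>In an algebraic relation for \<open>z\<close>, divided by a term \<open>T i\<close> that
  divides all others, the remaining ratios sum to -1. They cannot all be nonunits, so some
  \<open>T j / T i\<close> is a unit, and this is a power of \<open>z\<close> (or its inverse) up to
  a factor from \<open>F\<close>.\<close>

lemma algebraic_power_unit:
  assumes "algebraic_over F z" "z \<noteq> 0"
  obtains n c where "0 < n" "c \<in> F" "c \<noteq> 0" "z ^ n * inverse c \<in> units"
proof -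
  obtain P where P: "P \<in> polys_over F" "P \<noteq> 0" "poly P z = 0"
    using assms(1) unfolding algebraic_over_def by blast
  define T where "T i = coeff P i * z ^ i" for i
  define S where "S = {i. coeff P i \<noteq> 0}"
  have "finite S"
    unfolding S_def by (rule finite_subset[of _ "{..degree P}"]) (auto intro: le_degree)
  have "S \<noteq> {}"
    using P(2) by (auto simp: S_def poly_eq_iff)
  have Tnz: "T i \<noteq> 0" if "i \<in> S" for i
    using that assms(2) by (simp add: T_def S_def)
  obtain i where i: "i \<in> S" "\<And>j. j \<in> S \<Longrightarrow> T j / T i \<in> A"
    using exists_minimal_term[of S T] \<open>finite S\<close> \<open>S \<noteq> {}\<close> Tnz by blast
  have "\<exists>j\<in>S - {i}. T j / T i \<in> units"
  proof (rule ccontr)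
    assume none: "\<not> (\<exists>j\<in>S - {i}. T j / T i \<in> units)"
    have "sum T S = poly P z"
      unfolding poly_altdef T_def S_def
      by (intro sum.mono_neutral_left) (auto intro: le_degree)
    then have "0 = sum T S / T i"
      using P(3) by simp
    also have "\<dots> = (\<Sum>j\<in>S. T j / T i)"
      by (rule sum_divide_distrib)
    also have "\<dots> = 1 + (\<Sum>j\<in>S - {i}. T j / T i)"
      using \<open>finite S\<close> i(1) Tnz by (simp add: sum.remove)
    finally have "(\<Sum>j\<in>S - {i}. T j / T i) = - 1"
      by (metis add_eq_0_iff)
    moreover have "(\<Sum>j\<in>S - {i}. T j / T i) \<in> A - units"
      using none i(2) by (intro nonunits_sum) auto
    ultimately show False
      using ring_minus[OF ring_1] by (auto simp: units_def)
  qed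
  then obtain j where j: "j \<in> S" "j \<noteq> i" "T j / T i \<in> units"
    by blast
  have c: "coeff P i \<in> F" "coeff P j \<in> F" "coeff P i \<noteq> 0" "coeff P j \<noteq> 0"
    using P(1) i j by (auto simp: polys_over_def S_def)
  show thesis
  proof (cases "i < j")
    case True
    then have "z ^ j = z ^ (j - i) * z ^ i"
      by (simp flip: power_add)
    then have "T j / T i = z ^ (j - i) * inverse (coeff P i / coeff P j)"
      using c assms(2) by (simp add: T_def field_simps)
    then show ?thesis
      using that[of "j - i" "coeff P i / coeff P j"] True c j(3) subfield_closed(8)[OF F] by simp
  next
    case False
    then have "z ^ i = z ^ (i - j) * z ^ j"
      by (simp flip: power_add)
    then have "inverse (T j / T i) = z ^ (i - j) * inverse (coeff P j / coeff P i)"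
      using c assms(2) by (simp add: T_def field_simps)
    then show ?thesis
      using that[of "i - j" "coeff P j / coeff P i"] False j c units_inverse[OF j(3)] subfield_closed(8)[OF F] by simp
  qed
qed

text \<open>The value of \<open>z\<close> is w(c) / n, where \<open>z ^ n\<close> equals
  \<open>c\<close> up to a unit. Stating it with multiples postpones both the division in \<Lambda>
  and the independence of the choice of \<open>n\<close> and \<open>c\<close>.\<close>

definition has_value :: "'b \<Rightarrow> 'l \<Rightarrow> bool" where
  "has_value z a \<longleftrightarrow> (\<exists>n>0. \<exists>c\<in>F. c \<noteq> 0 \<and> z ^ n * inverse c \<in> units \<and> w c = Fin (nsmul n a))"

lemma has_value_mult:
  assumes "has_value z a" "has_value z' a'"
  shows "has_value (z * z') (a + a')"
proof -
  obtain n c where n: "n > 0" "c \<in> F" "c \<noteq> 0" "z ^ n * inverse c \<in> units" "w c = Fin (nsmul n a)"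
    using assms(1) unfolding has_value_def by blast
  obtain m d where m: "m > 0" "d \<in> F" "d \<noteq> 0" "z' ^ m * inverse d \<in> units" "w d = Fin (nsmul m a')"
    using assms(2) unfolding has_value_def by blast
  have "(z * z') ^ (n * m) * inverse (c ^ m * d ^ n) = (z ^ n * inverse c) ^ m * (z' ^ m * inverse d) ^ n"
  proof -
    have "(z ^ n) ^ m = z ^ (n * m)" "(z' ^ m) ^ n = z' ^ (n * m)"
      by (simp_all add: mult.commute flip: power_mult)
    then show ?thesis
      by (simp only: power_mult_distrib power_inverse inverse_mult_distrib mult_ac)
  qed
  moreover have "\<dots> \<in> units"
    by (rule units_mult[OF units_power[OF n(4)] units_power[OF m(4)]])
  moreover have "c ^ m * d ^ n \<in> F" "c ^ m * d ^ n \<noteq> 0"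
    using n m by (auto intro: subfield_closed[OF F] subfield_power[OF F])
  moreover have "w (c ^ m * d ^ n) = Fin (nsmul (n * m) (a + a'))"
    using n m by (simp add: F_mult F_power subfield_power[OF F] nsmul_nsmul nsmul_distrib mult.commute)
  ultimately show ?thesis
    unfolding has_value_def using n(1) m(1) by (intro exI[of _ "n * m"] conjI bexI[of _ "c ^ m * d ^ n"]) auto
qed

lemma has_value_inverse:
  assumes "has_value z a"
  shows "has_value (inverse z) (- a)"
proof -
  obtain n c where n: "n > 0" "c \<in> F" "c \<noteq> 0" "z ^ n * inverse c \<in> units" "w c = Fin (nsmul n a)"
    using assms unfolding has_value_def by blast
  have "inverse z ^ n * inverse (inverse c) \<in> units"
    using units_inverse[OF n(4)] by (simp add: power_inverse mult.commute)
  moreover have "w (inverse c) = Fin (nsmul n (- a))"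
    using F_inverse[OF n(2,3)] n(5) by (metis nsmul_uminus with_infinity.inject)
  ultimately show ?thesis
    unfolding has_value_def using n subfield_closed(6)[OF F]
    by (intro exI[of _ n] conjI bexI[of _ "inverse c"]) auto
qed

text \<open>Membership of \<open>z\<close> and of \<open>z ^ n\<close> are equivalent, because a
  valuation ring is integrally closed: \<open>z\<close> is \<open>z ^ n\<close> times a power of its
  inverse. Uniqueness of values follows by applying this to 1.\<close>

lemma has_value_nonneg_iff:
  assumes "has_value z a"
  shows "z \<in> A \<longleftrightarrow> 0 \<le> a"
proof -
  obtain n c where n: "n > 0" "c \<in> F" "c \<noteq> 0" "z ^ n * inverse c \<in> units" "w c = Fin (nsmul n a)"
    using assms unfolding has_value_def by blast
  define e where "e = z ^ n * inverse c"
  have e: "e \<in> A" "inverse e \<in> A" "e \<noteq> 0"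
    using n(4) by (auto simp: e_def units_def)
  have zn: "z ^ n = c * e"
    using n(3) by (simp add: e_def)
  have "z \<noteq> 0"
    using e(3) n(1) by (auto simp: e_def)
  have cA: "c \<in> A \<longleftrightarrow> 0 \<le> a"
  proof -
    have "c \<in> A \<longleftrightarrow> 0 \<le> nsmul n a"
      using A_F_iff[OF n(2)] n(5) by (simp add: zero_with_infinity_Fin)
    then show ?thesis
      using nsmul_le_cancel[OF n(1), of 0 a] by simp
  qed
  show ?thesis
  proof
    assume "z \<in> A"
    then have "z ^ n * inverse e \<in> A"
      using e by (intro ring_mult ring_power)
    moreover have "z ^ n * inverse e = c"
      unfolding zn using e(3) by simp
    ultimately show "0 \<le> a"
      using cA by simp
  next
    assume "0 \<le> a"
    then have "c * e \<in> A"
      using cA e by (intro ring_mult) auto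
    then have znA: "z ^ n \<in> A"
      using zn by simp
    show "z \<in> A"
    proof (rule ccontr)
      assume "z \<notin> A"
      then have "inverse z \<in> A"
        using valuation_ring[of z] by blast
      then have "z ^ n * inverse z ^ (n - 1) \<in> A"
        by (intro ring_mult[OF znA] ring_power)
      moreover have eq: "z ^ n * inverse z ^ (n - 1) = z"
        using \<open>z \<noteq> 0\<close> n(1) by (cases n) (auto simp: power_inverse)
      ultimately have "z \<in> A"
        unfolding eq by blast
      with \<open>z \<notin> A\<close> show False ..
    qed
  qed
qed

lemma has_value_unique:
  assumes "has_value z a" "has_value z b" "z \<noteq> 0"
  shows "a = b"
proof -
  have "has_value 1 (a - b)" "has_value 1 (b - a)"
    using has_value_mult[OF assms(1) has_value_inverse[OF assms(2)]]
      has_value_mult[OF assms(2) has_value_inverse[OF assms(1)]] assms(3) by simp_all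
  from this[THEN has_value_nonneg_iff] ring_1 show ?thesis
    by simp
qed

lemma has_value_F:
  assumes "x \<in> F" "x \<noteq> 0" "w x = Fin a"
  shows "has_value x a"
  unfolding has_value_def using assms units_1 by (intro exI[of _ 1] conjI bexI[of _ x]) auto

lemma extension:
  assumes div: "divisible_group TYPE('l)" and alg: "\<And>z. algebraic_over F z"
  obtains w' where "valuation w'" "\<And>x. x \<in> F \<Longrightarrow> w' x = w x"
proof -
  have ex: "\<exists>a. has_value z a" if z: "z \<noteq> 0" for z
  proof -
    obtain n c where n: "0 < n" "c \<in> F" "c \<noteq> 0" "z ^ n * inverse c \<in> units"
      using algebraic_power_unit[OF alg z] .
    obtain b where b: "w c = Fin b"
      using F_inverse[OF n(2,3)] by blast
    obtain a where "nsmul n a = b"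
      using divisible_nsmul[OF div n(1)] .
    with n b show ?thesis
      unfolding has_value_def by blast
  qed
  define w' where "w' z = (if z = 0 then Infty else Fin (SOME a. has_value z a))" for z
  have w'_value: "has_value z a" if "w' z = Fin a" for z a
    using that someI_ex[OF ex, of z] by (auto simp: w'_def split: if_splits)
  have w'_eq: "w' z = Fin a" if "z \<noteq> 0" "has_value z a" for z a
    using has_value_unique[OF _ that(2,1)] someI[of "has_value z", OF that(2)] that(1) by (simp add: w'_def)
  have w'_0: "w' 0 = Infty"
    by (simp add: w'_def)
  have w'_fin: "\<exists>a. w' z = Fin a \<and> has_value z a" if "z \<noteq> 0" for z
    using ex[OF that] w'_eq[OF that] by blast
  have w'_F: "w' x = w x" if x: "x \<in> F" for x
  proof (cases "x = 0")
    case False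
    obtain a where "w x = Fin a"
      using F_inverse[OF x False] by blast
    with w'_eq[OF False has_value_F[OF x False]] show ?thesis
      by simp
  qed (simp add: w'_0)
  have w'_mult: "w' (x * y) = w' x + w' y" for x y
  proof (cases "x = 0 \<or> y = 0")
    case False
    then obtain a b where "w' x = Fin a" "has_value x a" "w' y = Fin b" "has_value y b"
      using w'_fin by blast
    with w'_eq[OF _ has_value_mult[of x a y b]] False show ?thesis
      by simp
  qed (auto simp: w'_0)
  \<comment> \<open>If \<open>y / x\<close> lies in \<open>A\<close>, then so does
    \<open>(x + y) / x\<close>, which is 1 plus it.\<close>
  have le_aux: "w' x \<le> w' (x + y)" if le: "w' x \<le> w' y" for x y
  proof (cases "x = 0 \<or> x + y = 0 \<or> y = 0")
    case False
    then obtain a b d where v: "w' x = Fin a" "has_value x a" "w' y = Fin b" "has_value y b"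
      "w' (x + y) = Fin d" "has_value (x + y) d"
      using w'_fin by metis
    have "has_value (y * inverse x) (b - a)"
      using has_value_mult[OF v(4) has_value_inverse[OF v(2)]] by simp
    then have "y * inverse x \<in> A"
      using has_value_nonneg_iff le v by simp
    then have "1 + y * inverse x \<in> A"
      by (intro ring_add ring_1)
    moreover have "1 + y * inverse x = (x + y) * inverse x"
      using False by (simp add: algebra_simps)
    moreover have "has_value ((x + y) * inverse x) (d - a)"
      using has_value_mult[OF v(6) has_value_inverse[OF v(2)]] by simp
    ultimately show ?thesis
      using has_value_nonneg_iff v by simp
  next
    case True
    then show ?thesis
      using le by (auto simp: w'_0)
  qed
  have w'_add: "min (w' x) (w' y) \<le> w' (x + y)" for x y
    using le_aux[of x y] le_aux[of y x] by (cases "w' x \<le> w' y") (auto simp: add.commute min_def)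
  have "w' 1 = 0"
    using w'_F[OF subfield_closed(2)[OF F]] by simp
  then have "valuation w'"
    by unfold_locales (auto simp: valuation_on_def w'_0 w'_mult w'_add)
  with w'_F show thesis
    using that by blast
qed

end

theorem valuation_extension:
  fixes F :: "'b::field set" and w :: "'b \<Rightarrow> 'l::linordered_ab_group_add with_infinity"
  assumes "divisible_group TYPE('l)" "is_subfield F" "valuation_on F w" "\<And>z. algebraic_over F z"
  obtains w' where "valuation w'" "\<And>x. x \<in> F \<Longrightarrow> w' x = w x"
proof -
  interpret subfield_valuation F w
    by unfold_locales fact+
  obtain A where A: "A \<in> extension_rings" "\<And>B. B \<in> extension_rings \<Longrightarrow> A \<subseteq> B \<Longrightarrow> B = A"
    using maximal_extension_ring by blast
  interpret maximal_ring F w A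
    by unfold_locales (use A in auto)
  show thesis
    using extension[OF assms(1,4)] that .
qed

section \<open>Algebraic elements\<close>

text \<open>Gaussian elimination, with \<open>I\<close> indexing vectors and \<open>J\<close>
  coordinates. The pivot vector \<open>k\<close> clears coordinate \<open>j\<close>, and its own
  coefficient \<open>- s\<close> is then dictated by that coordinate.\<close>

lemma linear_dependence:
  fixes K :: "'b::field set"
  assumes K: "is_subfield K" and "finite J" "finite I" "card J < card I"
    "\<And>i j. i \<in> I \<Longrightarrow> j \<in> J \<Longrightarrow> v i j \<in> K"
  shows "\<exists>c. (\<forall>i\<in>I. c i \<in> K) \<and> (\<exists>i\<in>I. c i \<noteq> 0) \<and> (\<forall>j\<in>J. (\<Sum>i\<in>I. c i * v i j) = 0)"
  using assms(2-)
proof (induction J arbitrary: I v)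
  case empty
  then have "I \<noteq> {}" by auto
  then show ?case
    using subfield_closed(2)[OF K] by (intro exI[of _ "\<lambda>_. 1"]) auto
next
  case (insert j J)
  show ?case
  proof (cases "\<forall>i\<in>I. v i j = 0")
    case True
    have "card J < card I"
      using insert by simp
    then obtain c where "\<forall>i\<in>I. c i \<in> K" "\<exists>i\<in>I. c i \<noteq> 0" "\<forall>j\<in>J. (\<Sum>i\<in>I. c i * v i j) = 0"
      using insert.IH[of I v] insert.prems by blast
    with True show ?thesis by auto
  next
    case False
    then obtain k where k: "k \<in> I" "v k j \<noteq> 0" by blast
    define v' where "v' i l = v i l - v i j / v k j * v k l" for i l
    have "card J < card (I - {k})"
      using insert k by simp
    moreover have "v' i l \<in> K" if "i \<in> I - {k}" "l \<in> J" for i l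
      unfolding v'_def using that k insert.prems(3) by (intro subfield_closed K) auto
    ultimately obtain c where c: "\<forall>i\<in>I - {k}. c i \<in> K" "\<exists>i\<in>I - {k}. c i \<noteq> 0"
      "\<forall>l\<in>J. (\<Sum>i\<in>I - {k}. c i * v' i l) = 0"
      using insert.IH[of "I - {k}" v'] insert.prems(1) by blast
    define s where "s = (\<Sum>i\<in>I - {k}. c i * (v i j / v k j))"
    define c' where "c' = c(k := - s)"
    have sK: "s \<in> K"
      unfolding s_def using c(1) k insert.prems(3)
      by (intro subfield_sum[OF K] subfield_closed(4)[OF K] subfield_closed(8)[OF K]) auto
    have sum: "(\<Sum>i\<in>I. c' i * v i l) = (\<Sum>i\<in>I - {k}. c i * v i l) - s * v k l" for l
    proof -
      have "(\<Sum>i\<in>I. c' i * v i l) = c' k * v k l + (\<Sum>i\<in>I - {k}. c' i * v i l)"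
        using insert.prems(1) k(1) by (rule sum.remove)
      also have "(\<Sum>i\<in>I - {k}. c' i * v i l) = (\<Sum>i\<in>I - {k}. c i * v i l)"
        by (intro sum.cong) (auto simp: c'_def)
      finally show ?thesis
        by (simp add: c'_def)
    qed
    have "(\<Sum>i\<in>I. c' i * v i j) = 0"
      unfolding sum s_def sum_distrib_right using k(2) by simp
    moreover have "(\<Sum>i\<in>I. c' i * v i l) = 0" if "l \<in> J" for l
    proof -
      have "(\<Sum>i\<in>I - {k}. c i * v i l) - s * v k l = (\<Sum>i\<in>I - {k}. c i * v' i l)"
        unfolding s_def v'_def sum_distrib_right sum_subtractf[symmetric]
        by (intro sum.cong) (simp_all add: algebra_simps)
      then show ?thesis
        unfolding sum using c(3) that by simp
    qed
    moreover have "\<forall>i\<in>I. c' i \<in> K" "\<exists>i\<in>I. c' i \<noteq> 0"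
      using c(1,2) sK subfield_closed(5)[OF K] by (auto simp: c'_def)
    ultimately show ?thesis by blast
  qed
qed

definition field_span :: "'b::field set \<Rightarrow> 'i set \<Rightarrow> ('i \<Rightarrow> 'b) \<Rightarrow> 'b set" where
  "field_span K J b = {\<Sum>j\<in>J. c j * b j |c. \<forall>j\<in>J. c j \<in> K}"

context
  fixes K :: "'b::field set"
  assumes K: "is_subfield K"
begin

lemma algebraic_over_mem: "a \<in> K \<Longrightarrow> algebraic_over K a"
  unfolding algebraic_over_def using subfield_closed[OF K]
  by (intro bexI[of _ "[:- a, 1:]"]) (auto simp: K)

lemma field_span_add: "x \<in> field_span K J b \<Longrightarrow> y \<in> field_span K J b \<Longrightarrow> x + y \<in> field_span K J b"
proof -
  assume "x \<in> field_span K J b" "y \<in> field_span K J b"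
  then obtain c d where *: "\<forall>j\<in>J. c j \<in> K" "x = (\<Sum>j\<in>J. c j * b j)" "\<forall>j\<in>J. d j \<in> K" "y = (\<Sum>j\<in>J. d j * b j)"
    unfolding field_span_def by blast
  have "x + y = (\<Sum>j\<in>J. (c j + d j) * b j)"
    unfolding * by (simp add: sum.distrib algebra_simps)
  moreover have "\<forall>j\<in>J. c j + d j \<in> K"
    using * subfield_closed(3)[OF K] by blast
  ultimately show ?thesis
    unfolding field_span_def by (intro CollectI exI[of _ "\<lambda>j. c j + d j"]) auto
qed

lemma field_span_scale: "x \<in> field_span K J b \<Longrightarrow> a \<in> K \<Longrightarrow> a * x \<in> field_span K J b"
proof -
  assume "x \<in> field_span K J b" "a \<in> K"
  then obtain c where *: "\<forall>j\<in>J. c j \<in> K" "x = (\<Sum>j\<in>J. c j * b j)"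
    unfolding field_span_def by blast
  have "a * x = (\<Sum>j\<in>J. (a * c j) * b j)"
    unfolding * by (simp add: sum_distrib_left mult.assoc)
  moreover have "\<forall>j\<in>J. a * c j \<in> K"
    using * \<open>a \<in> K\<close> subfield_closed(4)[OF K] by blast
  ultimately show ?thesis
    unfolding field_span_def by (intro CollectI exI[of _ "\<lambda>j. a * c j"]) auto
qed

lemma field_span_0: "0 \<in> field_span K J b"
  unfolding field_span_def using subfield_closed(1)[OF K] by (intro CollectI exI[of _ "\<lambda>_. 0"]) auto

lemma field_span_sum:
  "(\<And>i. i \<in> I \<Longrightarrow> f i \<in> field_span K J b) \<Longrightarrow> sum f I \<in> field_span K J b"
  by (induction I rule: infinite_finite_induct) (auto intro: field_span_0 field_span_add)

lemma field_span_lincomb: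
  assumes "\<And>i. i \<in> I \<Longrightarrow> c i \<in> K" "\<And>i. i \<in> I \<Longrightarrow> f i \<in> field_span K J b"
  shows "(\<Sum>i\<in>I. c i * f i) \<in> field_span K J b"
  using assms by (intro field_span_sum) (rule field_span_scale)

lemma field_span_base:
  assumes "finite J" "j \<in> J"
  shows "b j \<in> field_span K J b"
proof -
  have "b j = (\<Sum>i\<in>J. (if i = j then 1 else 0) * b i)"
    using assms by (simp add: if_distrib[of "\<lambda>x. x * _"] cong: if_cong)
  then show ?thesis
    unfolding field_span_def using subfield_closed(1,2)[OF K]
    by (intro CollectI exI[of _ "\<lambda>i. if i = j then 1 else 0"]) auto
qed

lemma field_span_stable:
  assumes "\<And>j. j \<in> J \<Longrightarrow> z * b j \<in> field_span K J b" "x \<in> field_span K J b"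
  shows "z * x \<in> field_span K J b"
proof -
  obtain c where *: "\<forall>j\<in>J. c j \<in> K" "x = (\<Sum>j\<in>J. c j * b j)"
    using assms(2) unfolding field_span_def by blast
  have eq: "z * x = (\<Sum>j\<in>J. c j * (z * b j))"
    unfolding * by (simp add: sum_distrib_left mult.left_commute)
  show ?thesis
    unfolding eq using * assms(1) by (intro field_span_lincomb) auto
qed

text \<open>The \<open>card J + 1\<close> elements \<open>z ^ k * b0\<close> with
  \<open>k \<le> card J\<close> lie in the span of \<open>card J\<close> elements. A dependence
  between them is a polynomial relation for \<open>z\<close> once \<open>b0\<close> is
  cancelled.\<close>

lemma stable_imp_algebraic:
  assumes "finite J" "b0 \<in> field_span K J b" "b0 \<noteq> 0"
    and stable: "\<And>x. x \<in> field_span K J b \<Longrightarrow> z * x \<in> field_span K J b"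
  shows "algebraic_over K z"
proof -
  have pow: "z ^ k * b0 \<in> field_span K J b" for k
    by (induction k) (auto simp: assms(2) mult.assoc intro: stable)
  have "\<exists>c. (\<forall>j\<in>J. c j \<in> K) \<and> z ^ k * b0 = (\<Sum>j\<in>J. c j * b j)" for k
    using pow[of k] unfolding field_span_def by blast
  then obtain v where v: "\<And>k j. j \<in> J \<Longrightarrow> v k j \<in> K" "\<And>k. z ^ k * b0 = (\<Sum>j\<in>J. v k j * b j)"
    by metis
  let ?I = "{..card J}"
  obtain c where c: "\<forall>k\<in>?I. c k \<in> K" "\<exists>k\<in>?I. c k \<noteq> 0" "\<forall>j\<in>J. (\<Sum>k\<in>?I. c k * v k j) = 0"
    using linear_dependence[OF K assms(1), of ?I v] v(1) by auto
  define P where "P = (\<Sum>k\<in>?I. monom (c k) k)"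
  have coeffP: "coeff P k = (if k \<in> ?I then c k else 0)" for k
    by (simp add: P_def coeff_sum)
  have "P \<in> polys_over K"
    using c(1) subfield_closed(1)[OF K] by (simp add: polys_over_def coeffP)
  moreover have "P \<noteq> 0"
    using c(2) coeffP by (metis coeff_0)
  moreover have "poly P z * b0 = 0"
  proof -
    have "poly P z * b0 = (\<Sum>k\<in>?I. c k * (z ^ k * b0))"
      by (simp add: P_def poly_sum poly_monom sum_distrib_right mult.assoc)
    also have "\<dots> = (\<Sum>k\<in>?I. \<Sum>j\<in>J. c k * v k j * b j)"
      by (simp add: v(2) sum_distrib_left mult.assoc)
    also have "\<dots> = (\<Sum>j\<in>J. (\<Sum>k\<in>?I. c k * v k j) * b j)"
      by (subst sum.swap) (simp add: sum_distrib_right)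
    also have "\<dots> = 0"
      using c(3) by simp
    finally show ?thesis .
  qed
  ultimately show ?thesis
    using assms(3) unfolding algebraic_over_def by auto
qed

lemma algebraic_power_relation:
  assumes "algebraic_over K a"
  obtains n c where "0 < n" "\<And>i. c i \<in> K" "a ^ n = (\<Sum>i<n. c i * a ^ i)"
proof -
  obtain P where P: "P \<in> polys_over K" "P \<noteq> 0" "poly P a = 0"
    using assms unfolding algebraic_over_def by blast
  define n where "n = degree P"
  define l where "l = coeff P n"
  have "l \<noteq> 0"
    using P(2) by (simp add: l_def n_def)
  have "(\<Sum>i<n. coeff P i * a ^ i) + l * a ^ n = 0"
    using P(3) by (simp add: poly_altdef n_def l_def flip: lessThan_Suc_atMost)
  then have "l * a ^ n = - (\<Sum>i<n. coeff P i * a ^ i)"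
    by (simp add: add_eq_0_iff)
  then have "inverse l * (l * a ^ n) = (\<Sum>i<n. - (inverse l * coeff P i) * a ^ i)"
    by (simp add: sum_distrib_left sum_negf mult.assoc)
  moreover have "inverse l * (l * a ^ n) = a ^ n"
    using \<open>l \<noteq> 0\<close> by simp
  moreover have "- (inverse l * coeff P i) \<in> K" for i
    using P(1) by (intro subfield_closed K) (auto simp: l_def polys_over_def)
  moreover have "0 < n"
    unfolding n_def by (rule degree_pos_of_root[OF P(2,3)])
  ultimately show thesis
    using that[of n "\<lambda>i. - (inverse l * coeff P i)"] by simp
qed

text \<open>The products \<open>a ^ i * b ^ j\<close> with bounded exponents span a space stable
  under \<open>a\<close> and \<open>b\<close>, hence under their sum and product; overflowing
  exponents are reduced by the relations for \<open>a ^ n\<close> and \<open>b ^ m\<close>.\<close>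

lemma algebraic_add_mult:
  assumes "algebraic_over K a" "algebraic_over K b"
  shows "algebraic_over K (a + b)" "algebraic_over K (a * b)"
proof -
  obtain n c where n: "0 < n" "\<And>i. c i \<in> K" "a ^ n = (\<Sum>i<n. c i * a ^ i)"
    using algebraic_power_relation[OF assms(1)] by blast
  obtain m d where m: "0 < m" "\<And>i. d i \<in> K" "b ^ m = (\<Sum>i<m. d i * b ^ i)"
    using algebraic_power_relation[OF assms(2)] by blast
  define J where "J = {..<n} \<times> {..<m}"
  define e where "e = (\<lambda>(i, j). a ^ i * b ^ j)"
  have "finite J"
    by (simp add: J_def)
  let ?S = "field_span K J e"
  have base: "a ^ i * b ^ j \<in> ?S" if "i < n" "j < m" for i j
    using field_span_base[OF \<open>finite J\<close>, of "(i, j)" e] that by (simp add: J_def e_def)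
  have a_base: "a * e ij \<in> ?S" if ij: "ij \<in> J" for ij
  proof -
    obtain i j where ij': "ij = (i, j)" "i < n" "j < m"
      using ij by (auto simp: J_def)
    show ?thesis
    proof (cases "Suc i < n")
      case True
      then show ?thesis
        using base[of "Suc i" j] ij' by (simp add: e_def mult.assoc)
    next
      case False
      then have "n = Suc i" using ij' by simp
      then have "a * e ij = (\<Sum>i<n. c i * a ^ i) * b ^ j"
        unfolding n(3)[symmetric] by (simp add: ij' e_def mult.assoc)
      also have "\<dots> = (\<Sum>i<n. c i * (a ^ i * b ^ j))"
        by (simp add: sum_distrib_right mult.assoc)
      also have "\<dots> \<in> ?S"
        using base ij' n(2) by (intro field_span_lincomb) auto
      finally show ?thesis .
    qed
  qed
  have b_base: "b * e ij \<in> ?S" if ij: "ij \<in> J" for ij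
  proof -
    obtain i j where ij': "ij = (i, j)" "i < n" "j < m"
      using ij by (auto simp: J_def)
    show ?thesis
    proof (cases "Suc j < m")
      case True
      then show ?thesis
        using base[of i "Suc j"] ij' by (simp add: e_def mult.left_commute)
    next
      case False
      then have "m = Suc j" using ij' by simp
      then have "b * e ij = a ^ i * (\<Sum>j<m. d j * b ^ j)"
        unfolding m(3)[symmetric] by (simp add: ij' e_def mult.left_commute)
      also have "\<dots> = (\<Sum>j<m. d j * (a ^ i * b ^ j))"
        by (simp add: sum_distrib_left mult.left_commute)
      also have "\<dots> \<in> ?S"
        using base ij' m(2) by (intro field_span_lincomb) auto
      finally show ?thesis .
    qed
  qed
  note a_stable = field_span_stable[of J a e, OF a_base]
  note b_stable = field_span_stable[of J b e, OF b_base]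
  have one: "1 \<in> ?S"
    using base[of 0 0] n(1) m(1) by simp
  show "algebraic_over K (a + b)"
    by (rule stable_imp_algebraic[OF \<open>finite J\<close> one])
      (auto simp: distrib_right intro!: field_span_add a_stable b_stable)
  show "algebraic_over K (a * b)"
    by (rule stable_imp_algebraic[OF \<open>finite J\<close> one])
      (auto simp: mult.assoc intro!: a_stable b_stable)
qed

lemma algebraic_inverse:
  assumes "algebraic_over K a"
  shows "algebraic_over K (inverse a)"
proof (cases "a = 0")
  case False
  obtain P where P: "P \<in> polys_over K" "P \<noteq> 0" "poly P a = 0"
    using assms unfolding algebraic_over_def by blast
  have "reflect_poly P \<in> polys_over K"
    using P(1) subfield_closed(1)[OF K] by (simp add: polys_over_def coeff_reflect_poly)
  moreover have "poly (reflect_poly P) (inverse a) = 0"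
    using poly_reflect_poly_nz[of "inverse a" P] False P(3) by simp
  ultimately show ?thesis
    unfolding algebraic_over_def using P(2) by (intro bexI[of _ "reflect_poly P"]) auto
qed (use assms in simp)

end

text \<open>K(X) inside the fraction field of polynomials over the ambient field. Denominators 0
  contribute only the element 0.\<close>

definition rational_functions :: "'a::field set \<Rightarrow> 'a poly fract set" where
  "rational_functions K = {to_fract p / to_fract q |p q. p \<in> polys_over K \<and> q \<in> polys_over K}"

context
  fixes K :: "'a::field set"
  assumes K: "is_subfield K"
begin

lemma rational_functions_to_fract: "p \<in> polys_over K \<Longrightarrow> to_fract p \<in> rational_functions K"
  unfolding rational_functions_def using polys_over_1[OF K] by (intro CollectI exI[of _ p] exI[of _ 1]) auto

lemma subfield_rational_functions: "is_subfield (rational_functions K)"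
proof -
  let ?F = "rational_functions K"
  have eq: "x + y \<in> ?F \<and> x * y \<in> ?F" if xy: "x \<in> ?F" "y \<in> ?F" for x y
  proof -
    obtain p q p' q' where *: "p \<in> polys_over K" "q \<in> polys_over K" "x = to_fract p / to_fract q"
      "p' \<in> polys_over K" "q' \<in> polys_over K" "y = to_fract p' / to_fract q'"
      using xy unfolding rational_functions_def by blast
    have "x * y = to_fract (p * p') / to_fract (q * q')"
      by (simp add: *)
    then have "x * y \<in> ?F"
      unfolding rational_functions_def using * polys_over_closed(4)[OF K] by blast
    moreover have "x + y \<in> ?F"
    proof (cases "q = 0 \<or> q' = 0")
      case True
      then show ?thesis
        using xy * by auto
    next
      case False
      then have "x + y = to_fract (p * q' + p' * q) / to_fract (q * q')"
        by (simp add: * field_simps)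
      moreover have "p * q' + p' * q \<in> polys_over K" "q * q' \<in> polys_over K"
        using * by (auto intro!: polys_over_closed[OF K])
      ultimately show ?thesis
        unfolding rational_functions_def by blast
    qed
    ultimately show ?thesis by blast
  qed
  have eq': "- x \<in> ?F \<and> inverse x \<in> ?F" if x: "x \<in> ?F" for x
  proof -
    obtain p q where *: "p \<in> polys_over K" "q \<in> polys_over K" "x = to_fract p / to_fract q"
      using x unfolding rational_functions_def by blast
    have "- x = to_fract (- p) / to_fract q" "inverse x = to_fract q / to_fract p"
      by (simp_all add: *)
    then show ?thesis
      unfolding rational_functions_def using * polys_over_closed(3)[OF K] by blast
  qed
  have "0 \<in> ?F" "1 \<in> ?F"
    using rational_functions_to_fract[of 0] rational_functions_to_fract[of 1] by (simp_all add: K)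
  with eq eq' show ?thesis
    unfolding is_subfield_def by blast
qed

text \<open>The big field is generated by constants, algebraic over \<open>K\<close>, and by the
  variable, which lies in the small field.\<close>

lemma algebraic_rational_functions:
  assumes alg: "\<And>a. algebraic_over K a"
  shows "algebraic_over (rational_functions K) z"
proof -
  let ?F = "rational_functions K"
  note F = subfield_rational_functions
  have const: "algebraic_over ?F (to_fract [:c:])" for c
  proof -
    obtain P where P: "P \<in> polys_over K" "P \<noteq> 0" "poly P c = 0"
      using alg unfolding algebraic_over_def by blast
    define h where "h a = to_fract [:a:]" for a :: 'a
    have h: "h 0 = 0" "h (a + b) = h a + h b" "h (a * b) = h a * h b" "h a = 0 \<longleftrightarrow> a = 0" for a b
      by (simp_all add: h_def flip: to_fract_add to_fract_mult)
    have "map_poly h P \<in> polys_over ?F"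
    proof -
      have "h a \<in> ?F" if "a \<in> K" for a
        unfolding h_def using that K by (intro rational_functions_to_fract) simp
      then show ?thesis
        using P(1) h(1) by (simp add: polys_over_def coeff_map_poly)
    qed
    moreover have "map_poly h P \<noteq> 0"
      using P(2) h by (auto simp: poly_eq_iff coeff_map_poly)
    moreover have "poly (map_poly h Q) (h c) = h (poly Q c)" for Q
      by (induction Q) (auto simp: h map_poly_pCons)
    ultimately show ?thesis
      using P(3) h(1) unfolding algebraic_over_def h_def[symmetric] by metis
  qed
  have X: "algebraic_over ?F (to_fract [:0, 1:])"
    using rational_functions_to_fract[of "[:0, 1:]"] subfield_closed[OF K]
    by (intro algebraic_over_mem[OF F]) (auto simp: K)
  have poly: "algebraic_over ?F (to_fract p)" for p
  proof (induction p)
    case 0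
    show ?case
      using algebraic_over_mem[OF F subfield_closed(1)[OF F]] by simp
  next
    case (pCons c p)
    have "to_fract (pCons c p) = to_fract [:c:] + to_fract [:0, 1:] * to_fract p"
      by (simp flip: to_fract_mult to_fract_add)
    then show ?case
      using pCons.IH const X by (simp only: algebraic_add_mult[OF F])
  qed
  obtain p q where "z = Fract p q"
    by (cases z)
  then have "z = to_fract p * inverse (to_fract q)"
    by (simp add: Fract_conv_to_fract divide_inverse)
  then show ?thesis
    using poly by (simp only: algebraic_add_mult[OF F] algebraic_inverse[OF F])
qed

end

section \<open>Separability through derivations\<close>

section \<open>The separable closure\<close>

text \<open>Dual numbers serve to prove that separable elements form a field. Derivations that
  vanish on \<open>K\<close> kill separable elements, while every inseparable element has derivative
  1 under some such derivation.\<close>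

datatype 'a dual = Dual (dual_std: 'a) (dual_eps: 'a)

instantiation dual :: (comm_ring_1) comm_ring_1
begin

definition "0 = Dual 0 0"
definition "1 = Dual 1 0"
definition "x + y = Dual (dual_std x + dual_std y) (dual_eps x + dual_eps y)"
definition "x - y = Dual (dual_std x - dual_std y) (dual_eps x - dual_eps y)"
definition "- x = Dual (- dual_std x) (- dual_eps x)"
definition "x * y = Dual (dual_std x * dual_std y) (dual_std x * dual_eps y + dual_std y * dual_eps x)"

instance
  by standard
    (auto simp: zero_dual_def one_dual_def plus_dual_def minus_dual_def uminus_dual_def
      times_dual_def algebra_simps)

end

lemma dual_simps [simp]:
  "Dual a b + Dual c d = Dual (a + c) (b + d)"
  "Dual a b * Dual c d = Dual (a * c) (a * d + c * b)"
  "Dual a b - Dual c d = Dual (a - c) (b - d)"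
  "- Dual a b = Dual (- a) (- b)"
  "Dual a b = 0 \<longleftrightarrow> a = 0 \<and> b = 0" "Dual a b = 1 \<longleftrightarrow> a = 1 \<and> b = 0"
  "0 = Dual a b \<longleftrightarrow> a = 0 \<and> b = 0" "1 = Dual a b \<longleftrightarrow> a = 1 \<and> b = 0"
  by (auto simp: zero_dual_def one_dual_def plus_dual_def minus_dual_def uminus_dual_def times_dual_def)

text \<open>Homomorphisms into the dual numbers that lift the identity are the same as derivations.\<close>

definition derivation_graph :: "'a::field set \<Rightarrow> ('a \<times> 'a dual) set \<Rightarrow> bool" where
  "derivation_graph K G \<longleftrightarrow> hom_graph G \<and> (\<forall>(x, y)\<in>G. dual_std y = x) \<and> (\<forall>k\<in>K. (k, Dual k 0) \<in> G)"

text \<open>\<open>c\<close> is obtained by applying the derivation to the coefficients of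
  \<open>f\<close> and evaluating at \<open>a\<close>. It is independent of \<open>e\<close>, so the
  infinitesimal part is affine in \<open>e\<close>.\<close>

lemma poly_dual:
  assumes "(f, f') \<in> poly_graph G" "\<forall>(x, y)\<in>G. dual_std y = x"
  shows "\<exists>c. \<forall>e. poly f' (Dual a e) = Dual (poly f a) (c + e * poly (pderiv f) a)"
  using assms(1)
proof (induction f' arbitrary: f)
  case 0
  then have "f = 0"
    using assms(2) by (force simp: poly_graph_def poly_eq_iff zero_dual_def)
  then show ?case by simp
next
  case (pCons y f')
  obtain x g where f: "f = pCons x g"
    by (rule pCons_cases)
  have g: "(g, f') \<in> poly_graph G" and xy: "(x, y) \<in> G"
    using pCons.prems unfolding f poly_graph_def by (force simp: coeff_pCons split: nat.splits)+
  obtain c where c: "\<And>e. poly f' (Dual a e) = Dual (poly g a) (c + e * poly (pderiv g) a)"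
    using pCons.IH[OF g] by blast
  have y: "y = Dual x (dual_eps y)"
    using xy assms(2) by (cases y) auto
  have "poly (pCons y f') (Dual a e) = Dual (poly f a) (dual_eps y + a * c + e * poly (pderiv f) a)" for e
    unfolding poly_pCons c f by (subst y) (simp add: pderiv_pCons algebra_simps)
  then show ?case by blast
qed

lemma poly_dual_const:
  "poly (map_poly (\<lambda>k. Dual k 0) f) (Dual a e) = Dual (poly f a) (e * poly (pderiv f) a)"
  by (induction f) (simp_all add: map_poly_pCons pderiv_pCons algebra_simps)

lemma separable_overE:
  assumes "separable_over K a"
  obtains p where "p \<in> polys_over K" "p \<noteq> 0" "poly p a = 0" "poly (pderiv p) a \<noteq> 0"
proof -
  obtain p where p: "is_min_poly K a p" "rsquarefree p"
    using assms unfolding separable_over_def by blast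
  then have "p \<in> polys_over K" "p \<noteq> 0" "poly p a = 0"
    by (auto simp: is_min_poly_def)
  moreover have "poly (pderiv p) a \<noteq> 0"
  proof -
    have "order a p = 1"
      using p(2) \<open>poly p a = 0\<close> \<open>p \<noteq> 0\<close> order_root[of p a] unfolding rsquarefree_def by metis
    then obtain q where "p = [:- a, 1:] * q" "\<not> [:- a, 1:] dvd q"
      using order_decomp[OF \<open>p \<noteq> 0\<close>, of a] by auto
    then show ?thesis
      by (simp add: pderiv_mult pderiv_pCons poly_eq_0_iff_dvd del: mult_pCons_left)
  qed
  ultimately show thesis
    using that by blast
qed

context
  fixes K :: "'a::alg_closed_field set"
  assumes K: "is_subfield K" and alg: "\<And>a. algebraic_over K a"
begin

lemma exists_min_poly: "\<exists>p. is_min_poly K a p"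
proof -
  let ?A = "\<lambda>p. p \<in> polys_over K \<and> p \<noteq> 0 \<and> poly p a = 0"
  obtain p0 where "?A p0"
    using alg unfolding algebraic_over_def by blast
  then obtain p where p: "?A p" "\<And>q. ?A q \<Longrightarrow> degree p \<le> degree q"
    using ex_has_least_nat[of ?A p0 degree] by blast
  define q where "q = smult (inverse (lead_coeff p)) p"
  have "q \<in> polys_over K"
    using p(1) subfield_closed(6)[OF K] by (auto simp: q_def polys_over_def intro!: subfield_closed(4)[OF K])
  moreover have "lead_coeff q = 1" "poly q a = 0" "degree q = degree p"
    using p(1) by (simp_all add: q_def)
  ultimately show ?thesis
    unfolding is_min_poly_def using p by metis
qed

lemma min_poly_division:
  assumes p: "is_min_poly K a p" and f: "f \<in> polys_over K" "poly f a = 0"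
  obtains g where "g \<in> polys_over K" "f = p * g"
proof -
  have "p \<noteq> 0"
    using p by (auto simp: is_min_poly_def)
  then have "0 < degree p"
    using p by (intro degree_pos_of_root[of p a]) (simp_all add: is_min_poly_def)
  have "p \<in> polys_over K"
    using p by (simp add: is_min_poly_def)
  then obtain g r where gr: "g \<in> polys_over K" "r \<in> polys_over K" "f = p * g + r" "degree r < degree p"
    using polys_over_division[OF K f(1) _ \<open>0 < degree p\<close>] by blast
  have "poly r a = 0"
    using f(2) gr(3) p by (simp add: is_min_poly_def)
  then have "r = 0"
    using gr(2,4) p unfolding is_min_poly_def by force
  with gr that show thesis by simp
qed

text \<open>If the derivative were nonzero, a multiple root \<open>b\<close> of \<open>p\<close>
  would be a root of it, so the minimal polynomial \<open>n\<close> of \<open>b\<close> would have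
  degree below that of \<open>p\<close>. Then \<open>p = n * g\<close> with both factors
  nonconstant, and \<open>a\<close> would be a root of one of them, against minimality.\<close>

lemma inseparable_pderiv:
  assumes p: "is_min_poly K a p" and "\<not> rsquarefree p"
  shows "pderiv p = 0"
proof (rule ccontr)
  assume nz: "pderiv p \<noteq> 0"
  have "p \<noteq> 0" and pK: "p \<in> polys_over K"
    using p by (auto simp: is_min_poly_def)
  obtain b where b: "order b p \<noteq> 0" "order b p \<noteq> 1"
    using assms(2) \<open>p \<noteq> 0\<close> by (auto simp: rsquarefree_def)
  then have "[:- b, 1:] ^ 2 dvd p"
    using order_divides[of b 2 p] by auto
  then obtain q where q: "p = [:- b, 1:] ^ 2 * q"
    by (rule dvdE)
  have root: "poly p b = 0" "poly (pderiv p) b = 0"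
    by (simp_all add: q power2_eq_square pderiv_mult pderiv_pCons del: mult_pCons_left)
  obtain n where n: "is_min_poly K b n"
    using exists_min_poly by blast
  obtain g where g: "g \<in> polys_over K" "p = n * g"
    using min_poly_division[OF n pK root(1)] .
  have "n \<noteq> 0" "g \<noteq> 0"
    using g \<open>p \<noteq> 0\<close> by auto
  then have deg: "degree p = degree n + degree g"
    unfolding g(2) by (rule degree_mult_eq)
  have "degree n \<noteq> 0"
    using n degree_pos_of_root[OF \<open>n \<noteq> 0\<close>, of b] by (simp add: is_min_poly_def)
  have "pderiv p \<in> polys_over K"
  proof -
    have "of_nat i \<in> K" for i
      by (induction i) (simp_all add: subfield_closed(1-3)[OF K])
    then have "coeff (pderiv p) i \<in> K" for i
      unfolding coeff_pderiv using pK by (intro subfield_closed(4)[OF K]) (auto simp: polys_over_def simp del: of_nat_Suc)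
    then show ?thesis
      by (simp add: polys_over_def)
  qed
  then have "degree n \<le> degree (pderiv p)"
    using n nz root(2) unfolding is_min_poly_def by blast
  moreover have "degree (pderiv p) \<le> degree p - 1"
    by (intro degree_le) (simp add: coeff_pderiv coeff_eq_0)
  ultimately have "degree g \<noteq> 0"
    using deg \<open>degree n \<noteq> 0\<close> by linarith
  have "poly n a = 0 \<or> poly g a = 0"
    using p g by (auto simp: is_min_poly_def)
  then have "degree p \<le> degree n \<or> degree p \<le> degree g"
    using p g(1) n \<open>n \<noteq> 0\<close> \<open>g \<noteq> 0\<close> unfolding is_min_poly_def by blast
  then show False
    using deg \<open>degree n \<noteq> 0\<close> \<open>degree g \<noteq> 0\<close> by linarith
qed

lemma derivation_graph_poly_const:
  assumes "derivation_graph K G" "P \<in> polys_over K"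
  shows "(P, map_poly (\<lambda>k. Dual k 0) P) \<in> poly_graph G"
  using assms by (auto simp: poly_graph_def polys_over_def derivation_graph_def coeff_map_poly zero_dual_def)

lemma derivation_graph_algebraic: "derivation_graph K G \<Longrightarrow> algebraic_graph G"
  unfolding algebraic_graph_def using alg derivation_graph_poly_const
  unfolding algebraic_over_def by blast

text \<open>Deriving \<open>poly p a = 0\<close> gives \<open>e * poly (pderiv p) a = 0\<close>, and
  a separable \<open>a\<close> is a simple root.\<close>

lemma derivation_separable_zero:
  assumes G: "derivation_graph K G" and "separable_over K a" "(a, Dual a e) \<in> G"
  shows "e = 0"
proof -
  interpret hom_graph G
    using G by (simp add: derivation_graph_def)
  obtain p where p: "p \<in> polys_over K" "poly p a = 0" "poly (pderiv p) a \<noteq> 0"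
    using separable_overE[OF assms(2)] by blast
  have "(poly p a, poly (map_poly (\<lambda>k. Dual k 0) p) (Dual a e)) \<in> G"
    by (rule graph_poly[OF derivation_graph_poly_const[OF G p(1)] assms(3)])
  then have "(0, Dual 0 (e * poly (pderiv p) a)) \<in> G"
    by (simp add: poly_dual_const p(2))
  from graph_0_unique[OF this] p(3) show ?thesis
    by simp
qed

lemma derivation_graph_adjoin:
  assumes G: "derivation_graph K G" "hom_graph (adjoin_graph G a (Dual a e))" "G \<subseteq> adjoin_graph G a (Dual a e)"
  shows "derivation_graph K (adjoin_graph G a (Dual a e))"
proof -
  have std: "\<forall>(x, y)\<in>G. dual_std y = x"
    using G by (simp add: derivation_graph_def)
  have "dual_std y = x" if "(x, y) \<in> adjoin_graph G a (Dual a e)" for x y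
  proof -
    obtain H H' where H: "(H, H') \<in> poly_graph G" "x = poly H a" "y = poly H' (Dual a e)"
      using \<open>(x, y) \<in> adjoin_graph G a (Dual a e)\<close> unfolding adjoin_graph_def by blast
    with poly_dual[OF H(1) std, of a] show ?thesis
      by (metis dual.sel(1))
  qed
  then show ?thesis
    using G unfolding derivation_graph_def by blast
qed

text \<open>Extending to \<open>a\<close> means solving \<open>c + e * poly (pderiv F) a = 0\<close>
  for \<open>e\<close>. The factor is nonzero because \<open>F\<close> divides, over the domain of
  \<open>G\<close>, a polynomial over \<open>K\<close> with simple root \<open>a\<close>. The
  solution is then 0 by \<open>derivation_separable_zero\<close>.\<close>

lemma derivation_extend_separable:
  assumes G: "derivation_graph K G" and a: "separable_over K a"
  obtains G' where "derivation_graph K G'" "G \<subseteq> G'" "(a, Dual a 0) \<in> G'"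
proof -
  have hom: "hom_graph G" and std: "\<forall>(x, y)\<in>G. dual_std y = x"
    using G by (auto simp: derivation_graph_def)
  interpret hom_graph G by fact
  obtain F F' where F: "(F, F') \<in> poly_graph G" "poly F a = 0" "0 < degree F"
    and Fmin: "\<And>Q Q'. (Q, Q') \<in> poly_graph G \<Longrightarrow> Q \<noteq> 0 \<Longrightarrow> poly Q a = 0 \<Longrightarrow> degree F \<le> degree Q"
    and F_adjoin: "\<And>r. poly F' r = 0 \<Longrightarrow> adjoinable G a r"
    using hom_graph_adjoin[OF hom derivation_graph_algebraic[OF G], of a] by blast
  obtain c where c: "\<And>e. poly F' (Dual a e) = Dual (poly F a) (c + e * poly (pderiv F) a)"
    using poly_dual[OF F(1) std] by blast
  obtain p where p: "p \<in> polys_over K" "poly p a = 0" "poly (pderiv p) a \<noteq> 0"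
    using separable_overE[OF a] by blast
  define M where "M = Domain G"
  have M_iff: "x \<in> M \<longleftrightarrow> (\<exists>y. (x, y) \<in> G)" for x
    by (simp add: M_def Domain_iff)
  have M: "is_subfield M"
    unfolding M_def by (rule subfield_Domain)
  have lift: "\<exists>f'. (f, f') \<in> poly_graph G" if "f \<in> polys_over M" for f
    using that
  proof (induction f)
    case 0
    show ?case using poly_graph_0 by blast
  next
    case (pCons b f)
    then have "b \<in> M" "f \<in> polys_over M"
      using polys_over_pCons_iff[OF M] by blast+
    then obtain f' b' where "(f, f') \<in> poly_graph G" "(b, b') \<in> G"
      using pCons.IH M_iff by blast
    then have "(pCons b f, pCons b' f') \<in> poly_graph G" by simp
    then show ?case by blast
  qed
  have "F \<in> polys_over M"
    using F(1) by (force simp: polys_over_def poly_graph_def M_def)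
  moreover have "K \<subseteq> M"
    using G by (force simp: derivation_graph_def M_def)
  then have "p \<in> polys_over M"
    using p(1) by (auto simp: polys_over_def)
  ultimately obtain g r where gr: "r \<in> polys_over M" "p = F * g + r" "degree r < degree F"
    using polys_over_division[OF M _ _ F(3)] by metis
  have "poly r a = 0"
    using p(2) gr(2) F(2) by simp
  moreover obtain r' where "(r, r') \<in> poly_graph G"
    using lift[OF gr(1)] by blast
  ultimately have "r = 0"
    using Fmin[of r r'] gr(3) by fastforce
  then have "p = F * g"
    using gr by simp
  then have "poly (pderiv F) a \<noteq> 0"
    using p(3) F(2) by (auto simp: pderiv_mult)
  then have root: "poly F' (Dual a (- c / poly (pderiv F) a)) = 0"
    unfolding c F(2) by simp
  let ?e = "- c / poly (pderiv F) a"
  have adj: "derivation_graph K (adjoin_graph G a (Dual a ?e))" "G \<subseteq> adjoin_graph G a (Dual a ?e)"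
    "(a, Dual a ?e) \<in> adjoin_graph G a (Dual a ?e)"
    using F_adjoin[OF root] derivation_graph_adjoin[OF G] by blast+
  then have "?e = 0"
    using derivation_separable_zero[OF _ a] by blast
  with adj show thesis
    using that by metis
qed

text \<open>The zero derivation on \<open>K\<close> extends to \<open>c\<close> with any prescribed
  value, since the minimal polynomial has zero derivative; the value 1 is chosen.\<close>

lemma derivation_inseparable:
  assumes "\<not> separable_over K c"
  obtains G where "derivation_graph K G" "(c, Dual c 1) \<in> G"
proof -
  define G where "G = (\<lambda>k. (k, Dual k 0)) ` K"
  have hom: "hom_graph G"
    by unfold_locales
      (auto simp: G_def one_dual_def intro!: image_eqI subfield_closed[OF K])
  then have G: "derivation_graph K G"
    by (auto simp: derivation_graph_def G_def)
  interpret hom_graph G by fact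
  obtain F F' where F: "(F, F') \<in> poly_graph G" "poly F c = 0" "0 < degree F"
    and Fmin: "\<And>Q Q'. (Q, Q') \<in> poly_graph G \<Longrightarrow> Q \<noteq> 0 \<Longrightarrow> poly Q c = 0 \<Longrightarrow> degree F \<le> degree Q"
    and F_adjoin: "\<And>r. poly F' r = 0 \<Longrightarrow> adjoinable G c r"
    using hom_graph_adjoin[OF hom derivation_graph_algebraic[OF G], of c] by blast
  have FK: "F \<in> polys_over K" and F': "F' = map_poly (\<lambda>k. Dual k 0) F"
    using F(1) by (auto simp: poly_graph_def polys_over_def G_def poly_eq_iff coeff_map_poly zero_dual_def)
  obtain p where p: "is_min_poly K c p"
    using exists_min_poly by blast
  then have "\<not> rsquarefree p"
    using assms by (auto simp: separable_over_def)
  then have dp: "pderiv p = 0"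
    by (rule inseparable_pderiv[OF p])
  obtain g where g: "F = p * g"
    using min_poly_division[OF p FK F(2)] by blast
  have "poly (pderiv F) c = 0"
    using dp p by (simp add: g pderiv_mult is_min_poly_def)
  then have "poly F' (Dual c 1) = 0"
    by (simp add: F' poly_dual_const F(2))
  from F_adjoin[OF this] derivation_graph_adjoin[OF G] that show thesis
    by blast
qed

lemma separable_over_mem:
  assumes "a \<in> K" shows "separable_over K a"
proof (rule ccontr)
  assume "\<not> separable_over K a"
  then obtain G where G: "derivation_graph K G" "(a, Dual a 1) \<in> G"
    by (rule derivation_inseparable)
  interpret hom_graph G
    using G by (simp add: derivation_graph_def)
  have "(a, Dual a 0) \<in> G"
    using G assms by (auto simp: derivation_graph_def)
  from graph_unique[OF G(2) this] show False by simp
qed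

text \<open>A derivation with value 1 at \<open>a + b\<close> extends to \<open>a\<close> with value
  0, so it has value 1 at the separable element \<open>b\<close>, which is impossible.\<close>

lemma separable_over_add:
  assumes "separable_over K a" "separable_over K b"
  shows "separable_over K (a + b)"
proof (rule ccontr)
  assume "\<not> separable_over K (a + b)"
  then obtain G where G: "derivation_graph K G" "(a + b, Dual (a + b) 1) \<in> G"
    by (rule derivation_inseparable)
  obtain G' where G': "derivation_graph K G'" "G \<subseteq> G'" "(a, Dual a 0) \<in> G'"
    using derivation_extend_separable[OF G(1) assms(1)] .
  interpret hom_graph G'
    using G' by (simp add: derivation_graph_def)
  have "(b, Dual b 1) \<in> G'"
    using graph_diff[OF subsetD[OF G'(2) G(2)] G'(3)] by simp
  from derivation_separable_zero[OF G'(1) assms(2) this] show False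
    by simp
qed

lemma separable_over_mult:
  assumes "separable_over K a" "separable_over K b"
  shows "separable_over K (a * b)"
proof (cases "a = 0")
  case True
  then show ?thesis
    using separable_over_mem[OF subfield_closed(1)[OF K]] by simp
next
  case False
  show ?thesis
  proof (rule ccontr)
    assume "\<not> separable_over K (a * b)"
    then obtain G where G: "derivation_graph K G" "(a * b, Dual (a * b) 1) \<in> G"
      by (rule derivation_inseparable)
    obtain G' where G': "derivation_graph K G'" "G \<subseteq> G'" "(a, Dual a 0) \<in> G'"
      using derivation_extend_separable[OF G(1) assms(1)] .
    interpret hom_graph G'
      using G' by (simp add: derivation_graph_def)
    obtain y where y: "(inverse a, y) \<in> G'"
      using graph_inverse[OF G'(3)] by blast
    then obtain d where d: "y = Dual (inverse a) d"
      using G'(1) by (cases y) (auto simp: derivation_graph_def)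
    have "(1, Dual 1 (a * d)) \<in> G'"
      using graph_mult[OF G'(3) y] False by (simp add: d)
    from graph_unique[OF graph_1 this] have "d = 0"
      using False by simp
    \<comment> \<open>With \<open>a\<close> and its inverse killed, the product rule leaves the
      nonzero derivative \<open>inverse a\<close> for \<open>b\<close>.\<close>
    have "(b, Dual b (inverse a)) \<in> G'"
      using graph_mult[OF subsetD[OF G'(2) G(2)] y] False by (simp add: d \<open>d = 0\<close> field_simps)
    from derivation_separable_zero[OF G'(1) assms(2) this] False show False
      by simp
  qed
qed

lemma separable_over_uminus:
  assumes "separable_over K a"
  shows "separable_over K (- a)"
  using separable_over_mult[OF separable_over_mem[of "- 1"] assms] subfield_closed[OF K] by simp

lemma separable_over_inverse:
  assumes "separable_over K a"
  shows "separable_over K (inverse a)"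
proof (cases "a = 0")
  case False
  show ?thesis
  proof (rule ccontr)
    assume "\<not> separable_over K (inverse a)"
    then obtain G where G: "derivation_graph K G" "(inverse a, Dual (inverse a) 1) \<in> G"
      by (rule derivation_inseparable)
    interpret hom_graph G
      using G by (simp add: derivation_graph_def)
    obtain y where y: "(a, y) \<in> G"
      using graph_inverse[OF G(2)] by auto
    then obtain d where d: "y = Dual a d"
      using G(1) by (cases y) (auto simp: derivation_graph_def)
    have "d = 0"
      using derivation_separable_zero[OF G(1) assms] y d by simp
    have "(1, Dual 1 a) \<in> G"
      using graph_mult[OF G(2) y] False by (simp add: d \<open>d = 0\<close>)
    from graph_unique[OF graph_1 this] False show False
      by simp
  qed
qed (use assms in simp)

lemma subfield_separable_closure: "is_subfield (separable_closure K)"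
  unfolding is_subfield_def separable_closure_def
  using subfield_closed[OF K] separable_over_mem separable_over_add separable_over_mult
    separable_over_uminus separable_over_inverse by simp

end

section \<open>Supports, extension and conjugacy on the polynomial ring\<close>

section \<open>Valuations on polynomial rings over an algebraic closure\<close>

locale field_hom =
  fixes s :: "'b::field \<Rightarrow> 'c::field"
  assumes hom_add: "s (x + y) = s x + s y" and hom_mult: "s (x * y) = s x * s y" and hom_1 [simp]: "s 1 = 1"
begin

lemma hom_0 [simp]: "s 0 = 0"
  using hom_add[of 0 0] by (metis add.right_neutral add_left_cancel)

lemma hom_minus: "s (- x) = - s x"
  using hom_add[of x "- x"] by (simp add: eq_neg_iff_add_eq_0 add.commute)

lemma hom_eq_0_iff [simp]: "s x = 0 \<longleftrightarrow> x = 0"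
proof
  show "s x = 0 \<Longrightarrow> x = 0"
    using hom_mult[of x "inverse x"] by (cases "x = 0") auto
qed simp

lemma hom_inj: "s x = s y \<longleftrightarrow> x = y"
  using hom_eq_0_iff[of "x - y"] hom_add[of x "- y"] by (auto simp: hom_minus)

lemma hom_sum: "s (sum f A) = (\<Sum>i\<in>A. s (f i))"
  by (induction A rule: infinite_finite_induct) (auto simp: hom_add)

lemma map_poly_add: "map_poly s (f + g) = map_poly s f + map_poly s g"
  by (simp add: poly_eq_iff coeff_map_poly hom_add)

lemma map_poly_mult: "map_poly s (f * g) = map_poly s f * map_poly s g"
  by (simp add: poly_eq_iff coeff_map_poly coeff_mult hom_sum hom_mult)

lemma map_poly_const: "map_poly s [:a:] = [:s a:]"
  by (cases "a = 0") (auto simp: map_poly_pCons)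

lemma poly_map_poly: "poly (map_poly s f) (s a) = s (poly f a)"
  by (induction f) (auto simp: map_poly_pCons hom_add hom_mult)

lemma map_poly_prod_mset: "map_poly s (\<Prod>a\<in>#A. f a) = (\<Prod>a\<in>#A. map_poly s (f a))"
  by (induction A) (auto simp: map_poly_mult map_poly_const one_pCons)

lemma map_poly_linear: "map_poly s [:- a, 1:] = [:- s a, 1:]"
  by (simp add: map_poly_pCons hom_minus map_poly_const one_pCons)

lemma valuation_map_poly: "valuation om \<Longrightarrow> valuation (\<lambda>f. om (map_poly s f))"
  using map_poly_const[of 1] unfolding valuation_def valuation_on_def
  by (simp add: map_poly_add map_poly_mult one_pCons)

end

lemma valuation_const:
  fixes om :: "'a::field poly \<Rightarrow> 'l::linordered_ab_group_add with_infinity"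
  assumes "valuation om" shows "valuation (\<lambda>a. om [:a:])"
proof -
  interpret valuation om by fact
  have "om ([:a:] * [:b:]) = om [:a:] + om [:b:]" "min (om [:a:]) (om [:b:]) \<le> om ([:a:] + [:b:])" for a b
    by (rule val_mult, rule val_add)
  then show ?thesis
    unfolding valuation_def valuation_on_def using val_1 by (simp add: one_pCons add.commute)
qed

lemma identity_graph:
  assumes "is_subfield K" "\<And>a. algebraic_over K a"
  shows "hom_graph (Id_on K)" "algebraic_graph (Id_on K)"
proof -
  show "hom_graph (Id_on K)"
    by unfold_locales (use subfield_closed(2-6)[OF assms(1)] in \<open>auto simp: Id_on_iff\<close>)
  have "(P, P) \<in> poly_graph (Id_on K)" if "P \<in> polys_over K" for P
    using that by (auto simp: poly_graph_def polys_over_def)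
  then show "algebraic_graph (Id_on K)"
    unfolding algebraic_graph_def using assms(2) unfolding algebraic_over_def by blast
qed

lemma poly_graph_identity: "(f, g) \<in> poly_graph (Id_on K) \<longleftrightarrow> f = g \<and> f \<in> polys_over K"
  by (auto simp: poly_graph_def polys_over_def poly_eq_iff Id_on_iff)

text \<open>The polynomial f - f(b) is a multiple of x - b and lies in the support, so the valuation
  factors through evaluation at \<open>b\<close>.\<close>

lemma val_linear_Infty:
  fixes om :: "'a::field poly \<Rightarrow> 'l::linordered_ab_group_add with_infinity"
  assumes "valuation om" "om [:- b, 1:] = Infty"
  shows "om f = om [:poly f b:]"
proof -
  interpret valuation om by fact
  have "[:- b, 1:] dvd f - [:poly f b:]"
    by (simp flip: poly_eq_0_iff_dvd)
  then obtain g where g: "f - [:poly f b:] = [:- b, 1:] * g"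
    by (rule dvdE)
  then have inf: "om ([:- b, 1:] * g) = Infty"
    unfolding val_mult by (simp add: assms(2))
  have "f = [:poly f b:] + [:- b, 1:] * g" "[:poly f b:] = f - [:- b, 1:] * g"
    using g by (simp_all add: algebra_simps)
  then have "om [:poly f b:] \<le> om f" "om f \<le> om [:poly f b:]"
    using val_add[of "[:poly f b:]" "[:- b, 1:] * g"] val_diff[of f "[:- b, 1:] * g"] inf by simp_all
  then show ?thesis by simp
qed

text \<open>The support is prime, so it contains a linear factor of \<open>f\<close>; nonzero
  constants have finite value.\<close>

lemma exists_root_Infty:
  fixes om :: "'a::alg_closed_field poly \<Rightarrow> 'l::linordered_ab_group_add with_infinity"
  assumes "valuation om" "f \<noteq> 0" "om f = Infty"
  obtains b where "om [:- b, 1:] = Infty"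
proof -
  interpret c: valuation "\<lambda>a. om [:a:]"
    by (rule valuation_const) fact
  interpret c: field_valuation "\<lambda>a. om [:a:]" ..
  obtain A where A: "om f = om [:lead_coeff f:] + (\<Sum>a\<in>#A. om [:- a, 1:])"
    using val_poly_split[OF assms(1,2)] by blast
  have "om [:lead_coeff f:] \<noteq> Infty"
    using assms(2) by simp
  moreover have "om [:lead_coeff f:] + (\<Sum>a\<in>#A. om [:- a, 1:]) = Infty"
    unfolding A[symmetric] by (rule assms(3))
  ultimately have inf: "(\<Sum>a\<in>#A. om [:- a, 1:]) = Infty"
    by simp
  have "(\<Sum>a\<in>#B. om [:- a, 1:]) = Infty \<Longrightarrow> \<exists>b. om [:- b, 1:] = Infty" for B
    by (induction B) (auto simp: zero_with_infinity_Fin)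
  from this[OF inf] that show thesis by blast
qed

lemma fraction_valuation:
  fixes \<mu> :: "'a::field poly \<Rightarrow> 'l::linordered_ab_group_add with_infinity"
  assumes K: "is_subfield K" and \<mu>: "valuation_on (polys_over K) \<mu>"
    and supp: "\<And>f. f \<in> polys_over K \<Longrightarrow> \<mu> f = Infty \<Longrightarrow> f = 0"
  obtains w where "valuation_on (rational_functions K) w" "\<And>f. f \<in> polys_over K \<Longrightarrow> w (to_fract f) = \<mu> f"
proof -
  let ?R = "polys_over K"
  have \<mu>_0: "\<mu> 0 = Infty" and \<mu>_1: "\<mu> 1 = 0"
    and \<mu>_mult: "\<And>f g. f \<in> ?R \<Longrightarrow> g \<in> ?R \<Longrightarrow> \<mu> (f * g) = \<mu> f + \<mu> g"
    and \<mu>_add: "\<And>f g. f \<in> ?R \<Longrightarrow> g \<in> ?R \<Longrightarrow> min (\<mu> f) (\<mu> g) \<le> \<mu> (f + g)"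
    using \<mu> unfolding valuation_on_def by auto
  have fin: "\<exists>b. \<mu> q = Fin b" if "q \<in> ?R" "q \<noteq> 0" for q
    using supp[OF that(1)] that(2) by (cases "\<mu> q") auto
  \<comment> \<open>The value \<open>c\<close> of \<open>z = p / q\<close> is described additively,
    since infinite values cannot be subtracted. It is unique because \<open>\<mu> q\<close> is
    finite and cancels.\<close>
  define val where "val z c \<longleftrightarrow> (\<exists>p\<in>?R. \<exists>q\<in>?R. q \<noteq> 0 \<and> z = to_fract p / to_fract q \<and> \<mu> p = c + \<mu> q)" for z c
  have val_unique: "c = c'" if val: "val z c" "val z c'" for z c c'
  proof -
    obtain p q where p: "p \<in> ?R" "q \<in> ?R" "q \<noteq> 0" "z = to_fract p / to_fract q" "\<mu> p = c + \<mu> q"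
      using val(1) unfolding val_def by blast
    obtain p' q' where p': "p' \<in> ?R" "q' \<in> ?R" "q' \<noteq> 0" "z = to_fract p' / to_fract q'" "\<mu> p' = c' + \<mu> q'"
      using val(2) unfolding val_def by blast
    have "to_fract (p * q') = to_fract (p' * q)"
      using p(3,4) p'(3,4) by (simp add: field_simps)
    then have "p * q' = p' * q"
      by (simp only: to_fract_eq_iff)
    then have "\<mu> p + \<mu> q' = \<mu> p' + \<mu> q"
      using \<mu>_mult[OF p(1) p'(2)] \<mu>_mult[OF p'(1) p(2)] by simp
    moreover obtain b b' where "\<mu> q = Fin b" "\<mu> q' = Fin b'"
      using fin p p' by meson
    ultimately show "c = c'"
      using p(5) p'(5) by (cases c; cases c') (auto simp: algebra_simps)
  qed
  have val_ex: "\<exists>c. val z c" if z: "z \<in> rational_functions K" for z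
  proof -
    obtain p q where p: "p \<in> ?R" "q \<in> ?R" "z = to_fract p / to_fract q"
      using z unfolding rational_functions_def by blast
    show ?thesis
    proof (cases "q = 0")
      case True
      then have "val z Infty"
        unfolding val_def using p \<mu>_0 \<mu>_1 K by (intro bexI[of _ 0] bexI[of _ 1]) auto
      then show ?thesis ..
    next
      case False
      then obtain b where "\<mu> q = Fin b"
        using fin p by blast
      then have "\<mu> p = (\<mu> p + Fin (- b)) + \<mu> q"
        by (simp add: add.assoc)
      then show ?thesis
        unfolding val_def using p False by blast
    qed
  qed
  define w where "w z = (SOME c. val z c)" for z
  have w_eq: "w z = c" if "val z c" for z c
    unfolding w_def using that val_unique by (intro some_equality) auto
  have w_val: "val z (w z)" if "z \<in> rational_functions K" for z
    unfolding w_def using val_ex[OF that] by (rule someI_ex)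
  have w_fract: "w (to_fract f) = \<mu> f" if "f \<in> ?R" for f
  proof (rule w_eq)
    have "to_fract f = to_fract f / to_fract 1" "\<mu> f = \<mu> f + \<mu> 1" "(1 :: 'a poly) \<noteq> 0"
      using \<mu>_1 by simp_all
    then show "val (to_fract f) (\<mu> f)"
      unfolding val_def using that polys_over_1[OF K] by blast
  qed
  have "valuation_on (rational_functions K) w"
    unfolding valuation_on_def
  proof (intro conjI ballI)
    show "w 0 = Infty" "w 1 = 0"
      using w_fract[of 0] w_fract[of 1] \<mu>_0 \<mu>_1 K by simp_all
    fix x y assume xy: "x \<in> rational_functions K" "y \<in> rational_functions K"
    obtain p q where p: "p \<in> ?R" "q \<in> ?R" "q \<noteq> 0" "x = to_fract p / to_fract q" "\<mu> p = w x + \<mu> q"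
      using w_val[OF xy(1)] unfolding val_def by blast
    obtain p' q' where p': "p' \<in> ?R" "q' \<in> ?R" "q' \<noteq> 0" "y = to_fract p' / to_fract q'" "\<mu> p' = w y + \<mu> q'"
      using w_val[OF xy(2)] unfolding val_def by blast
    have R: "p * p' \<in> ?R" "q * q' \<in> ?R" "p * q' \<in> ?R" "p' * q \<in> ?R" "p * q' + p' * q \<in> ?R" "q * q' \<noteq> 0"
      using p p' by (auto intro!: polys_over_closed[OF K])
    show "w (x * y) = w x + w y"
    proof (rule w_eq)
      have "\<mu> (p * p') = (w x + w y) + \<mu> (q * q')"
        using p p' by (simp add: \<mu>_mult add.assoc add.left_commute)
      then show "val (x * y) (w x + w y)"
        unfolding val_def using R p(4) p'(4) by (intro bexI[of _ "p * p'"] bexI[of _ "q * q'"]) auto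
    qed
    have "x + y = to_fract (p * q' + p' * q) / to_fract (q * q')"
      using p(3,4) p'(3,4) by (simp add: field_simps)
    moreover obtain b where b: "\<mu> (q * q') = Fin b"
      using fin R by blast
    moreover have "\<mu> (p * q' + p' * q) = (\<mu> (p * q' + p' * q) + Fin (- b)) + \<mu> (q * q')"
      unfolding b by (simp add: add.assoc)
    ultimately have "val (x + y) (\<mu> (p * q' + p' * q) + Fin (- b))"
      unfolding val_def using R by blast
    then have w_sum: "w (x + y) + Fin b = \<mu> (p * q' + p' * q)"
      using w_eq by (simp add: add.assoc)
    have "\<mu> (p * q') = w x + \<mu> (q * q')" "\<mu> (p' * q) = w y + \<mu> (q * q')"
      unfolding \<mu>_mult[OF p(1) p'(2)] \<mu>_mult[OF p'(1) p(2)] \<mu>_mult[OF p(2) p'(2)] p(5) p'(5)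
      by (simp_all only: add.assoc add.commute[of "\<mu> q'"])
    then have "\<mu> (p * q') = w x + Fin b" "\<mu> (p' * q) = w y + Fin b"
      unfolding b .
    then have "min (w x + Fin b) (w y + Fin b) \<le> w (x + y) + Fin b"
      using \<mu>_add[OF R(3,4)] w_sum by simp
    then show "min (w x) (w y) \<le> w (x + y)"
      by (auto simp: min_def split: if_splits)
  qed
  with w_fract show thesis
    using that by blast
qed

text \<open>K[b] is closed under inverses because \<open>b\<close> is algebraic; this is read off
  from \<open>hom_graphI_algebraic\<close>, applied to the identity of K[b].\<close>

lemma subfield_poly_image:
  assumes "is_subfield K" "\<And>a. algebraic_over K a"
  shows "is_subfield ((\<lambda>h. poly h b) ` polys_over K)"
proof -
  let ?F = "(\<lambda>h. poly h b) ` polys_over K"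
  have eq: "adjoin_graph (Id_on K) b b = Id_on ?F"
    by (auto simp: adjoin_graph_def poly_graph_identity)
  have sub: "Id_on K \<subseteq> Id_on ?F"
  proof
    fix x assume "x \<in> Id_on K"
    then obtain k where "k \<in> K" "x = (k, k)" by auto
    then have "[:k:] \<in> polys_over K" "k = poly [:k:] b"
      using assms(1) by simp_all
    then show "x \<in> Id_on ?F"
      using \<open>x = (k, k)\<close> by blast
  qed
  have "hom_graph (Id_on ?F)"
  proof (rule hom_graphI_algebraic[OF identity_graph[OF assms] sub])
    fix x y x' y' assume "(x, y) \<in> Id_on ?F" "(x', y') \<in> Id_on ?F"
    then obtain h h' where h: "h \<in> polys_over K" "h' \<in> polys_over K" "x = poly h b" "y = x" "x' = poly h' b" "y' = x'"
      by auto
    have "h + h' \<in> polys_over K" "h * h' \<in> polys_over K" "x + x' = poly (h + h') b" "x * x' = poly (h * h') b"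
      using h by (auto intro: polys_over_closed[OF assms(1)])
    then have "x + x' \<in> ?F" "x * x' \<in> ?F"
      by blast+
    then show "(x + x', y + y') \<in> Id_on ?F" "(x * x', y * y') \<in> Id_on ?F"
      using h(4,6) by (simp_all only: Id_on_iff)
  qed (auto simp: Id_on_iff)
  then interpret hom_graph "Id_on ?F" .
  from subfield_Domain show ?thesis
    by simp
qed

text \<open>With zero support the valuation passes to rational functions. Otherwise the support
  contains the minimal polynomial of some \<open>b\<close>, the value of \<open>f\<close> depends
  only on \<open>poly f b\<close>, and extending the induced valuation of the field M[b] to the
  ambient field suffices.\<close>

lemma valuation_extension_poly:
  fixes \<mu> :: "'a::alg_closed_field poly \<Rightarrow> 'l::linordered_ab_group_add with_infinity"
  assumes div: "divisible_group TYPE('l)" and M: "is_subfield M" and alg: "\<And>a. algebraic_over M a"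
    and \<mu>: "valuation_on (polys_over M) \<mu>" and fin: "\<And>a. a \<in> M \<Longrightarrow> a \<noteq> 0 \<Longrightarrow> \<mu> [:a:] \<noteq> Infty"
  obtains om where "valuation om" "\<And>f. f \<in> polys_over M \<Longrightarrow> om f = \<mu> f"
proof (cases "\<forall>f\<in>polys_over M. \<mu> f = Infty \<longrightarrow> f = 0")
  case True
  then obtain w where w: "valuation_on (rational_functions M) w" "\<And>f. f \<in> polys_over M \<Longrightarrow> w (to_fract f) = \<mu> f"
    using fraction_valuation[OF M \<mu>] by blast
  obtain w' where w': "valuation w'" "\<And>x. x \<in> rational_functions M \<Longrightarrow> w' x = w x"
    using valuation_extension[OF div subfield_rational_functions[OF M] w(1) algebraic_rational_functions[OF M alg]]
    by blast
  interpret w': valuation w' by fact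
  have "valuation (\<lambda>f. w' (to_fract f))"
    by unfold_locales (simp add: valuation_on_def w'.val_mult w'.val_add)
  moreover have "w' (to_fract f) = \<mu> f" if "f \<in> polys_over M" for f
    using w'(2) w(2) rational_functions_to_fract[OF M] that by simp
  ultimately show thesis
    using that by blast
next
  case False
  let ?R = "polys_over M"
  have \<mu>_0: "\<mu> 0 = Infty" and \<mu>_1: "\<mu> 1 = 0"
    and \<mu>_mult: "\<And>f g. f \<in> ?R \<Longrightarrow> g \<in> ?R \<Longrightarrow> \<mu> (f * g) = \<mu> f + \<mu> g"
    and \<mu>_add: "\<And>f g. f \<in> ?R \<Longrightarrow> g \<in> ?R \<Longrightarrow> min (\<mu> f) (\<mu> g) \<le> \<mu> (f + g)"
    using \<mu> unfolding valuation_on_def by auto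
  obtain f0 where f0: "f0 \<in> ?R" "\<mu> f0 = Infty" "f0 \<noteq> 0"
    using False by blast
  obtain p where p: "p \<in> ?R" "\<mu> p = Infty" "p \<noteq> 0"
    and pmin: "\<And>q. q \<in> ?R \<Longrightarrow> \<mu> q = Infty \<Longrightarrow> q \<noteq> 0 \<Longrightarrow> degree p \<le> degree q"
    using ex_has_least_nat[of "\<lambda>p. p \<in> ?R \<and> \<mu> p = Infty \<and> p \<noteq> 0" f0 degree] f0 by blast
  have degp: "0 < degree p"
  proof (rule ccontr)
    assume "\<not> 0 < degree p"
    then obtain c where c: "p = [:c:]"
      by (metis degree_eq_zeroE gr0I)
    have "c \<in> M" "c \<noteq> 0"
      using p(1,3) polys_over_pCons_iff[OF M, of c 0] unfolding c by auto
    from fin[OF this] p(2) show False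
      unfolding c by simp
  qed
  obtain b where b: "poly p b = 0"
    using alg_closed_imp_poly_has_root[OF degp] by blast
  \<comment> \<open>In \<open>p = m * g\<close> the cofactor has degree below that of
    \<open>p\<close>, hence finite value, so \<open>m\<close> lies in the support.\<close>
  obtain m where m: "is_min_poly M b m"
    using exists_min_poly[OF M alg] by blast
  then have mR: "m \<in> ?R" and "m \<noteq> 0" "poly m b = 0"
    by (auto simp: is_min_poly_def)
  obtain g where g: "g \<in> ?R" "p = m * g"
    using min_poly_division[OF M alg m p(1) b] .
  have "g \<noteq> 0" "0 < degree m"
    using g p degree_pos_of_root[OF \<open>m \<noteq> 0\<close> \<open>poly m b = 0\<close>] by auto
  then have "degree g < degree p"
    using g(2) \<open>m \<noteq> 0\<close> by (simp add: degree_mult_eq)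
  then have "\<mu> g \<noteq> Infty"
    using pmin[OF g(1)] \<open>g \<noteq> 0\<close> by auto
  then have m_Infty: "\<mu> m = Infty"
    using p(2) \<mu>_mult[OF mR g(1)] g(2) by simp
  have root_Infty: "\<mu> h = Infty" if h: "h \<in> ?R" "poly h b = 0" for h
  proof -
    obtain k where "k \<in> ?R" "h = m * k"
      using min_poly_division[OF M alg m h] .
    then show ?thesis
      using \<mu>_mult[OF mR] m_Infty by simp
  qed
  have \<mu>_cong: "\<mu> h = \<mu> h'" if h: "h \<in> ?R" "h' \<in> ?R" "poly h b = poly h' b" for h h'
  proof -
    have inf: "\<mu> (h - h') = Infty" "\<mu> (h' - h) = Infty"
      using h by (auto intro!: root_Infty polys_over_closed[OF M])
    have "min (\<mu> h') (\<mu> (h - h')) \<le> \<mu> (h' + (h - h'))" "min (\<mu> h) (\<mu> (h' - h)) \<le> \<mu> (h + (h' - h))"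
      by (rule \<mu>_add[OF h(2) polys_over_closed(2)[OF M h(1,2)]],
          rule \<mu>_add[OF h(1) polys_over_closed(2)[OF M h(2,1)]])
    then show ?thesis
      using inf by simp
  qed
  let ?F = "(\<lambda>h. poly h b) ` ?R"
  define w where "w c = \<mu> (SOME h. h \<in> ?R \<and> poly h b = c)" for c
  have w_poly: "w (poly h b) = \<mu> h" if "h \<in> ?R" for h
  proof -
    have "(SOME h'. h' \<in> ?R \<and> poly h' b = poly h b) \<in> ?R \<and> poly (SOME h'. h' \<in> ?R \<and> poly h' b = poly h b) b = poly h b"
      by (rule someI[of _ h]) (use that in simp)
    with that show ?thesis
      unfolding w_def by (intro \<mu>_cong) auto
  qed
  have F: "is_subfield ?F"
    by (rule subfield_poly_image[OF M alg])
  have w_val: "valuation_on ?F w"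
    unfolding valuation_on_def
  proof (intro conjI ballI)
    show "w 0 = Infty" "w 1 = 0"
      using w_poly[of 0] w_poly[of 1] \<mu>_0 \<mu>_1 M by simp_all
    fix x y assume "x \<in> ?F" "y \<in> ?F"
    then obtain h h' where h: "h \<in> ?R" "h' \<in> ?R" "x = poly h b" "y = poly h' b"
      by blast
    then show "w (x * y) = w x + w y"
      using w_poly[of "h * h'"] by (simp add: w_poly \<mu>_mult polys_over_closed[OF M])
    show "min (w x) (w y) \<le> w (x + y)"
      using w_poly[of "h + h'"] \<mu>_add[OF h(1,2)] h by (simp add: w_poly polys_over_closed[OF M])
  qed
  have "M \<subseteq> ?F"
  proof
    fix a assume "a \<in> M"
    then have "[:a:] \<in> ?R" "a = poly [:a:] b"
      using M by simp_all
    then show "a \<in> ?F" by blast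
  qed
  then have "algebraic_over ?F z" for z
    using alg[of z] unfolding algebraic_over_def polys_over_def by blast
  then obtain w' where w': "valuation w'" "\<And>x. x \<in> ?F \<Longrightarrow> w' x = w x"
    using valuation_extension[OF div F w_val] by blast
  interpret w': valuation w' by fact
  have "valuation (\<lambda>f. w' (poly f b))"
    by unfold_locales (simp add: valuation_on_def w'.val_mult w'.val_add)
  moreover have "w' (poly f b) = \<mu> f" if "f \<in> ?R" for f
    using w'(2) w_poly that by simp
  ultimately show thesis
    using that by blast
qed

text \<open>An arbitrary extension is twisted by an embedding acting on coefficients; as it fixes
  \<open>M\<close>, the values on polynomials over \<open>M\<close> do not change. The base
  \<open>M\<close> is both \<open>K\<close> and the henselization in the applications.\<close>

lemma extension_over_closure:
  fixes vbar :: "'a::alg_closed_field \<Rightarrow> 'l::linordered_ab_group_add with_infinity"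
  assumes div: "divisible_group TYPE('l)" and M: "is_subfield M" and alg: "\<And>a. algebraic_over M a"
    and vbar: "valuation vbar"
    and \<mu>: "valuation_on (polys_over M) \<mu>" and ext: "\<And>a. a \<in> M \<Longrightarrow> \<mu> [:a:] = vbar a"
  obtains om where "valuation om" "\<And>f. f \<in> polys_over M \<Longrightarrow> om f = \<mu> f" "\<And>a. om [:a:] = vbar a"
proof -
  interpret vbar: field_valuation vbar by (rule field_valuation.intro) fact
  have "\<mu> [:a:] \<noteq> Infty" if "a \<in> M" "a \<noteq> 0" for a
    using ext that by simp
  then obtain om where om: "valuation om" "\<And>f. f \<in> polys_over M \<Longrightarrow> om f = \<mu> f"
    using valuation_extension_poly[OF div M alg \<mu>] by blast
  have "compatible_graph vbar (\<lambda>a. om [:a:]) (Id_on M)"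
    using om(2) ext M by (auto simp: compatible_graph_def)
  then obtain s where s: "\<And>x y. s (x + y) = s x + s y" "\<And>x y. s (x * y) = s x * s y"
    "\<And>x y. (x, y) \<in> Id_on M \<Longrightarrow> s x = y" "\<And>x. vbar x = om [:s x:]"
    using conjugate_valuations[OF vbar valuation_const[OF om(1)] identity_graph[OF M alg]] by blast
  have fix_M: "s x = x" if "x \<in> M" for x
    using s(3) that by blast
  interpret field_hom s
    using s(1,2) fix_M[OF subfield_closed(2)[OF M]] by unfold_locales
  have "map_poly s f = f" if "f \<in> polys_over M" for f
    using that fix_M by (simp add: poly_eq_iff coeff_map_poly polys_over_def)
  then show thesis
    using that[OF valuation_map_poly[OF om(1)]] om(2) s(4) by (simp add: map_poly_const)
qed

lemma val_quotient:
  fixes w1 w2 :: "'b::field \<Rightarrow> 'l::linordered_ab_group_add with_infinity"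
  assumes "valuation w1" "valuation w2" "w1 x = w2 x" "w1 y = w2 y"
  shows "w1 (x / y) = w2 (x / y)"
proof (cases "y = 0")
  case True
  interpret w1: valuation w1 by fact
  interpret w2: valuation w2 by fact
  from True show ?thesis by simp
next
  case False
  interpret w1: field_valuation w1 by (rule field_valuation.intro) fact
  interpret w2: field_valuation w2 by (rule field_valuation.intro) fact
  have "w1 y \<noteq> Infty"
    using False by simp
  then obtain a where a: "w1 y = Fin a"
    by (rule neq_InftyE)
  then have "w1 (inverse y) = w2 (inverse y)"
    using w1.val_inverse[OF False a] w2.val_inverse[OF False, of a] assms(4) by simp
  then show ?thesis
    using assms(3) by (simp add: divide_inverse w1.val_mult w2.val_mult)
qed

text \<open>A conjugation of the rational function field over \<open>K(X)\<close>, taken in an algebraic closure of that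
  field, maps constants to constants because constants are algebraic over \<open>K\<close>.\<close>

lemma conjugate_over_closure_faithful:
  fixes om1 om2 :: "'a::alg_closed_field poly \<Rightarrow> 'l::linordered_ab_group_add with_infinity"
  assumes div: "divisible_group TYPE('l)" and K: "is_subfield K" and alg: "\<And>a. algebraic_over K a"
    and om1: "valuation om1" "\<And>f. om1 f = Infty \<Longrightarrow> f = 0"
    and om2: "valuation om2" "\<And>f. om2 f = Infty \<Longrightarrow> f = 0"
    and eq: "\<And>f. f \<in> polys_over K \<Longrightarrow> om1 f = om2 f"
  obtains s where "field_hom s" "\<And>x. x \<in> K \<Longrightarrow> s x = x" "\<And>f. om1 f = om2 (map_poly s f)"
proof -
  have UNIV: "is_subfield (UNIV :: 'a set)" "polys_over (UNIV :: 'a set) = UNIV"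
    by (auto simp: is_subfield_def polys_over_def)
  have RUNIV: "rational_functions (UNIV :: 'a set) = UNIV"
    unfolding rational_functions_def UNIV(2) using Fract_conv_to_fract Fract_cases by (metis (mono_tags, lifting) UNIV_I UNIV_eq_I mem_Collect_eq)
  have fract: "\<exists>w. valuation w \<and> (\<forall>f. w (to_fract f) = om f)"
    if om: "valuation om" "\<And>f. om f = Infty \<Longrightarrow> f = 0" for om :: "'a poly \<Rightarrow> 'l with_infinity"
  proof -
    obtain w where "valuation_on (rational_functions UNIV) w" "\<And>f. f \<in> polys_over UNIV \<Longrightarrow> w (to_fract f) = om f"
      using fraction_valuation[OF UNIV(1), of om] om(2) valuation.valuation_UNIV[OF om(1)]
      unfolding UNIV(2) by blast
    then show ?thesis
      unfolding RUNIV UNIV(2) valuation_def by blast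
  qed
  obtain w1 where w1: "valuation w1" "\<And>f. w1 (to_fract f) = om1 f"
    using fract[OF om1] by blast
  obtain w2 where w2: "valuation w2" "\<And>f. w2 (to_fract f) = om2 f"
    using fract[OF om2] by blast
  interpret w2: valuation w2 by fact
  \<comment> \<open>Conjugacy needs an algebraically closed target, so \<open>w2\<close> is extended
    to an algebraic closure of the rational function field.\<close>
  let ?F = "range (to_ac :: 'a poly fract \<Rightarrow> _)"
  have "is_subfield ?F"
    unfolding is_subfield_def
    by (auto simp flip: to_ac_add to_ac_mult to_ac_minus to_ac_inverse to_ac_0 to_ac_1
        simp del: to_ac_0 to_ac_1)
  moreover have "valuation_on ?F (\<lambda>z. w2 (of_ac z))"
    unfolding valuation_on_def
    by (auto simp flip: to_ac_add to_ac_mult simp: w2.val_mult w2.val_add)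
  moreover have "algebraic_over ?F z" for z
  proof -
    obtain p :: "'a poly fract poly" where p: "p \<noteq> 0" "poly (map_poly to_ac p) z = 0"
      by (rule alg_closure_algebraic)
    have "map_poly to_ac p \<in> polys_over ?F" "map_poly to_ac p \<noteq> 0"
      using p(1) by (auto simp: polys_over_def coeff_map_poly poly_eq_iff)
    with p(2) show ?thesis
      unfolding algebraic_over_def by blast
  qed
  ultimately obtain W where W: "valuation W" "\<And>x. x \<in> ?F \<Longrightarrow> W x = w2 (of_ac x)"
    using valuation_extension[OF div] by blast
  have W_ac: "W (to_ac z) = w2 z" for z
    using W(2) by simp
  let ?R = "rational_functions K"
  define G where "G = (\<lambda>z. (z, to_ac z)) ` ?R"
  note R = subfield_rational_functions[OF K]
  have G_iff: "(x, y) \<in> G \<longleftrightarrow> x \<in> ?R \<and> y = to_ac x" for x y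
    by (auto simp: G_def)
  have "hom_graph G"
    by unfold_locales (use subfield_closed(2-6)[OF R] in \<open>auto simp: G_iff\<close>)
  moreover have "algebraic_graph G"
  proof -
    have "(P, map_poly to_ac P) \<in> poly_graph G" if "P \<in> polys_over ?R" for P
      using that by (auto simp: poly_graph_def polys_over_def G_iff coeff_map_poly)
    then show ?thesis
      unfolding algebraic_graph_def
      using algebraic_rational_functions[OF K alg] unfolding algebraic_over_def by blast
  qed
  moreover have "compatible_graph w1 W G"
  proof -
    have "w1 z = w2 z" if z: "z \<in> ?R" for z
    proof -
      obtain p q where pq: "p \<in> polys_over K" "q \<in> polys_over K" "z = to_fract p / to_fract q"
        using z unfolding rational_functions_def by blast
      show ?thesis
        unfolding pq(3) by (rule val_quotient[OF w1(1) w2(1)]) (simp_all add: w1(2) w2(2) eq pq(1,2))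
    qed
    then show ?thesis
      by (auto simp: compatible_graph_def G_iff W_ac)
  qed
  ultimately obtain S where S: "\<And>x y. S (x + y) = S x + S y" "\<And>x y. S (x * y) = S x * S y"
    "\<And>x y. (x, y) \<in> G \<Longrightarrow> S x = y" "\<And>x. w1 x = W (S x)"
    using conjugate_valuations[OF w1(1) W(1)] by blast
  have S_R: "S z = to_ac z" if "z \<in> ?R" for z
    using S(3) that by (simp add: G_iff)
  define \<iota> :: "'a \<Rightarrow> 'a poly fract alg_closure" where "\<iota> a = to_ac (to_fract [:a:])" for a
  define T where "T a = S (to_fract [:a:])" for a :: 'a
  have K_R: "to_fract [:a:] \<in> ?R" if "a \<in> K" for a
    using that K by (intro rational_functions_to_fract[OF K]) simp
  have T_K: "T a = \<iota> a" if "a \<in> K" for a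
    using S_R[OF K_R[OF that]] by (simp add: T_def \<iota>_def)
  have const_hom: "to_fract [:a + b:] = to_fract [:a:] + to_fract [:b:]"
    "to_fract [:a * b:] = to_fract [:a:] * to_fract [:b:]" "to_fract [:1:] = 1" for a b :: 'a
    by (simp_all flip: to_fract_add to_fract_mult add: one_pCons[symmetric])
  interpret \<iota>: field_hom \<iota>
    by unfold_locales (simp_all add: \<iota>_def const_hom)
  interpret T: field_hom T
    using T_K[OF subfield_closed(2)[OF K]] by unfold_locales (simp_all add: T_def const_hom S(1,2))
  \<comment> \<open>The image of a constant \<open>a\<close> is a root of a polynomial over
    \<open>K\<close>, and this polynomial already splits over the constants.\<close>
  have "\<exists>b. T a = \<iota> b" for a
  proof -
    obtain p where p: "p \<in> polys_over K" "p \<noteq> 0" "poly p a = 0"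
      using alg unfolding algebraic_over_def by blast
    obtain A where A: "p = smult (lead_coeff p) (\<Prod>a\<in>#A. [:- a, 1:])"
      using alg_closed_imp_factorization[OF p(2)] by blast
    have "map_poly T p = map_poly \<iota> p"
      using p(1) T_K by (simp add: poly_eq_iff coeff_map_poly polys_over_def)
    then have "poly (map_poly \<iota> p) (T a) = 0"
      using T.poly_map_poly[of p a] p(3) by simp
    moreover have "map_poly \<iota> p = [:\<iota> (lead_coeff p):] * (\<Prod>a\<in>#A. [:- \<iota> a, 1:])"
    proof -
      have "p = [:lead_coeff p:] * (\<Prod>a\<in>#A. [:- a, 1:])"
        using A by simp
      from arg_cong[OF this, of "map_poly \<iota>"] show ?thesis
        by (simp only: \<iota>.map_poly_mult \<iota>.map_poly_prod_mset \<iota>.map_poly_const \<iota>.map_poly_linear)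
    qed
    ultimately have "(\<Prod>b\<in>#A. T a - \<iota> b) = 0"
      using p(2) by (simp add: poly_prod_mset)
    then show ?thesis
      by (auto simp: prod_mset_zero_iff)
  qed
  then obtain s where s: "\<And>a. T a = \<iota> (s a)"
    by metis
  have "field_hom s"
  proof
    show "s (x + y) = s x + s y" "s (x * y) = s x * s y" "s 1 = 1" for x y
      unfolding \<iota>.hom_inj[symmetric, of "s _"] s[symmetric] \<iota>.hom_add \<iota>.hom_mult T.hom_add T.hom_mult
      by simp_all
  qed
  then interpret s: field_hom s .
  have s_K: "s x = x" if "x \<in> K" for x
    using T_K[OF that] by (simp add: s \<iota>.hom_inj)
  have X_R: "to_fract [:0, 1:] \<in> ?R"
    using subfield_closed(1,2)[OF K] by (intro rational_functions_to_fract[OF K]) (simp add: K)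
  \<comment> \<open>\<open>S\<close> fixes the variable, so it acts on polynomials through their
    coefficients.\<close>
  have S_fract: "S (to_fract f) = to_ac (to_fract (map_poly s f))" for f
  proof (induction f)
    case 0
    show ?case
      using S_R[OF subfield_closed(1)[OF R]] by simp
  next
    case (pCons a f)
    have split: "to_fract (pCons a f) = to_fract [:a:] + to_fract [:0, 1:] * to_fract f" for a and f :: "'a poly"
      by (simp flip: to_fract_mult to_fract_add)
    have "S (to_fract (pCons a f)) = T a + S (to_fract [:0, 1:]) * S (to_fract f)"
      unfolding split[of a f] S(1,2) T_def ..
    also have "\<dots> = to_ac (to_fract [:s a:] + to_fract [:0, 1:] * to_fract (map_poly s f))"
      unfolding s \<iota>_def S_R[OF X_R] pCons.IH by simp
    also have "\<dots> = to_ac (to_fract (map_poly s (pCons a f)))"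
      unfolding split[symmetric, of "s a" "map_poly s f"] by (simp only: map_poly_pCons s.hom_0)
    finally show ?case .
  qed
  have "om1 f = om2 (map_poly s f)" for f
    using S(4)[of "to_fract f"] by (simp add: S_fract W_ac w1(2) w2(2))
  with \<open>field_hom s\<close> s_K show thesis
    using that by blast
qed

text \<open>If the support meets K[x] in 0, both valuations have zero support. Otherwise they are
  \<open>vbar\<close> composed with evaluation at points \<open>b1\<close> and \<open>b2\<close>,
  and an embedding preserving \<open>vbar\<close> and taking \<open>b1\<close> to \<open>b2\<close>
  is obtained by starting the conjugacy argument from K[b1].\<close>

lemma conjugate_over_closure:
  fixes om1 om2 :: "'a::alg_closed_field poly \<Rightarrow> 'l::linordered_ab_group_add with_infinity"
  assumes div: "divisible_group TYPE('l)" and K: "is_subfield K" and alg: "\<And>a. algebraic_over K a"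
    and vbar: "valuation vbar" and om1: "valuation om1" "\<And>a. om1 [:a:] = vbar a"
    and om2: "valuation om2" "\<And>a. om2 [:a:] = vbar a"
    and eq: "\<And>f. f \<in> polys_over K \<Longrightarrow> om1 f = om2 f"
  obtains s where "field_hom s" "\<And>x. x \<in> K \<Longrightarrow> s x = x" "\<And>f. om1 f = om2 (map_poly s f)"
proof (cases "\<exists>f\<in>polys_over K. f \<noteq> 0 \<and> om1 f = Infty")
  case False
  \<comment> \<open>A linear polynomial x - b in the support would bring with it an annihilating
    polynomial of \<open>b\<close> over \<open>K\<close>.\<close>
  have nz: "f = 0" if om: "valuation om" "\<And>g. g \<in> polys_over K \<Longrightarrow> om g = om1 g" "om f = Infty" for om f
  proof (rule ccontr)
    assume "f \<noteq> 0"
    interpret valuation om by fact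
    obtain b where b: "om [:- b, 1:] = Infty"
      using exists_root_Infty[OF om(1) \<open>f \<noteq> 0\<close> om(3)] .
    obtain p where p: "p \<in> polys_over K" "p \<noteq> 0" "poly p b = 0"
      using alg unfolding algebraic_over_def by blast
    have "om p = Infty"
      using val_linear_Infty[OF om(1) b, of p] p(3) by simp
    then show False
      using False p om(2) by auto
  qed
  show thesis
    by (rule conjugate_over_closure_faithful[OF div K alg om1(1) nz[OF om1(1) refl] om2(1) nz[OF om2(1) eq[symmetric]] eq that])
next
  case True
  interpret vbar: field_valuation vbar by (rule field_valuation.intro) fact
  obtain f0 where f0: "f0 \<in> polys_over K" "f0 \<noteq> 0" "om1 f0 = Infty"
    using True by blast
  obtain b1 where b1: "om1 [:- b1, 1:] = Infty"
    using exists_root_Infty[OF om1(1) f0(2,3)] .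
  obtain b2 where b2: "om2 [:- b2, 1:] = Infty"
    using exists_root_Infty[OF om2(1) f0(2)] eq[OF f0(1)] f0(3) by auto
  have om1_eq: "om1 f = vbar (poly f b1)" and om2_eq: "om2 f = vbar (poly f b2)" for f
    using val_linear_Infty[OF om1(1) b1] val_linear_Infty[OF om2(1) b2] om1(2) om2(2) by simp_all
  let ?G = "adjoin_graph (Id_on K) b1 b2"
  have G_iff: "(x, y) \<in> ?G \<longleftrightarrow> (\<exists>h\<in>polys_over K. x = poly h b1 \<and> y = poly h b2)" for x y
    unfolding adjoin_graph_def poly_graph_identity by auto
  have sub: "Id_on K \<subseteq> ?G"
  proof
    fix x assume "x \<in> Id_on K"
    then obtain k where k: "k \<in> K" "x = (k, k)" by auto
    then have "[:k:] \<in> polys_over K" "k = poly [:k:] b1" "k = poly [:k:] b2"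
      using K by simp_all
    then show "x \<in> ?G"
      unfolding k(2) G_iff by blast
  qed
  have compat: "compatible_graph vbar vbar ?G"
    unfolding compatible_graph_def using eq om1_eq om2_eq by (auto simp: G_iff)
  have "hom_graph ?G"
  proof (rule hom_graphI_algebraic[OF identity_graph[OF K alg] sub])
    fix x y x' y' assume "(x, y) \<in> ?G" "(x', y') \<in> ?G"
    then obtain h h' where h: "h \<in> polys_over K" "h' \<in> polys_over K" "x = poly h b1" "y = poly h b2"
      "x' = poly h' b1" "y' = poly h' b2"
      unfolding G_iff by blast
    show "(x + x', y + y') \<in> ?G"
      unfolding G_iff using h by (intro bexI[of _ "h + h'"]) (auto intro: polys_over_closed[OF K])
    show "(x * x', y * y') \<in> ?G"
      unfolding G_iff using h by (intro bexI[of _ "h * h'"]) (auto intro: polys_over_closed[OF K])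
  next
    \<comment> \<open>Equality of the valuations on K[x] makes \<open>b1 \<mapsto> b2\<close> well
      defined: if h(b1) = 0, then h(b2) has infinite value and is 0.\<close>
    fix y assume "(0, y) \<in> ?G"
    then have "vbar 0 = vbar y"
      using compat unfolding compatible_graph_def by blast
    then show "y = 0"
      by (metis vbar.val_0 vbar.val_eq_Infty_iff)
  qed
  then obtain s where s: "\<And>x y. s (x + y) = s x + s y" "\<And>x y. s (x * y) = s x * s y"
    "\<And>x y. (x, y) \<in> ?G \<Longrightarrow> s x = y" "\<And>x. vbar x = vbar (s x)"
    using conjugate_valuations[OF vbar vbar _ algebraic_graph_mono[OF sub identity_graph(2)[OF K alg]] compat] by blast
  have s_K: "s x = x" if "x \<in> K" for x
    using s(3) sub that by blast
  have "field_hom s"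
    using s(1,2) s_K[OF subfield_closed(2)[OF K]] by unfold_locales
  then interpret field_hom s .
  have "s b1 = b2"
  proof -
    have "[:0, 1:] \<in> polys_over K"
      using K subfield_closed[OF K] by simp
    then have "(b1, b2) \<in> ?G"
      unfolding G_iff by (intro bexI[of _ "[:0, 1:]"]) auto
    then show ?thesis by (rule s(3))
  qed
  then have "om1 f = om2 (map_poly s f)" for f
    using poly_map_poly[of f b1] s(4)[of "poly f b1"] by (simp add: om1_eq om2_eq)
  with \<open>field_hom s\<close> s_K show thesis
    using that by blast
qed

section \<open>Henselization\<close>

context
  fixes K :: "'a::alg_closed_field set" and vbar :: "'a \<Rightarrow> 'l::linordered_ab_group_add with_infinity"
  assumes K: "is_subfield K" and alg: "\<And>a. algebraic_over K a"
begin

lemma field_automorphism_simps: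
  assumes \<sigma>: "\<sigma> \<in> field_automorphisms_over K E" and E: "is_subfield E" "K \<subseteq> E"
  shows "a \<in> E \<Longrightarrow> b \<in> E \<Longrightarrow> \<sigma> (a + b) = \<sigma> a + \<sigma> b" "a \<in> E \<Longrightarrow> b \<in> E \<Longrightarrow> \<sigma> (a * b) = \<sigma> a * \<sigma> b"
    "a \<in> K \<Longrightarrow> \<sigma> a = a" "a \<in> E \<Longrightarrow> \<sigma> (- a) = - \<sigma> a" "a \<in> E \<Longrightarrow> \<sigma> (inverse a) = inverse (\<sigma> a)"
proof -
  show add: "a \<in> E \<Longrightarrow> b \<in> E \<Longrightarrow> \<sigma> (a + b) = \<sigma> a + \<sigma> b"
    and mult: "a \<in> E \<Longrightarrow> b \<in> E \<Longrightarrow> \<sigma> (a * b) = \<sigma> a * \<sigma> b"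
    and fixed: "a \<in> K \<Longrightarrow> \<sigma> a = a" for a b
    using \<sigma> unfolding field_automorphisms_over_def by blast+
  show "\<sigma> (- a) = - \<sigma> a" if "a \<in> E"
  proof -
    have "- 1 \<in> K"
      using subfield_closed(2,5)[OF K] by blast
    then show ?thesis
      using mult[of "- 1" a] fixed[of "- 1"] that E(2) by auto
  qed
  show "\<sigma> (inverse a) = inverse (\<sigma> a)" if "a \<in> E"
  proof (cases "a = 0")
    case True
    then show ?thesis
      using fixed subfield_closed(1)[OF K] by simp
  next
    case False
    have "\<sigma> a * \<sigma> (inverse a) = 1"
      using mult[OF that subfield_closed(6)[OF E(1) that]] False fixed subfield_closed(2)[OF K] by simp
    then show ?thesis
      by (rule inverse_unique[symmetric])
  qed
qed

lemma subset_separable_closure: "K \<subseteq> separable_closure K"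
  unfolding separable_closure_def using separable_over_mem[OF K alg] by blast

lemma subfield_henselization: "is_subfield (henselization K vbar)"
proof -
  note E = subfield_separable_closure[OF K alg]
  note [simp] = field_automorphism_simps[OF _ E subset_separable_closure]
  show ?thesis
    unfolding is_subfield_def henselization_def
    using subfield_closed(1,2)[OF K] subfield_closed(1-6)[OF E] by auto
qed

lemma subset_henselization: "K \<subseteq> henselization K vbar"
  unfolding henselization_def using subset_separable_closure
  by (auto simp: field_automorphisms_over_def)

text \<open>\<open>s\<close> is only an embedding; it is onto here because it maps the finite set of
  roots of each minimal polynomial injectively into itself.\<close>

lemma hom_separable_closure:
  assumes "field_hom s" "\<And>x. x \<in> K \<Longrightarrow> s x = x"
  shows "bij_betw s (separable_closure K) (separable_closure K)"
proof -
  interpret field_hom s by fact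
  have map: "map_poly s q = q" if "q \<in> polys_over K" for q
    using that assms(2) by (simp add: poly_eq_iff coeff_map_poly polys_over_def)
  have root: "poly q (s a) = 0 \<longleftrightarrow> poly q a = 0" if "q \<in> polys_over K" for q a
    using poly_map_poly[of q a] map[OF that] by simp
  have min: "is_min_poly K (s a) m \<longleftrightarrow> is_min_poly K a m" for a m
    unfolding is_min_poly_def using root by blast
  then have sep: "separable_over K (s a) \<longleftrightarrow> separable_over K a" for a
    by (simp add: separable_over_def)
  have "b \<in> s ` separable_closure K" if b: "b \<in> separable_closure K" for b
  proof -
    obtain m where m: "is_min_poly K b m"
      using exists_min_poly[OF K alg] by blast
    let ?R = "{a. poly m a = 0}"
    have mK: "m \<in> polys_over K" "m \<noteq> 0" "b \<in> ?R"
      using m by (auto simp: is_min_poly_def)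
    have "finite ?R"
      using mK(2) by (rule poly_roots_finite)
    moreover have "s ` ?R \<subseteq> ?R"
      using root[OF mK(1)] by auto
    moreover have "inj_on s ?R"
      using hom_inj by (auto simp: inj_on_def)
    ultimately have "s ` ?R = ?R"
      by (rule endo_inj_surj)
    then obtain a where "b = s a"
      using mK(3) by blast
    then show ?thesis
      using b sep by (auto simp: separable_closure_def)
  qed
  then show ?thesis
    unfolding bij_betw_def using sep hom_inj by (auto simp: inj_on_def separable_closure_def)
qed

text \<open>Restricted to the separable closure, \<open>s\<close> is one of the automorphisms that
  define the henselization as a fixed field.\<close>

lemma hom_fixes_henselization:
  assumes s: "field_hom s" "\<And>x. x \<in> K \<Longrightarrow> s x = x" "\<And>x. vbar (s x) = vbar x"
    and a: "a \<in> henselization K vbar"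
  shows "s a = a"
proof -
  interpret field_hom s by fact
  let ?E = "separable_closure K"
  note E = subfield_closed(3,4)[OF subfield_separable_closure[OF K alg]]
  have "restrict s ?E \<in> field_automorphisms_over K ?E"
    unfolding field_automorphisms_over_def
    using hom_separable_closure[OF s(1,2)] subset_separable_closure s(2) E
    by (auto simp: hom_add hom_mult bij_betw_restrict_eq)
  moreover have "\<forall>b\<in>?E. vbar (restrict s ?E b) = vbar b"
    by (simp add: s(3))
  ultimately have "restrict s ?E a = a"
    using a unfolding henselization_def by blast
  moreover have "a \<in> ?E"
    using a by (simp add: henselization_def)
  ultimately show ?thesis
    by simp
qed

lemma unique_over_henselization:
  assumes div: "divisible_group TYPE('l)"
    and vbar: "valuation vbar" and om1: "valuation om1" "\<And>a. om1 [:a:] = vbar a"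
    and om2: "valuation om2" "\<And>a. om2 [:a:] = vbar a"
    and eq: "\<And>f. f \<in> polys_over K \<Longrightarrow> om1 f = om2 f"
    and f: "f \<in> polys_over (henselization K vbar)"
  shows "om1 f = om2 f"
proof -
  obtain s where s: "field_hom s" "\<And>x. x \<in> K \<Longrightarrow> s x = x" "\<And>f. om1 f = om2 (map_poly s f)"
    using conjugate_over_closure[OF div K alg vbar om1 om2 eq] by blast
  \<comment> \<open>Both valuations restrict to \<open>vbar\<close> on constants, so the conjugating
    map preserves \<open>vbar\<close> automatically.\<close>
  interpret field_hom s by fact
  have "vbar (s x) = vbar x" for x
    using s(3)[of "[:x:]"] by (simp add: map_poly_const om1(2) om2(2))
  then have "s a = a" if "a \<in> henselization K vbar" for a
    using hom_fixes_henselization[OF s(1,2) _ that] by blast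
  then have "map_poly s f = f"
    using f by (simp add: poly_eq_iff coeff_map_poly polys_over_def)
  then show ?thesis
    using s(3) by simp
qed

end

section \<open>Bijectivity and comparison of orders\<close>

theorem theoremA:
  fixes K :: "'a::alg_closed_field set"
    and v vbar :: "'a \<Rightarrow> 'l::linordered_ab_group_add with_infinity"
  assumes "divisible_group TYPE('l)"
    and "is_algebraic_closure_of K"
    and "valuation_on K v"
    and "valuation_on UNIV vbar" and "\<forall>a\<in>K. vbar a = v a"
  shows "poset_isomorphism
    (valuation_extensions (henselization K vbar) (henselized_valuation K vbar))
    (pointwise_le_on (polys_over (henselization K vbar)))
    (valuation_extensions K v)
    (pointwise_le_on (polys_over K))
    (\<lambda>\<eta>. restrict \<eta> (polys_over K))"
proof -
  have K: "is_subfield K" and alg: "\<And>a. algebraic_over K a"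
    using assms(2) by (auto simp: is_algebraic_closure_of_def)
  have vbar: "valuation vbar"
    using assms(4) by (rule valuation.intro)
  define L where "L = henselization K vbar"
  have L: "is_subfield L" "K \<subseteq> L"
    unfolding L_def by (rule subfield_henselization[OF K alg], rule subset_henselization[OF K alg])
  have alg_L: "algebraic_over L a" for a
    using alg[of a] L(2) unfolding algebraic_over_def polys_over_def by blast
  have KL: "polys_over K \<subseteq> polys_over L"
    using L(2) by (auto simp: polys_over_def)
  let ?T = "valuation_extensions L (henselized_valuation K vbar)"
  have T_iff: "\<eta> \<in> ?T \<longleftrightarrow> \<eta> \<in> extensional (polys_over L) \<and> valuation_on (polys_over L) \<eta> \<and> (\<forall>a\<in>L. \<eta> [:a:] = vbar a)" for \<eta>
    by (auto simp: valuation_extensions_def henselized_valuation_def L_def)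
  let ?U = "valuation_extensions K v"
  have U_iff: "\<mu> \<in> ?U \<longleftrightarrow> \<mu> \<in> extensional (polys_over K) \<and> valuation_on (polys_over K) \<mu> \<and> (\<forall>a\<in>K. \<mu> [:a:] = vbar a)" for \<mu>
    using assms(5) by (auto simp: valuation_extensions_def)
  have extend: "\<exists>om. valuation om \<and> (\<forall>f\<in>polys_over L. om f = \<eta> f) \<and> (\<forall>a. om [:a:] = vbar a)" if "\<eta> \<in> ?T" for \<eta>
    using extension_over_closure[OF assms(1) L(1) alg_L vbar, of \<eta>] that unfolding T_iff by metis
  have restrict_valuation: "valuation_on (polys_over M) (restrict om (polys_over M))"
    if "valuation_on S om" "polys_over M \<subseteq> S" "is_subfield M" for om S and M :: "'a set"
    using that polys_over_closed(1,4)[OF that(3)] polys_over_0[OF that(3)] polys_over_1[OF that(3)]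
    unfolding valuation_on_def by (auto simp: subset_iff)
  have restrict_U: "restrict \<eta> (polys_over K) \<in> ?U" if "\<eta> \<in> ?T" for \<eta>
    using that restrict_valuation[of "polys_over L" \<eta> K] KL L(2) K unfolding T_iff U_iff by auto
  \<comment> \<open>The order on K^h[x] is recovered from the order on K[x]. Applied in both
    directions to equal restrictions, this also yields injectivity.\<close>
  have mono: "\<eta> f \<le> \<eta>' f"
    if \<eta>: "\<eta> \<in> ?T" "\<eta>' \<in> ?T" and le: "\<And>f. f \<in> polys_over K \<Longrightarrow> \<eta> f \<le> \<eta>' f" and f: "f \<in> polys_over L"
    for \<eta> \<eta>' f
  proof -
    obtain om where om: "valuation om" "\<And>f. f \<in> polys_over L \<Longrightarrow> om f = \<eta> f" "\<And>a. om [:a:] = vbar a"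
      using extend[OF \<eta>(1)] by blast
    obtain om' where om': "valuation om'" "\<And>f. f \<in> polys_over L \<Longrightarrow> om' f = \<eta>' f" "\<And>a. om' [:a:] = vbar a"
      using extend[OF \<eta>(2)] by blast
    have le': "om f \<le> om' f" if "f \<in> polys_over K" for f
      using le[OF that] om(2) om'(2) KL that by auto
    have unique: "om f = om'' f"
      if "valuation om''" "\<And>a. om'' [:a:] = vbar a" "\<And>f. f \<in> polys_over K \<Longrightarrow> om f = om'' f" for om''
      using unique_over_henselization[OF K alg assms(1) vbar om(1,3) that] f unfolding L_def by blast
    have "om f \<le> om' f"
    proof (cases "\<forall>f\<in>polys_over K. om f = om' f")
      case True
      then show ?thesis
        using unique[OF om'(1,3)] by simp
    next
      case False
      interpret vbar: field_valuation vbar by (rule field_valuation.intro) fact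
      obtain \<theta> t where t: "\<And>f. gauss_at vbar \<theta> t f \<le> om' f"
        "\<And>f. f \<in> polys_over K \<Longrightarrow> gauss_at vbar \<theta> t f = om f"
        using gauss_at_interpolation[OF assms(1) K vbar om(1) om'(1) om(3) om'(3) le'] False by blast
      \<comment> \<open>The Gauss valuation agrees with \<open>om\<close> on K[x] and on constants,
        so uniqueness carries the equality over to \<open>f\<close> in K^h[x].\<close>
      have "om f = gauss_at vbar \<theta> t f"
        by (rule unique[OF vbar.valuation_gauss_at]) (simp_all add: t(2))
      then show ?thesis
        using t(1) by simp
    qed
    then show ?thesis
      using om(2) om'(2) f by simp
  qed
  have "inj_on (\<lambda>\<eta>. restrict \<eta> (polys_over K)) ?T"
  proof (rule inj_onI)
    fix \<eta> \<eta>' assume \<eta>: "\<eta> \<in> ?T" "\<eta>' \<in> ?T" and eq: "restrict \<eta> (polys_over K) = restrict \<eta>' (polys_over K)"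
    have eqK: "\<eta> f = \<eta>' f" if "f \<in> polys_over K" for f
      using fun_cong[OF eq, of f] that by simp
    show "\<eta> = \<eta>'"
    proof (rule extensionalityI[of _ "polys_over L"])
      show "\<eta> \<in> extensional (polys_over L)" "\<eta>' \<in> extensional (polys_over L)"
        using \<eta> unfolding T_iff by blast+
      show "\<eta> f = \<eta>' f" if "f \<in> polys_over L" for f
        using mono[OF \<eta> _ that] mono[OF \<eta>(2,1) _ that] eqK by (simp add: order_antisym)
    qed
  qed
  moreover have "?U \<subseteq> (\<lambda>\<eta>. restrict \<eta> (polys_over K)) ` ?T"
  proof
    fix \<mu> assume \<mu>: "\<mu> \<in> ?U"
    then obtain om where om: "valuation om" "\<And>f. f \<in> polys_over K \<Longrightarrow> om f = \<mu> f" "\<And>a. om [:a:] = vbar a"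
      using extension_over_closure[OF assms(1) K alg vbar, of \<mu>] unfolding U_iff by metis
    have "restrict om (polys_over L) \<in> ?T"
      unfolding T_iff using restrict_valuation[of UNIV om L] valuation.valuation_UNIV[OF om(1)] om(3) L(1) by auto
    moreover have "\<mu> = restrict (restrict om (polys_over L)) (polys_over K)"
    proof (rule extensionalityI[of _ "polys_over K"])
      show "\<mu> \<in> extensional (polys_over K)"
        using \<mu> unfolding U_iff by blast
    qed (use om(2) KL in auto)
    ultimately show "\<mu> \<in> (\<lambda>\<eta>. restrict \<eta> (polys_over K)) ` ?T"
      by blast
  qed
  ultimately have "bij_betw (\<lambda>\<eta>. restrict \<eta> (polys_over K)) ?T ?U"
    unfolding bij_betw_def using restrict_U by blast
  moreover have "pointwise_le_on (polys_over L) \<eta> \<eta>' \<longleftrightarrow>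
      pointwise_le_on (polys_over K) (restrict \<eta> (polys_over K)) (restrict \<eta>' (polys_over K))"
    if "\<eta> \<in> ?T" "\<eta>' \<in> ?T" for \<eta> \<eta>'
    using mono[OF that] KL by (auto simp: pointwise_le_on_def)
  ultimately show ?thesis
    unfolding poset_isomorphism_def L_def by blast
qed

end
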